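(* Let $\epsilon_{3}^{1}\geq\epsilon_{3}^{2}$. 1. If $\max\left\{ \frac{1-\epsilon_{34}^{1}}{1-\epsilon_{34}^{2}},\frac{1-\epsilon_{4}^{1}}{1-\epsilon_{4}^{2}}\right\} \leq1$, then the capacity region is the set $\mathcal{R}_1$ of pairs $(R_1,R_2)$ with $R_1,R_2\ge0$ and $$\left(\frac{\epsilon_{3}^{1}-\epsilon_{23}^{1}}{(1-\epsilon_{3}^{2})(1-\epsilon_{23}^{1})}+\frac{1}{1-\epsilon_{23}^{1}}\right)R_{1}+\frac{R_{2}}{1-\epsilon_{34}^{2}}\leq1,\qquad \left(\frac{\epsilon_{34}^{1}-\epsilon_{234}^{1}}{(1-\epsilon_{234}^{1})(1-\epsilon_{34}^{2})}+\frac{1}{1-\epsilon_{23}^{1}}\right)R_{1}+\frac{R_{2}}{1-\epsilon_{4}^{2}}\leq1.$$ 2. If $\max\left\{ \frac{1-\epsilon_{34}^{1}}{1-\epsilon_{34}^{2}},\frac{1-\epsilon_{4}^{1}}{1-\epsilon_{4}^{2}}\right\} =\frac{1-\epsilon_{34}^{1}}{1-\epsilon_{34}^{2}}>1$, then the capacity region is the set $\mathcal{R}_2$ of pairs $(R_1,R_2)$ with $R_1,R_2\ge0$ for which there exists $G\ge0$ with $$G\leq\frac{\epsilon_{34}^{1}-\epsilon_{234}^{1}}{(1-\epsilon_{234}^{1})(1-\epsilon_{34}^{1})}R_{1},$$ $$\left(\frac{\epsilon_{3}^{1}-\epsilon_{23}^{1}}{(1-\epsilon_{3}^{2})(1-\epsilon_{23}^{1})}+\frac{1}{1-\epsilon_{23}^{1}}\right)R_{1}+\frac{R_{2}}{1-\epsilon_{34}^{2}}\leq1-G+\left(\frac{1-\epsilon_{3}^{1}}{1-\epsilon_{3}^{2}}\right)G,$$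 $$\left(\frac{\epsilon_{34}^{1}-\epsilon_{234}^{1}}{(1-\epsilon_{234}^{1})(1-\epsilon_{34}^{2})}+\frac{1}{1-\epsilon_{23}^{1}}\right)R_{1}+\frac{R_{2}}{1-\epsilon_{4}^{2}}\leq1-G+\frac{1-\epsilon_{34}^{1}}{1-\epsilon_{34}^{2}}G.$$ 3. If $\max\left\{ \frac{1-\epsilon_{34}^{1}}{1-\epsilon_{34}^{2}},\frac{1-\epsilon_{4}^{1}}{1-\epsilon_{4}^{2}}\right\} =\frac{1-\epsilon_{4}^{1}}{1-\epsilon_{4}^{2}}>1$, then the capacity region contains the set of all pairs $(R_1,R_2)$ with $R_1,R_2\ge0$ for which there exist $G\ge0$, $S\ge0$, $U\ge0$ satisfying $$\left(\frac{\epsilon_{3}^{1}-\epsilon_{23}^{1}}{(1-\epsilon_{3}^{2})(1-\epsilon_{23}^{1})}+\frac{1}{1-\epsilon_{23}^{1}}\right)R_{1}+\frac{R_{2}}{1-\epsilon_{34}^{2}}\leq1-G-S-U+\left(\frac{1-\epsilon_{3}^{1}}{1-\epsilon_{3}^{2}}\right)(G+S),$$ $$\left(\frac{\epsilon_{34}^{1}-\epsilon_{234}^{1}}{(1-\epsilon_{234}^{1})(1-\epsilon_{34}^{2})}+\frac{1}{1-\epsilon_{23}^{1}}\right)R_{1}+\frac{R_{2}}{1-\epsilon_{4}^{2}}\leq1-G-S-U+\frac{1-\epsilon_{34}^{1}}{1-\epsilon_{34}^{2}}G+\frac{1-\epsilon_{4}^{1}}{1-\epsilon_{4}^{2}}(S+U),$$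 $$(\epsilon_{3}^{2}-\epsilon_{34}^{2})G+(1-\epsilon_{34}^{2})S\leq\frac{(\epsilon_{3}^{2}-\epsilon_{34}^{2})(\epsilon_{34}^{1}-\epsilon_{234}^{1})}{(1-\epsilon_{34}^{1})(1-\epsilon_{234}^{1})}R_{1},$$ $$(\epsilon_{3}^{2}-\epsilon_{34}^{2})U\leq\left(\frac{(1-\epsilon_{4}^{2})(1-\epsilon_{34}^{1})}{1-\epsilon_{4}^{1}}-(\epsilon_{3}^{2}-\epsilon_{34}^{2})\right)S,$$ $$G+\frac{(1-\epsilon_{4}^{1})(1-\epsilon_{34}^{2})}{(1-\epsilon_{4}^{2})(1-\epsilon_{34}^{1})}(U+S)\leq\frac{\epsilon_{34}^{1}-\epsilon_{234}^{1}}{(1-\epsilon_{34}^{1})(1-\epsilon_{234}^{1})}R_{1},$$ $$S\leq\frac{(\epsilon_{3}^{2}-\epsilon_{34}^{2})(\epsilon_{4}^{2}-\epsilon_{34}^{2})}{(1-\epsilon_{34}^{1})(1-\epsilon_{4}^{2})(1-\epsilon_{34}^{2})}R_{2}.$$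
   Context: Network: there are four nodes; node 1 (primary transmitter) has a message for node 3, node 2 (secondary transmitter) has a message for node 4. Let $\mathcal{N}_1=\{2,3,4\}$, $\mathcal{N}_2=\{3,4\}$. Erasures are described by random tuples $\boldsymbol{Z}(t)=(\boldsymbol{Z}_1(t),\boldsymbol{Z}_2(t))$, $t=1,2,\dots$, with $\boldsymbol{Z}_i(t)=(Z_{ij}(t))_{j\in\mathcal{N}_i}$, $Z_{ij}(t)\in\{0,1\}$: a symbol transmitted by node $i$ at time $t$ is received by node $j\in\mathcal N_i$ if $Z_{ij}(t)=1$ and erased if $Z_{ij}(t)=0$. The tuples $\boldsymbol{Z}(t)$ are independent over $t$; for fixed $t$ the components may be arbitrarily dependent. For $\mathcal{S}\subseteq\mathcal{N}_i$, $\epsilon^i_{\mathcal{S}}=\Pr(Z_{ij}(t)=0\ \forall j\in\mathcal{S})$, which does not depend on $t$; e.g. $\epsilon_{23}^1=\epsilon^1_{\{2,3\}}$. It is assumed that $\epsilon^1_{23},\epsilon^2_3,\epsilon^2_4<1$. Scheduling and feedback: at each time $t\ge1$ exactly one node $\sigma(t)\in\{1,2\}$ transmits, and afterwards all nodes learn $\boldsymbol{Z}_{\sigma(t)}(t)$. Write $\boldsymbol{Z}^{t}=(\boldsymbol{Z}_{\sigma(s)}(s))_{s=1}^{t}$. $\sigma(1)$ is a fixed element, and $\sigma(t)=\sigma(\boldsymbol{Z}^{t-1})$ is a function of $\boldsymbol{Z}^{t-1}$ for $t\ge2$. Symbols ("packets") are elements of a finite field $\mathcal{F}$. $X_i(t)\in\mathcal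 F$ is the symbol transmitted by node $i$ at time $t$ ($X_i(t)=\eta$, a null symbol, if $\sigma(t)\ne i$). $Y_{ij}(t)$ is what node $j\in\mathcal{N}_i$ receives from node $i$ at time $t$: $X_i(t)$ if $\sigma(t)=i$ and $Z_{ij}(t)=1$, the erasure symbol $\varepsilon$ if $\sigma(t)=i$ and $Z_{ij}(t)=0$, and $\eta$ if $\sigma(t)\neq i$. For $\mathcal S\subseteq\mathcal N_i$, $\boldsymbol{Y}_{i\mathcal{S}}(t)=(Y_{ij}(t))_{j\in\mathcal{S}}$, and a superscript $t$ denotes the sequence over times $1,\dots,t$. Codes: a channel code $C_n$ of rate $\boldsymbol{R}=(R_1,R_2)$, $R_i\ge0$, uses $n$ transmissions and consists of: independent messages $\boldsymbol{W}_1,\boldsymbol{W}_2$, where $\boldsymbol{W}_i=(W_{i,1},\dots,W_{i,\lceil nR_i\rceil})$ has i.i.d. entries uniform on $\mathcal{F}$, independent of all $\boldsymbol{Z}(t)$; a scheduling rule $\sigma$; encoders: if $\sigma(t)=2$ then $X_2(t)=f_{2,n}(\boldsymbol{W}_2,\boldsymbol{Y}_{1\{2\}}^{t-1},\boldsymbol{Z}^{t-1})$ with $f_{2,n}$ arbitrary, and if $\sigma(t)=1$ then $X_1(t)=W_{1,J_n(t)}$, where the index $J_n(t)=J_n(\boldsymbol{Z}^{t-1})$ depends only on feedback ($J_n(1)$ is fixed); decoders $\hat{\boldsymbol{W}}_{j-2}=g_{j,n}(\boldsymbol{Y}_{1\{j\}}^n,\boldsymbol{Y}_{2\{j\}}^n,\boldsymbol{Z}^n)$,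 $j\in\{3,4\}$. The error probability is $\lambda_n=\Pr(\hat{\boldsymbol{W}}_1\ne\boldsymbol{W}_1\text{ or }\hat{\boldsymbol{W}}_2\neq\boldsymbol{W}_2)$. $\boldsymbol{R}$ is achievable if there is a sequence of codes $C_n$ of rate $\boldsymbol{R}$ with $\lim_{n\to\infty}\lambda_n=0$. The capacity region is the closure of the set of all achievable rate vectors. *)

theory Defs
  imports "HOL-Probability.Probability"
begin

datatype node = N1 | N2 | N3 | N4

instance node :: finite
proof
  show "finite (UNIV :: node set)"
  proof (rule finite_subset)
    show "(UNIV :: node set) \<subseteq> {N1, N2, N3, N4}"
      by (auto intro: node.exhaust)
  qed simp
qed

fun nbrs :: "node \<Rightarrow> node set" where
  "nbrs N1 = {N2, N3, N4}"
| "nbrs N2 = {N3, N4}"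
| "nbrs N3 = {}"
| "nbrs N4 = {}"

text \<open>\<open>z i j\<close> stands for \<open>Z_ij(t) = 1\<close> (reception). Only the entries with
  \<open>j \<in> nbrs i\<close> exist in the model; \<open>link_state\<close> forgets all others, so that
  \<open>link_state z i\<close> is the tuple \<open>Z_i(t)\<close> and \<open>link_state z\<close> is \<open>Z(t)\<close>.\<close>

definition link_state :: "(node \<Rightarrow> node \<Rightarrow> bool) \<Rightarrow> node \<Rightarrow> node \<Rightarrow> bool" where
  "link_state z = (\<lambda>i j. j \<in> nbrs i \<and> z i j)"

text \<open>Independence is over \<open>t\<close> only: for fixed \<open>t\<close> the components are arbitrarily dependent,
  and the joint law of \<open>(Z_1(t), Z_2(t))\<close> may vary with \<open>t\<close> as long as the erasure
  probabilities do not.\<close>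

locale erasure_network = prob_space M
  for M :: "'a measure" +
  fixes Z :: "nat \<Rightarrow> 'a \<Rightarrow> node \<Rightarrow> node \<Rightarrow> bool"
    and eps :: "node \<Rightarrow> node set \<Rightarrow> real"
  assumes indep_Z: "indep_vars (\<lambda>_. count_space UNIV) (\<lambda>t \<omega>. link_state (Z t \<omega>)) {1..}"
    and eps: "\<And>t i S. t \<ge> 1 \<Longrightarrow> i \<in> {N1, N2} \<Longrightarrow> S \<subseteq> nbrs i \<Longrightarrow>
      prob {\<omega> \<in> space M. \<forall>j\<in>S. \<not> Z t \<omega> i j} = eps i S"
    and eps_less_1: "eps N1 {N2, N3} < 1" "eps N2 {N3} < 1" "eps N2 {N4} < 1"

datatype 'f signal = Packet 'f | Erased | Null

text \<open>A feedback history is the list of the tuples \<open>Z_\<sigma>(s)(s)\<close>, oldest first; a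
  history of length \<open>t - 1\<close> determines the action at time \<open>t\<close>.\<close>

type_synonym history = "(node \<Rightarrow> bool) list"

record 'f channel_code =
  sched :: "history \<Rightarrow> node"
  index :: "history \<Rightarrow> nat"
  enc2 :: "'f list \<Rightarrow> 'f signal list \<Rightarrow> history \<Rightarrow> 'f"
  dec3 :: "'f signal list \<Rightarrow> 'f signal list \<Rightarrow> history \<Rightarrow> 'f list"
  dec4 :: "'f signal list \<Rightarrow> 'f signal list \<Rightarrow> history \<Rightarrow> 'f list"

definition num_packets :: "nat \<Rightarrow> real \<Rightarrow> nat" where
  "num_packets n r = nat \<lceil>real n * r\<rceil>"

text \<open>Packets of \<open>W_1\<close> are indexed from 0. If \<open>W_1\<close> has no packets, node 1 has nothing to
  send and cannot be scheduled.\<close>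

definition is_code :: "nat \<Rightarrow> real \<times> real \<Rightarrow> 'f channel_code \<Rightarrow> bool" where
  "is_code n R c \<longleftrightarrow>
    (\<forall>h. length h < n \<longrightarrow>
      sched c h \<in> {N1, N2} \<and>
      (sched c h = N1 \<longrightarrow> index c h < num_packets n (fst R)))"

text \<open>Below, \<open>z\<close> is a realization of the erasure process and \<open>w1\<close>, \<open>w2\<close> of the messages.
  \<open>feedback c z t\<close> is \<open>Z^t\<close>.\<close>

primrec feedback :: "'f channel_code \<Rightarrow> (nat \<Rightarrow> node \<Rightarrow> node \<Rightarrow> bool) \<Rightarrow> nat \<Rightarrow> history" where
  "feedback c z 0 = []"
| "feedback c z (Suc t) =
    feedback c z t @ [link_state (z (Suc t)) (sched c (feedback c z t))]"

definition sender :: "'f channel_code \<Rightarrow> (nat \<Rightarrow> node \<Rightarrow> node \<Rightarrow> bool) \<Rightarrow> nat \<Rightarrow> node" where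
  "sender c z t = sched c (feedback c z (t - 1))"

definition channel_out :: "'f channel_code \<Rightarrow> (nat \<Rightarrow> node \<Rightarrow> node \<Rightarrow> bool) \<Rightarrow>
    (nat \<Rightarrow> 'f signal) \<Rightarrow> node \<Rightarrow> node \<Rightarrow> nat \<Rightarrow> 'f signal" where
  "channel_out c z x i j t =
    (if sender c z t \<noteq> i then Null
     else if link_state (z t) i j then x t else Erased)"

definition X1 :: "'f channel_code \<Rightarrow> (nat \<Rightarrow> node \<Rightarrow> node \<Rightarrow> bool) \<Rightarrow> 'f list \<Rightarrow>
    nat \<Rightarrow> 'f signal" where
  "X1 c z w1 t =
    (if sender c z t = N1 then Packet (w1 ! index c (feedback c z (t - 1))) else Null)"

definition Y1 :: "'f channel_code \<Rightarrow> (nat \<Rightarrow> node \<Rightarrow> node \<Rightarrow> bool) \<Rightarrow> 'f list \<Rightarrow>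
    node \<Rightarrow> nat \<Rightarrow> 'f signal list" where
  "Y1 c z w1 j t = map (channel_out c z (X1 c z w1) N1 j) [1..<Suc t]"

definition X2 :: "'f channel_code \<Rightarrow> (nat \<Rightarrow> node \<Rightarrow> node \<Rightarrow> bool) \<Rightarrow> 'f list \<Rightarrow> 'f list \<Rightarrow>
    nat \<Rightarrow> 'f signal" where
  "X2 c z w1 w2 t =
    (if sender c z t = N2
     then Packet (enc2 c w2 (Y1 c z w1 N2 (t - 1)) (feedback c z (t - 1)))
     else Null)"

definition Y2 :: "'f channel_code \<Rightarrow> (nat \<Rightarrow> node \<Rightarrow> node \<Rightarrow> bool) \<Rightarrow> 'f list \<Rightarrow> 'f list \<Rightarrow>
    node \<Rightarrow> nat \<Rightarrow> 'f signal list" where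
  "Y2 c z w1 w2 j t = map (channel_out c z (X2 c z w1 w2) N2 j) [1..<Suc t]"

definition decoding_error :: "nat \<Rightarrow> 'f channel_code \<Rightarrow> (nat \<Rightarrow> node \<Rightarrow> node \<Rightarrow> bool) \<Rightarrow>
    'f list \<Rightarrow> 'f list \<Rightarrow> bool" where
  "decoding_error n c z w1 w2 \<longleftrightarrow>
    dec3 c (Y1 c z w1 N3 n) (Y2 c z w1 w2 N3 n) (feedback c z n) \<noteq> w1 \<or>
    dec4 c (Y1 c z w1 N4 n) (Y2 c z w1 w2 N4 n) (feedback c z n) \<noteq> w2"

text \<open>A uniform list of length \<open>k\<close> over the finite field has i.i.d. uniform entries; the product
  measures make the two messages and the erasure process independent.\<close>

definition message_pmf :: "nat \<Rightarrow> 'f::{field, finite} list pmf" where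
  "message_pmf k = pmf_of_set {w. length w = k}"

definition error_prob :: "'a measure \<Rightarrow> (nat \<Rightarrow> 'a \<Rightarrow> node \<Rightarrow> node \<Rightarrow> bool) \<Rightarrow>
    nat \<Rightarrow> real \<times> real \<Rightarrow> 'f::{field, finite} channel_code \<Rightarrow> real" where
  "error_prob M Z n R c =
    (let P = M \<Otimes>\<^sub>M measure_pmf (pair_pmf (message_pmf (num_packets n (fst R)))
                                      (message_pmf (num_packets n (snd R))))
     in measure P {(\<omega>, w1, w2) \<in> space P. decoding_error n c (\<lambda>t. Z t \<omega>) w1 w2})"

definition achievable :: "'f::{field, finite} itself \<Rightarrow> 'a measure \<Rightarrow>
    (nat \<Rightarrow> 'a \<Rightarrow> node \<Rightarrow> node \<Rightarrow> bool) \<Rightarrow> real \<times> real \<Rightarrow> bool" where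
  "achievable F M Z R \<longleftrightarrow>
    fst R \<ge> 0 \<and> snd R \<ge> 0 \<and>
    (\<exists>C :: nat \<Rightarrow> 'f channel_code.
      (\<forall>n\<ge>1. is_code n R (C n)) \<and> (\<lambda>n. error_prob M Z n R (C n)) \<longlonglongrightarrow> 0)"

definition capacity_region :: "'f::{field, finite} itself \<Rightarrow> 'a measure \<Rightarrow>
    (nat \<Rightarrow> 'a \<Rightarrow> node \<Rightarrow> node \<Rightarrow> bool) \<Rightarrow> (real \<times> real) set" where
  "capacity_region F M Z = closure {R. achievable F M Z R}"

end

theory Submission
  imports Defs
begin

text \<open>
  Achievability. Node 1 sends each packet until node 2 or node 3 has it; node 2 takes over the packets
  that node 3 lacks and sends its own packets until node 3 or node 4 has them. Packets known to the
  wrong receiver are finally sent as sums of one packet for each receiver. In the time \<open>G\<close> node 1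
  itself repeats packets that only node 2 knows. For \<open>S\<close> and \<open>U\<close>, node 2 sends sums early; if
  node 4 holds such a sum, an uncoded repetition of its \<open>W_1\<close>-packet by node 1 serves node 4, and node 3
  as well if it lacks that packet. All senders follow a fixed time table, so along almost every sequence
  of erasures the queue lengths, divided by \<open>n\<close>, converge to the solution of a linear flow problem.

  Outer bound. For a fixed sequence of erasures the messages are uniform on a finite set, and the
  entropies of the received symbols satisfy the chain rule slot by slot; the expectation over the
  erasures turns reception into factors \<open>1 - \<epsilon>\<close>. Fano's inequality bounds the rates. As node 1 sends
  uncoded packets, its slots can be counted: it repeats each packet until node 2 or node 3 has it, and
  a repetition of a packet that node 4 has already received brings nothing to node 4. What node 4 learns
  about \<open>W_2\<close> from uncoded \<open>W_1\<close>-packets is limited, since \<open>W_1\<close> and \<open>W_2\<close> are independent, by the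
  \<open>W_1\<close>-entropy in the sums it received from node 2.
\<close>

section \<open>The coding scheme\<close>

text \<open>With a fixed time table the queue lengths after a phase depend only on counts of
  reception patterns in a deterministic window, so no random stopping times arise. The price is a
  mismatch of o(n) packets or idle slots at the end of each phase. Decoding requires queues that are
  literally empty, hence the short clearing phases; the time for them comes from making the rate
  constraints strict. Strictness is bought by moving toward a point \<open>(\<eta>, 0)\<close> with
  positive first rate, which also avoids an empty \<open>W_1\<close>, for which node 1 could not
  transmit at all; the closure in the definition of the region pays for this. In the outer bound the
  time G of the second region has to be extracted from an arbitrary code for each n. Such witnesses
  need not converge, and the region is a projection whose closedness is not evident; both
  difficulties disappear by passing to the least admissible G, a continuous function of the
  rates.\<close>

type_synonym erasures = "nat \<Rightarrow> node \<Rightarrow> node \<Rightarrow> bool"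

text \<open>Except in the last phase, which serves two queues at once, each phase serves one kind of packet;
  the suffix tells which node transmits. In phase \<open>Mix\<close> node 2 sends sums of a packet of \<open>W_1\<close>
  and a packet of \<open>W_2\<close>.\<close>

datatype phase = New1 | At4 | At2_by1 | At2_by2 | New2 | Mix | Pend_by1 | Link | Pend_by2 | Final

fun tx :: "phase \<Rightarrow> node" where
  "tx New1 = N1" | "tx At4 = N1" | "tx At2_by1 = N1" | "tx At2_by2 = N2" | "tx New2 = N2"
| "tx Mix = N2" | "tx Pend_by1 = N1" | "tx Link = N1" | "tx Pend_by2 = N2" | "tx Final = N2"

text \<open>The first four queues hold packets of \<open>W_1\<close> that node 3 lacks: \<open>at2\<close>, \<open>at4\<close> and \<open>at24\<close> name
  the other nodes that have them, and nobody has those in \<open>new1\<close>. A pair \<open>(i, j)\<close> in \<open>pend\<close> means that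
  node 4 has the sum of \<open>W_1\<close>-packet \<open>i\<close> and \<open>W_2\<close>-packet \<open>j\<close>, and that node 3 has \<open>j\<close> but lacks \<open>i\<close>;
  in \<open>link\<close> node 3 has both. Hence node 4 recovers \<open>j\<close> from an uncoded transmission of \<open>i\<close> by node 1.
  The packets of \<open>W_2\<close> in \<open>at3\<close> are known to node 3 but not to node 4.\<close>

record queues =
  new1 :: "nat list"
  at4 :: "nat list"
  at2 :: "nat list"
  at24 :: "nat list"
  pend :: "(nat \<times> nat) list"
  link :: "(nat \<times> nat) list"
  new2 :: "nat list"
  at3 :: "nat list"

text \<open>When \<open>at3\<close> runs empty, \<open>Mix\<close> continues with uncoded packets, so that \<open>at2\<close> is served at the
  same rate throughout the phase.\<close>

fun step :: "phase \<Rightarrow> (node \<Rightarrow> bool) \<Rightarrow> queues \<Rightarrow> queues" where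
  "step New1 r q = (case new1 q of [] \<Rightarrow> q | i # is \<Rightarrow>
     if r N3 then q\<lparr>new1 := is\<rparr>
     else if r N2 \<and> r N4 then q\<lparr>new1 := is, at24 := i # at24 q\<rparr>
     else if r N2 then q\<lparr>new1 := is, at2 := i # at2 q\<rparr>
     else if r N4 then q\<lparr>new1 := is, at4 := i # at4 q\<rparr>
     else q)"
| "step At4 r q = (case at4 q of [] \<Rightarrow> q | i # is \<Rightarrow>
     if r N3 then q\<lparr>at4 := is\<rparr>
     else if r N2 then q\<lparr>at4 := is, at24 := i # at24 q\<rparr>
     else q)"
| "step At2_by1 r q = (case at2 q of [] \<Rightarrow> q | i # is \<Rightarrow>
     if r N3 then q\<lparr>at2 := is\<rparr>
     else if r N4 then q\<lparr>at2 := is, at24 := i # at24 q\<rparr>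
     else q)"
| "step At2_by2 r q = (case at2 q of [] \<Rightarrow> q | i # is \<Rightarrow>
     if r N3 then q\<lparr>at2 := is\<rparr>
     else if r N4 then q\<lparr>at2 := is, at24 := i # at24 q\<rparr>
     else q)"
| "step New2 r q = (case new2 q of [] \<Rightarrow> q | j # js \<Rightarrow>
     if r N4 then q\<lparr>new2 := js\<rparr>
     else if r N3 then q\<lparr>new2 := js, at3 := j # at3 q\<rparr>
     else q)"
| "step Mix r q = (case at2 q of [] \<Rightarrow> q | i # is \<Rightarrow>
     (case at3 q of
        [] \<Rightarrow>
          if r N3 then q\<lparr>at2 := is\<rparr>
          else if r N4 then q\<lparr>at2 := is, at24 := i # at24 q\<rparr>
          else q
      | j # js \<Rightarrow>
          if r N3 \<and> r N4 then q\<lparr>at2 := is, at3 := js, link := (i, j) # link q\<rparr>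
          else if r N3 then q\<lparr>at2 := is\<rparr>
          else if r N4 then q\<lparr>at2 := is, at3 := js, pend := (i, j) # pend q\<rparr>
          else q))"
| "step Pend_by1 r q = (case pend q of [] \<Rightarrow> q | (i, j) # ps \<Rightarrow>
     if r N3 \<and> r N4 then q\<lparr>pend := ps\<rparr>
     else if r N4 then q\<lparr>pend := ps, at24 := i # at24 q\<rparr>
     else if r N3 then q\<lparr>pend := ps, link := (i, j) # link q\<rparr>
     else q)"
| "step Link r q = (case link q of [] \<Rightarrow> q | _ # ps \<Rightarrow> if r N4 then q\<lparr>link := ps\<rparr> else q)"
| "step Pend_by2 r q = (case pend q of [] \<Rightarrow> q | ij # ps \<Rightarrow>
     if r N3 then q\<lparr>pend := ps, link := ij # link q\<rparr> else q)"
| "step Final r q =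
     (let q' = (if r N3 then q\<lparr>at24 := tl (at24 q)\<rparr> else q)
      in if r N4 then (if at3 q = [] then q'\<lparr>link := tl (link q)\<rparr> else q'\<lparr>at3 := tl (at3 q)\<rparr>)
         else q')"

text \<open>An idle slot of node 1 still has to name a packet. The filler 0 is a legal index as soon
  as \<open>W_1\<close> is nonempty, and repeating packet 0 leaves the queues alone.\<close>

fun slot_index :: "phase \<Rightarrow> queues \<Rightarrow> nat" where
  "slot_index New1 q = (if new1 q = [] then 0 else hd (new1 q))"
| "slot_index At4 q = (if at4 q = [] then 0 else hd (at4 q))"
| "slot_index At2_by1 q = (if at2 q = [] then 0 else hd (at2 q))"
| "slot_index Pend_by1 q = (if pend q = [] then 0 else fst (hd (pend q)))"
| "slot_index Link q = (if link q = [] then 0 else fst (hd (link q)))"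
| "slot_index _ q = 0"

text \<open>The last clause covers the phases of node 1, so that one function describes both
  senders.\<close>

fun symbol :: "phase \<Rightarrow> queues \<Rightarrow> 'f::field list \<Rightarrow> 'f list \<Rightarrow> 'f" where
  "symbol At2_by2 q w1 w2 = (if at2 q = [] then 0 else w1 ! hd (at2 q))"
| "symbol New2 q w1 w2 = (if new2 q = [] then 0 else w2 ! hd (new2 q))"
| "symbol Mix q w1 w2 =
     (if at2 q = [] then 0
      else w1 ! hd (at2 q) + (if at3 q = [] then 0 else w2 ! hd (at3 q)))"
| "symbol Pend_by2 q w1 w2 = (if pend q = [] then 0 else w1 ! fst (hd (pend q)))"
| "symbol Final q w1 w2 =
     (if at24 q = [] then 0 else w1 ! hd (at24 q))
     + (if at3 q \<noteq> [] then w2 ! hd (at3 q)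
        else if link q \<noteq> [] then w2 ! snd (hd (link q)) else 0)"
| "symbol ph q w1 w2 = w1 ! slot_index ph q"

lemma symbol_by1: "tx ph = N1 \<Longrightarrow> symbol ph q w1 w2 = w1 ! slot_index ph q"
  by (cases ph) auto

definition init_queues :: "nat \<Rightarrow> nat \<Rightarrow> queues" where
  "init_queues K1 K2 = \<lparr>new1 = [0..<K1], at4 = [], at2 = [], at24 = [], pend = [], link = [],
     new2 = [0..<K2], at3 = []\<rparr>"

definition empty_queues :: queues where
  "empty_queues = \<lparr>new1 = [], at4 = [], at2 = [], at24 = [], pend = [], link = [], new2 = [], at3 = []\<rparr>"

primrec evolve :: "(nat \<Rightarrow> phase) \<Rightarrow> queues \<Rightarrow> (nat \<Rightarrow> node \<Rightarrow> bool) \<Rightarrow> nat \<Rightarrow> queues" where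
  "evolve ph q r 0 = q"
| "evolve ph q r (Suc t) = step (ph t) (r t) (evolve ph q r t)"

lemma evolve_cong: "(\<And>s. s < t \<Longrightarrow> r s = r' s) \<Longrightarrow> evolve ph q r t = evolve ph q r' t"
  by (induction t) auto

section \<open>Invariants of the queues\<close>

definition indices_below :: "nat \<Rightarrow> queues \<Rightarrow> bool" where
  "indices_below K q \<longleftrightarrow>
     set (new1 q) \<union> set (at4 q) \<union> set (at2 q) \<union> set (at24 q) \<union> fst ` set (pend q)
       \<union> fst ` set (link q) \<subseteq> {..<K}"

lemma set_tl_subset: "set (tl xs) \<subseteq> set xs"
  by (cases xs) auto

lemma indices_below_step: "indices_below K q \<Longrightarrow> indices_below K (step ph r q)"
  using set_tl_subset[of "link q"] set_tl_subset[of "at24 q"]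
  by (cases ph) (auto simp: indices_below_def Let_def image_subset_iff split: list.splits if_splits)

lemma indices_below_evolve: "indices_below K1 (evolve ph (init_queues K1 K2) r t)"
proof (induction t)
  case 0 show ?case by (auto simp: indices_below_def init_queues_def)
qed (simp add: indices_below_step)

lemma slot_index_less: "indices_below K q \<Longrightarrow> K > 0 \<Longrightarrow> slot_index ph q < K"
  by (cases ph) (auto simp: indices_below_def image_subset_iff neq_Nil_conv)

text \<open>What a node knows is expressed by comparing two pairs of messages that it cannot tell apart.\<close>

definition agree3 :: "nat \<Rightarrow> 'f list \<Rightarrow> 'f list \<Rightarrow> 'f list \<Rightarrow> 'f list \<Rightarrow> queues \<Rightarrow> bool" where
  "agree3 K w1 w2 v1 v2 q \<longleftrightarrow>
     (\<forall>i<K. w1 ! i = v1 ! i \<or>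
        i \<in> set (new1 q) \<union> set (at4 q) \<union> set (at2 q) \<union> set (at24 q) \<union> fst ` set (pend q)) \<and>
     (\<forall>j \<in> set (at3 q) \<union> snd ` set (pend q) \<union> snd ` set (link q). w2 ! j = v2 ! j)"

text \<open>The invariant leaves at most one undetermined packet in any symbol that node 3 receives:
  the \<open>W_2\<close> summand of a sum comes from \<open>at3\<close> or \<open>link\<close>,
  where both message pairs agree, so it cancels and the \<open>W_1\<close> summands agree as
  well.\<close>

lemma agree3_step:
  fixes w1 :: "'f::field list"
  assumes "agree3 K w1 w2 v1 v2 q"
    and "r N3 \<Longrightarrow> symbol ph q w1 w2 = symbol ph q v1 v2"
  shows "agree3 K w1 w2 v1 v2 (step ph r q)"
proof (cases ph)
  case Final
  then show ?thesis using assms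
    apply (cases "at24 q"; cases "at3 q"; cases "link q")
    by (auto simp: agree3_def Let_def)
qed (use assms in \<open>auto simp: agree3_def split: list.splits if_splits; metis\<close>)+

definition agree4 :: "nat \<Rightarrow> 'f::field list \<Rightarrow> 'f list \<Rightarrow> 'f list \<Rightarrow> 'f list \<Rightarrow> queues \<Rightarrow> bool" where
  "agree4 K w1 w2 v1 v2 q \<longleftrightarrow>
     (\<forall>j<K. w2 ! j = v2 ! j \<or>
        j \<in> set (new2 q) \<union> set (at3 q) \<union> snd ` set (pend q) \<union> snd ` set (link q)) \<and>
     (\<forall>i \<in> set (at4 q) \<union> set (at24 q). w1 ! i = v1 ! i) \<and>
     (\<forall>(i, j) \<in> set (pend q) \<union> set (link q). w1 ! i + w2 ! j = v1 ! i + v2 ! j)"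

text \<open>Dual to node 3, with one twist: pairs in \<open>pend\<close> and \<open>link\<close> are
  known to node 4 only as sums, so an uncoded \<open>i\<close> yields \<open>j\<close> by
  subtraction. In \<open>Final\<close> the \<open>at24\<close> summand is known to node 4 and
  cancels.\<close>

lemma agree4_step:
  fixes w1 :: "'f::field list"
  assumes "agree4 K w1 w2 v1 v2 q"
    and "r N4 \<Longrightarrow> symbol ph q w1 w2 = symbol ph q v1 v2"
  shows "agree4 K w1 w2 v1 v2 (step ph r q)"
proof (cases ph)
  case Final
  then show ?thesis using assms
    apply (cases "at24 q"; cases "at3 q"; cases "link q")
    by (auto simp: agree4_def Let_def)
qed (use assms in \<open>auto simp: agree4_def split: list.splits if_splits; metis\<close>)+

text \<open>\<open>link\<close> is absent because node 2 sends only the \<open>W_2\<close> component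
  of a pair in \<open>link\<close>.\<close>

definition known2 :: "queues \<Rightarrow> nat set" where
  "known2 q = set (at2 q) \<union> set (at24 q) \<union> fst ` set (pend q)"

lemma known2_step:
  "known2 (step ph r q) \<subseteq> known2 q \<union> (if tx ph = N1 \<and> r N2 then {slot_index ph q} else {})"
  using set_tl_subset[of "at24 q"]
  by (cases ph) (auto simp: known2_def Let_def image_iff split: list.splits if_splits)

lemma symbol_cong:
  assumes "tx ph = N2" "\<And>i. i \<in> known2 q \<Longrightarrow> w1 ! i = v1 ! i"
  shows "symbol ph q w1 w2 = symbol ph q v1 w2"
  using assms by (cases ph) (auto simp: known2_def)

text \<open>A function of the feedback alone, so every node can follow the queues without knowing
  any packet.\<close>

definition queues_after :: "nat \<Rightarrow> nat \<Rightarrow> (nat \<Rightarrow> phase) \<Rightarrow> history \<Rightarrow> queues" where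
  "queues_after K1 K2 ph h = evolve ph (init_queues K1 K2) (nth h) (length h)"

definition sent :: "nat \<Rightarrow> nat \<Rightarrow> (nat \<Rightarrow> phase) \<Rightarrow> history \<Rightarrow> 'f::field list \<Rightarrow> 'f list \<Rightarrow> nat \<Rightarrow> 'f" where
  "sent K1 K2 ph h w1 w2 s = symbol (ph s) (queues_after K1 K2 ph (take s h)) w1 w2"

definition received :: "nat \<Rightarrow> nat \<Rightarrow> (nat \<Rightarrow> phase) \<Rightarrow> history \<Rightarrow> 'f::field list \<Rightarrow> 'f list \<Rightarrow>
    node \<Rightarrow> node \<Rightarrow> 'f signal list" where
  "received K1 K2 ph h w1 w2 i j =
     map (\<lambda>s. if tx (ph s) \<noteq> i then Null
              else if (h ! s) j then Packet (sent K1 K2 ph h w1 w2 s) else Erased) [0..<length h]"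

definition consistent :: "nat \<Rightarrow> nat \<Rightarrow> (nat \<Rightarrow> phase) \<Rightarrow> node \<Rightarrow> 'f::field signal list \<Rightarrow>
    'f signal list \<Rightarrow> history \<Rightarrow> 'f list \<Rightarrow> 'f list \<Rightarrow> bool" where
  "consistent K1 K2 ph j y1 y2 h w1 w2 \<longleftrightarrow> length w1 = K1 \<and> length w2 = K2 \<and>
     received K1 K2 ph h w1 w2 N1 j = y1 \<and> received K1 K2 ph h w1 w2 N2 j = y2"

text \<open>Node 2 and the decoders work with an arbitrary choice among the messages consistent with what they
  have received; the symbol that node 2 has to send does not depend on this choice, and neither does
  the decoded message once all queues are empty.\<close>

definition scheme_code :: "nat \<Rightarrow> nat \<Rightarrow> (nat \<Rightarrow> phase) \<Rightarrow> 'f::field channel_code" where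
  "scheme_code K1 K2 ph = \<lparr>
     sched = (\<lambda>h. tx (ph (length h))),
     index = (\<lambda>h. slot_index (ph (length h)) (queues_after K1 K2 ph h)),
     enc2 = (\<lambda>w2 y h. symbol (ph (length h)) (queues_after K1 K2 ph h)
               (SOME w1. received K1 K2 ph h w1 w2 N1 N2 = y) w2),
     dec3 = (\<lambda>y1 y2 h. SOME w1. \<exists>w2. consistent K1 K2 ph N3 y1 y2 h w1 w2),
     dec4 = (\<lambda>y1 y2 h. SOME w2. \<exists>w1. consistent K1 K2 ph N4 y1 y2 h w1 w2)\<rparr>"

lemma tx_cases: "tx ph = N1 \<or> tx ph = N2"
  by (cases ph) auto

lemma scheme_code_is_code:
  assumes "num_packets n (fst R) > 0"
  shows "is_code n R (scheme_code (num_packets n (fst R)) K2 ph)"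
  unfolding is_code_def scheme_code_def queues_after_def
  using tx_cases slot_index_less[OF indices_below_evolve assms] by auto

lemma queues_after_take:
  assumes "s \<le> length h"
  shows "queues_after K1 K2 ph (take s h) = evolve ph (init_queues K1 K2) (nth h) s"
  unfolding queues_after_def using assms by (auto simp: min_def intro!: evolve_cong)

lemma known2_received:
  assumes "t \<le> length h" "i \<in> known2 (queues_after K1 K2 ph (take t h))"
  shows "\<exists>s<t. tx (ph s) = N1 \<and> (h ! s) N2 \<and>
    slot_index (ph s) (queues_after K1 K2 ph (take s h)) = i"
  using assms
proof (induction t)
  case 0
  then show ?case by (simp add: queues_after_def init_queues_def known2_def)
next
  case (Suc t)
  let ?q = "queues_after K1 K2 ph (take t h)"
  have "queues_after K1 K2 ph (take (Suc t) h) = step (ph t) (h ! t) ?q"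
    using Suc.prems(1) queues_after_take[of "Suc t" h] queues_after_take[of t h] by simp
  then have "i \<in> known2 ?q \<or> tx (ph t) = N1 \<and> (h ! t) N2 \<and> i = slot_index (ph t) ?q"
    using Suc.prems(2) known2_step[of "ph t" "h ! t" ?q] by (auto split: if_splits)
  then show ?case using Suc by (auto intro: less_SucI)
qed

text \<open>This makes the arbitrary choice in \<open>enc2\<close> harmless: every
  \<open>W_1\<close> position that node 2 reads lies in \<open>known2\<close>, which a packet enters
  only after node 2 has received it uncoded, so all candidates that explain the observations of node
  2 give the same symbol.\<close>

lemma sent_cong_N2:
  fixes w1 v1 :: "'f::field list"
  assumes "received K1 K2 ph h w1 w2 N1 N2 = received K1 K2 ph h v1 v2 N1 N2" "tx (ph (length h)) = N2"
  shows "symbol (ph (length h)) (queues_after K1 K2 ph h) w1 u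
    = symbol (ph (length h)) (queues_after K1 K2 ph h) v1 u"
proof (rule symbol_cong[OF assms(2)])
  fix i assume "i \<in> known2 (queues_after K1 K2 ph h)"
  then obtain s where s: "s < length h" "tx (ph s) = N1" "(h ! s) N2"
    and i: "slot_index (ph s) (queues_after K1 K2 ph (take s h)) = i"
    using known2_received[of "length h" h i K1 K2 ph] by auto
  have "received K1 K2 ph h w1 w2 N1 N2 ! s = received K1 K2 ph h v1 v2 N1 N2 ! s"
    using assms(1) by simp
  then show "w1 ! i = v1 ! i"
    using s i by (simp add: received_def sent_def symbol_by1)
qed

lemma feedback_scheme:
  "feedback (scheme_code K1 K2 ph) z t = map (\<lambda>s. link_state (z (Suc s)) (tx (ph s))) [0..<t]"
  by (induction t) (auto simp: scheme_code_def)

lemma take_feedback: "s \<le> t \<Longrightarrow> take s (feedback c z t) = feedback c z s"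
proof (induction t)
  case (Suc t)
  have "length (feedback c z t) = t" for t by (induction t) auto
  then show ?case using Suc by (cases "s = Suc t") auto
qed auto

lemma length_feedback [simp]: "length (feedback c z t) = t"
  by (induction t) auto

lemma nth_feedback: "s < t \<Longrightarrow> feedback c z t ! s = link_state (z (Suc s)) (sender c z (Suc s))"
  by (induction t) (auto simp: nth_append less_Suc_eq sender_def)

lemma sender_scheme: "sender (scheme_code K1 K2 ph) z (Suc s) = tx (ph s)"
  by (simp add: sender_def) (simp add: scheme_code_def)

lemma map_upt_shift: "map f [1..<Suc t] = map (\<lambda>s. f (Suc s)) [0..<t]"
  by (induction t) auto

lemma Y1_scheme:
  fixes w1 w2 :: "'f::field list"
  shows "Y1 (scheme_code K1 K2 ph) z w1 j t =
    received K1 K2 ph (feedback (scheme_code K1 K2 ph :: 'f channel_code) z t) w1 w2 N1 j"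
proof -
  let ?c = "scheme_code K1 K2 ph :: 'f channel_code"
  have "channel_out ?c z (X1 ?c z w1) N1 j (Suc s) =
      (if tx (ph s) \<noteq> N1 then Null
       else if (feedback ?c z t ! s) j
            then Packet (sent K1 K2 ph (feedback ?c z t) w1 w2 s) else Erased)"
    if "s < t" for s
  proof -
    have "index ?c (feedback ?c z s) = slot_index (ph s) (queues_after K1 K2 ph (feedback ?c z s))"
      by (simp add: scheme_code_def feedback_scheme)
    then show ?thesis using that
      by (auto simp: channel_out_def sender_scheme X1_def nth_feedback sent_def take_feedback symbol_by1)
  qed
  then show ?thesis unfolding Y1_def map_upt_shift received_def length_feedback
    by (intro map_cong refl) (simp only: atLeastLessThan_iff set_upt)
qed

lemma Y2_scheme:
  fixes w1 w2 :: "'f::field list"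
  shows "Y2 (scheme_code K1 K2 ph) z w1 w2 j t =
    received K1 K2 ph (feedback (scheme_code K1 K2 ph :: 'f channel_code) z t) w1 w2 N2 j"
proof -
  let ?c = "scheme_code K1 K2 ph :: 'f channel_code"
  have "channel_out ?c z (X2 ?c z w1 w2) N2 j (Suc s) =
      (if tx (ph s) \<noteq> N2 then Null
       else if (feedback ?c z t ! s) j
            then Packet (sent K1 K2 ph (feedback ?c z t) w1 w2 s) else Erased)"
    if "s < t" for s
  proof (cases "tx (ph s) = N2")
    case True
    let ?h = "feedback ?c z s"
    let ?v = "SOME v. received K1 K2 ph ?h v w2 N1 N2 = Y1 ?c z w1 N2 s"
    have "received K1 K2 ph ?h ?v w2 N1 N2 = Y1 ?c z w1 N2 s"
      by (rule someI[where x = w1]) (rule Y1_scheme[symmetric])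
    then have "received K1 K2 ph ?h ?v w2 N1 N2 = received K1 K2 ph ?h w1 w2 N1 N2"
      using Y1_scheme[of K1 K2 ph z w1 N2 s w2] by simp
    then have "symbol (ph (length ?h)) (queues_after K1 K2 ph ?h) ?v w2
        = symbol (ph (length ?h)) (queues_after K1 K2 ph ?h) w1 w2"
      by (rule sent_cong_N2) (simp add: True)
    then have "enc2 ?c w2 (Y1 ?c z w1 N2 s) ?h = sent K1 K2 ph (feedback ?c z t) w1 w2 s"
      using that by (simp add: sent_def take_feedback) (simp add: scheme_code_def)
    then show ?thesis using that True
      by (auto simp: channel_out_def sender_scheme X2_def nth_feedback)
  qed (auto simp: channel_out_def sender_scheme)
  then show ?thesis unfolding Y2_def map_upt_shift received_def length_feedback
    by (intro map_cong refl) (simp only: atLeastLessThan_iff set_upt)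
qed

lemma received_eqD:
  assumes "consistent K1 K2 ph j y1 y2 h w1 w2" "consistent K1 K2 ph j y1 y2 h v1 v2"
    and "s < length h" "(h ! s) j"
  shows "sent K1 K2 ph h w1 w2 s = sent K1 K2 ph h v1 v2 s"
proof -
  from tx_cases[of "ph s"] obtain i where i: "i = N1 \<or> i = N2" "tx (ph s) = i" by blast
  have "received K1 K2 ph h w1 w2 i j ! s = received K1 K2 ph h v1 v2 i j ! s"
    using assms(1,2) i(1) by (auto simp: consistent_def)
  then show ?thesis using assms(3,4) i(2) by (simp add: received_def)
qed

lemma agree3_evolve:
  assumes "consistent K1 K2 ph N3 y1 y2 h w1 w2" "consistent K1 K2 ph N3 y1 y2 h v1 v2" "t \<le> length h"
  shows "agree3 K1 w1 w2 v1 v2 (evolve ph (init_queues K1 K2) (nth h) t)"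
  using assms(3)
proof (induction t)
  case 0 then show ?case by (auto simp: agree3_def init_queues_def)
next
  case (Suc t)
  have "(h ! t) N3 \<Longrightarrow> sent K1 K2 ph h w1 w2 t = sent K1 K2 ph h v1 v2 t"
    using received_eqD[OF assms(1,2)] Suc.prems by simp
  then show ?case using Suc
    by (auto simp: sent_def queues_after_take intro!: agree3_step)
qed

lemma agree4_evolve:
  assumes "consistent K1 K2 ph N4 y1 y2 h w1 w2" "consistent K1 K2 ph N4 y1 y2 h v1 v2" "t \<le> length h"
  shows "agree4 K2 w1 w2 v1 v2 (evolve ph (init_queues K1 K2) (nth h) t)"
  using assms(3)
proof (induction t)
  case 0 then show ?case by (auto simp: agree4_def init_queues_def)
next
  case (Suc t)
  have "(h ! t) N4 \<Longrightarrow> sent K1 K2 ph h w1 w2 t = sent K1 K2 ph h v1 v2 t"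
    using received_eqD[OF assms(1,2)] Suc.prems by simp
  then show ?case using Suc
    by (auto simp: sent_def queues_after_take intro!: agree4_step)
qed

text \<open>With all queues empty the exceptional sets in \<open>agree3\<close> and
  \<open>agree4\<close> disappear, so any two consistent message pairs coincide in the wanted
  message and the choice made by the decoder is forced.\<close>

lemma scheme_decodes:
  fixes w1 w2 :: "'f::field list"
  assumes "length w1 = K1" "length w2 = K2"
    and empty: "evolve ph (init_queues K1 K2) (\<lambda>s. link_state (z (Suc s)) (tx (ph s))) n
      = empty_queues"
  shows "\<not> decoding_error n (scheme_code K1 K2 ph) z w1 w2"
proof -
  let ?c = "scheme_code K1 K2 ph :: 'f channel_code"
  let ?h = "feedback ?c z n"
  have e: "evolve ph (init_queues K1 K2) (nth ?h) n
      = empty_queues"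
    unfolding empty[symmetric] by (rule evolve_cong) (simp add: feedback_scheme)
  have cons: "consistent K1 K2 ph j (Y1 ?c z w1 j n) (Y2 ?c z w1 w2 j n) ?h w1 w2" for j
    unfolding consistent_def using assms(1,2)
    by (intro conjI Y1_scheme[symmetric] Y2_scheme[symmetric])
  have "v1 = w1" if "consistent K1 K2 ph N3 (Y1 ?c z w1 N3 n) (Y2 ?c z w1 w2 N3 n) ?h v1 v2" for v1 v2
    using agree3_evolve[OF that cons, of n] that assms
    by (intro nth_equalityI) (auto simp: e empty_queues_def agree3_def consistent_def)
  then have 3: "dec3 ?c (Y1 ?c z w1 N3 n) (Y2 ?c z w1 w2 N3 n) ?h = w1"
    using cons[of N3] by (auto simp add: scheme_code_def intro!: some_equality)
  have "v2 = w2" if "consistent K1 K2 ph N4 (Y1 ?c z w1 N4 n) (Y2 ?c z w1 w2 N4 n) ?h v1 v2" for v1 v2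
    using agree4_evolve[OF that cons, of n] that assms
    by (intro nth_equalityI) (auto simp: e empty_queues_def agree4_def consistent_def)
  then have 4: "dec4 ?c (Y1 ?c z w1 N4 n) (Y2 ?c z w1 w2 N4 n) ?h = w2"
    using cons[of N4] by (auto simp add: scheme_code_def intro!: some_equality)
  show ?thesis unfolding decoding_error_def using 3 4 by simp
qed

section \<open>Queue lengths during a phase\<close>

datatype queue = QNew1 | QAt4 | QAt2 | QAt24 | QPend | QLink | QNew2 | QAt3

fun len :: "queues \<Rightarrow> queue \<Rightarrow> nat" where
  "len q QNew1 = length (new1 q)" | "len q QAt4 = length (at4 q)"
| "len q QAt2 = length (at2 q)" | "len q QAt24 = length (at24 q)"
| "len q QPend = length (pend q)" | "len q QLink = length (link q)"
| "len q QNew2 = length (new2 q)" | "len q QAt3 = length (at3 q)"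

definition occ :: "(nat \<Rightarrow> bool) \<Rightarrow> nat \<Rightarrow> nat \<Rightarrow> nat" where
  "occ P a b = card {t \<in> {a..<b}. P t}"

lemma occ_self [simp]: "occ P a a = 0"
  by (simp add: occ_def)

lemma occ_Suc: "a \<le> b \<Longrightarrow> occ P a (Suc b) = occ P a b + of_bool (P b)"
proof -
  assume "a \<le> b"
  then have "{t \<in> {a..<Suc b}. P t} = (if P b then insert b {t \<in> {a..<b}. P t} else {t \<in> {a..<b}. P t})"
    by (auto simp: less_Suc_eq)
  then show ?thesis by (simp add: occ_def)
qed

text \<open>\<open>S r\<close> says that the packet at the head of queue \<open>k0\<close> leaves it under the reception pattern \<open>r\<close>,
  and \<open>E k r\<close> that it then enters queue \<open>k\<close>.\<close>

definition serves :: "phase \<Rightarrow> queue \<Rightarrow> ((node \<Rightarrow> bool) \<Rightarrow> bool) \<Rightarrow>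
    (queue \<Rightarrow> (node \<Rightarrow> bool) \<Rightarrow> bool) \<Rightarrow> bool" where
  "serves ph k0 S E \<longleftrightarrow> (\<forall>k r. E k r \<longrightarrow> S r) \<and> (\<forall>r q.
     len (step ph r q) k0 = len q k0 - of_bool (S r) \<and>
     (\<forall>k. k \<noteq> k0 \<longrightarrow> len (step ph r q) k = len q k + of_bool (E k r \<and> len q k0 > 0)))"

lemma queue_all: "(\<forall>k. P k) \<longleftrightarrow> P QNew1 \<and> P QAt4 \<and> P QAt2 \<and> P QAt24 \<and> P QPend \<and> P QLink \<and> P QNew2 \<and> P QAt3"
  by (metis queue.exhaust)

lemma serves_New1: "serves New1 QNew1 (\<lambda>r. r N2 \<or> r N3 \<or> r N4)
   (\<lambda>k r. (k = QAt4 \<and> r N4 \<and> \<not> r N2 \<and> \<not> r N3) \<or> (k = QAt2 \<and> r N2 \<and> \<not> r N3 \<and> \<not> r N4)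
     \<or> (k = QAt24 \<and> r N2 \<and> r N4 \<and> \<not> r N3))"
  by (auto simp: serves_def queue_all split: list.splits)

lemma serves_At4: "serves At4 QAt4 (\<lambda>r. r N2 \<or> r N3) (\<lambda>k r. k = QAt24 \<and> r N2 \<and> \<not> r N3)"
  by (auto simp: serves_def queue_all split: list.splits)

lemma serves_At2:
  assumes "ph = At2_by1 \<or> ph = At2_by2"
  shows "serves ph QAt2 (\<lambda>r. r N3 \<or> r N4) (\<lambda>k r. k = QAt24 \<and> r N4 \<and> \<not> r N3)"
  using assms by (auto simp: serves_def queue_all split: list.splits)

lemma serves_New2: "serves New2 QNew2 (\<lambda>r. r N3 \<or> r N4) (\<lambda>k r. k = QAt3 \<and> r N3 \<and> \<not> r N4)"
  by (auto simp: serves_def queue_all split: list.splits)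

lemma serves_Pend_by1: "serves Pend_by1 QPend (\<lambda>r. r N3 \<or> r N4)
   (\<lambda>k r. (k = QAt24 \<and> r N4 \<and> \<not> r N3) \<or> (k = QLink \<and> r N3 \<and> \<not> r N4))"
  by (auto simp: serves_def queue_all split: list.splits)

lemma serves_Pend_by2: "serves Pend_by2 QPend (\<lambda>r. r N3) (\<lambda>k r. k = QLink \<and> r N3)"
  by (auto simp: serves_def queue_all split: list.splits)

lemma serves_Link: "serves Link QLink (\<lambda>r. r N4) (\<lambda>k r. False)"
  by (auto simp: serves_def queue_all split: list.splits)

text \<open>Each occurrence of \<open>S\<close> removes a packet until the queue \<open>k0\<close>
  is empty; the surplus of occurrences over its initial length bounds the entries into
  \<open>k\<close> that fail to happen. The emptying time itself never has to be known. The bound on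
  the sum of two lengths serves the clearing phases, in which the surplus is large.\<close>

lemma serves_run:
  assumes sv: "serves ph k0 S E" and "a \<le> b"
    and run: "\<And>t. a \<le> t \<Longrightarrow> t < b \<Longrightarrow> \<sigma> (Suc t) = step ph (r t) (\<sigma> t)"
  shows "len (\<sigma> b) k0 = len (\<sigma> a) k0 - occ (\<lambda>t. S (r t)) a b"
    and "k \<noteq> k0 \<Longrightarrow> len (\<sigma> a) k \<le> len (\<sigma> b) k \<and>
      len (\<sigma> b) k + len (\<sigma> b) k0 \<le> len (\<sigma> a) k + len (\<sigma> a) k0 \<and>
      len (\<sigma> b) k \<le> len (\<sigma> a) k + occ (\<lambda>t. E k (r t)) a b \<and>
      len (\<sigma> a) k + occ (\<lambda>t. E k (r t)) a b
        \<le> len (\<sigma> b) k + (occ (\<lambda>t. S (r t)) a b - len (\<sigma> a) k0)"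
proof -
  have "len (\<sigma> b) k0 = len (\<sigma> a) k0 - occ (\<lambda>t. S (r t)) a b \<and> (k \<noteq> k0 \<longrightarrow>
      len (\<sigma> a) k \<le> len (\<sigma> b) k \<and>
      len (\<sigma> b) k + len (\<sigma> b) k0 \<le> len (\<sigma> a) k + len (\<sigma> a) k0 \<and>
      len (\<sigma> b) k \<le> len (\<sigma> a) k + occ (\<lambda>t. E k (r t)) a b \<and>
      len (\<sigma> a) k + occ (\<lambda>t. E k (r t)) a b
        \<le> len (\<sigma> b) k + (occ (\<lambda>t. S (r t)) a b - len (\<sigma> a) k0))"
    using \<open>a \<le> b\<close> run
  proof (induction b rule: nat_induct_at_least)
    case (Suc b)
    have "E k (r b) \<Longrightarrow> S (r b)" and "len (\<sigma> (Suc b)) k0 = len (\<sigma> b) k0 - of_bool (S (r b))"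
      and "k \<noteq> k0 \<Longrightarrow> len (\<sigma> (Suc b)) k = len (\<sigma> b) k + of_bool (E k (r b) \<and> len (\<sigma> b) k0 > 0)"
      using sv Suc.prems[of b] Suc.hyps by (auto simp: serves_def)
    moreover have "len (\<sigma> b) k0 = len (\<sigma> a) k0 - occ (\<lambda>t. S (r t)) a b \<and> (k \<noteq> k0 \<longrightarrow>
      len (\<sigma> a) k \<le> len (\<sigma> b) k \<and>
      len (\<sigma> b) k + len (\<sigma> b) k0 \<le> len (\<sigma> a) k + len (\<sigma> a) k0 \<and>
      len (\<sigma> b) k \<le> len (\<sigma> a) k + occ (\<lambda>t. E k (r t)) a b \<and>
      len (\<sigma> a) k + occ (\<lambda>t. E k (r t)) a b
        \<le> len (\<sigma> b) k + (occ (\<lambda>t. S (r t)) a b - len (\<sigma> a) k0))"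
      using Suc.IH Suc.prems by (meson less_SucI)
    ultimately show ?case
      using Suc.hyps
      by (cases "E k (r b)"; cases "S (r b)"; cases "len (\<sigma> b) k0 = 0")
        (auto simp: occ_Suc)
  qed auto
  then show "len (\<sigma> b) k0 = len (\<sigma> a) k0 - occ (\<lambda>t. S (r t)) a b"
    and "k \<noteq> k0 \<Longrightarrow> len (\<sigma> a) k \<le> len (\<sigma> b) k \<and>
      len (\<sigma> b) k + len (\<sigma> b) k0 \<le> len (\<sigma> a) k + len (\<sigma> a) k0 \<and>
      len (\<sigma> b) k \<le> len (\<sigma> a) k + occ (\<lambda>t. E k (r t)) a b \<and>
      len (\<sigma> a) k + occ (\<lambda>t. E k (r t)) a b
        \<le> len (\<sigma> b) k + (occ (\<lambda>t. S (r t)) a b - len (\<sigma> a) k0)"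
    by auto
qed

text \<open>Two surpluses appear: slots served after \<open>at2\<close> is empty, and receptions at
  node 4 beyond the initial length of \<open>at3\<close>. Only these spoil exact bookkeeping, and
  both vanish on the scale of n if the phase is no longer than \<open>at2\<close> and
  \<open>at3\<close> last.\<close>

lemma Mix_run:
  fixes r :: "nat \<Rightarrow> node \<Rightarrow> bool"
  assumes "a \<le> b"
    and run: "\<forall>t\<in>{a..<b}. \<sigma> (Suc t) = step Mix (r t) (\<sigma> t)"
  shows "len (\<sigma> b) QAt2 = len (\<sigma> a) QAt2 - occ (\<lambda>t. r t N3 \<or> r t N4) a b \<and>
    len (\<sigma> b) QAt3 \<le> (len (\<sigma> a) QAt3 - occ (\<lambda>t. r t N4) a b) + (occ (\<lambda>t. r t N3 \<or> r t N4) a b - len (\<sigma> a) QAt2) \<and>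
    len (\<sigma> a) QAt3 \<le> len (\<sigma> b) QAt3 + occ (\<lambda>t. r t N4) a b \<and>
    len (\<sigma> b) QLink \<le> len (\<sigma> a) QLink + occ (\<lambda>t. r t N3 \<and> r t N4) a b \<and>
    len (\<sigma> a) QLink + occ (\<lambda>t. r t N3 \<and> r t N4) a b \<le> len (\<sigma> b) QLink + (occ (\<lambda>t. r t N3 \<or> r t N4) a b - len (\<sigma> a) QAt2) + (occ (\<lambda>t. r t N4) a b - len (\<sigma> a) QAt3) \<and>
    len (\<sigma> b) QPend \<le> len (\<sigma> a) QPend + occ (\<lambda>t. r t N4 \<and> \<not> r t N3) a b \<and>
    len (\<sigma> a) QPend + occ (\<lambda>t. r t N4 \<and> \<not> r t N3) a b \<le> len (\<sigma> b) QPend + (occ (\<lambda>t. r t N3 \<or> r t N4) a b - len (\<sigma> a) QAt2) + (occ (\<lambda>t. r t N4) a b - len (\<sigma> a) QAt3) \<and>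
    len (\<sigma> a) QAt24 \<le> len (\<sigma> b) QAt24 \<and>
    len (\<sigma> b) QAt24 \<le> len (\<sigma> a) QAt24 + (occ (\<lambda>t. r t N4) a b - len (\<sigma> a) QAt3) \<and>
    len (\<sigma> b) QNew1 = len (\<sigma> a) QNew1 \<and>
    len (\<sigma> b) QAt4 = len (\<sigma> a) QAt4 \<and>
    len (\<sigma> b) QNew2 = len (\<sigma> a) QNew2"
  using assms
proof (induction b rule: nat_induct_at_least)
  case (Suc b)
  have "\<forall>t\<in>{a..<b}. \<sigma> (Suc t) = step Mix (r t) (\<sigma> t)" "\<sigma> (Suc b) = step Mix (r b) (\<sigma> b)"
    using Suc.prems Suc.hyps by auto
  from Suc.IH[OF this(1)] Suc.hyps this(2) show ?case
    by (auto simp: occ_Suc split: list.splits)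
qed auto

text \<open>\<open>at3\<close> and \<open>link\<close> share the receptions at node 4,
  \<open>at3\<close> first, so only the sum of their lengths follows a simple law.\<close>

lemma Final_run:
  fixes r :: "nat \<Rightarrow> node \<Rightarrow> bool"
  assumes "a \<le> b"
    and run: "\<forall>t\<in>{a..<b}. \<sigma> (Suc t) = step Final (r t) (\<sigma> t)"
  shows "len (\<sigma> b) QAt24 = len (\<sigma> a) QAt24 - occ (\<lambda>t. r t N3) a b \<and>
    len (\<sigma> b) QAt3 + len (\<sigma> b) QLink
      = len (\<sigma> a) QAt3 + len (\<sigma> a) QLink - occ (\<lambda>t. r t N4) a b \<and>
    (\<forall>k. k \<notin> {QAt24, QAt3, QLink} \<longrightarrow> len (\<sigma> b) k = len (\<sigma> a) k)"
  using assms
proof (induction b rule: nat_induct_at_least)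
  case (Suc b)
  have "\<forall>t\<in>{a..<b}. \<sigma> (Suc t) = step Final (r t) (\<sigma> t)" "\<sigma> (Suc b) = step Final (r b) (\<sigma> b)"
    using Suc.prems Suc.hyps by auto
  from Suc.IH[OF this(1)] Suc.hyps this(2) show ?case
    by (cases "at3 (\<sigma> b)"; cases "link (\<sigma> b)") (auto simp: occ_Suc Let_def queue_all)
qed auto

section \<open>Fluid limits\<close>

definition dens :: "(nat \<Rightarrow> nat) \<Rightarrow> real \<Rightarrow> bool" where
  "dens f v \<longleftrightarrow> (\<lambda>n. real (f n) / real n) \<longlonglongrightarrow> v"

lemma dens_diff_trunc:
  assumes "dens f v" "dens g w"
  shows "dens (\<lambda>n. f n - g n) (max 0 (v - w))"
proof -
  have "(\<lambda>n. max 0 (real (f n) / real n - real (g n) / real n)) \<longlonglongrightarrow> max 0 (v - w)"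
    using assms unfolding dens_def by (intro tendsto_intros)
  moreover have "real (f n - g n) / real n = max 0 (real (f n) / real n - real (g n) / real n)" for n
    by (cases "f n \<le> g n")
      (auto simp: divide_right_mono of_nat_diff max_def divide_simps split: if_splits)
  ultimately show ?thesis unfolding dens_def by simp
qed

lemma dens_add: "dens f v \<Longrightarrow> dens g w \<Longrightarrow> dens (\<lambda>n. f n + g n) (v + w)"
  unfolding dens_def by (auto simp: add_divide_distrib intro: tendsto_add)

lemma dens_0: "dens (\<lambda>n. 0) 0"
  by (simp add: dens_def)

lemma dens_sandwich:
  assumes "dens f v" "dens h v" "\<And>n. f n \<le> g n" "\<And>n. g n \<le> h n"
  shows "dens g v"
  unfolding dens_def
proof (rule tendsto_sandwich)
  show "\<forall>\<^sub>F n in sequentially. real (f n) / real n \<le> real (g n) / real n"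
    "\<forall>\<^sub>F n in sequentially. real (g n) / real n \<le> real (h n) / real n"
    using assms(3,4) by (simp_all add: divide_right_mono)
qed (use assms(1,2) in \<open>simp_all add: dens_def\<close>)

lemma dens_near:
  assumes "dens f v" "dens h 0" "\<And>n. g n \<le> f n" "\<And>n. f n \<le> g n + h n" "v \<ge> 0"
  shows "dens g v"
proof (rule dens_sandwich)
  show "dens (\<lambda>n. f n - h n) v"
    using dens_diff_trunc[OF assms(1,2)] \<open>v \<ge> 0\<close> by simp
  show "f n - h n \<le> g n" for n using assms(4)[of n] by simp
qed (use assms in auto)

lemma dens_nonneg: "dens f v \<Longrightarrow> v \<ge> 0"
  unfolding dens_def by (rule LIMSEQ_le_const) auto

lemma dens_less:
  assumes "dens f v" "dens g w" "v < w"
  shows "\<forall>\<^sub>F n in sequentially. f n \<le> g n"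
proof -
  have "\<forall>\<^sub>F n in sequentially. real (f n) / real n < (v + w) / 2"
    using assms unfolding dens_def by (intro order_tendstoD) auto
  moreover have "\<forall>\<^sub>F n in sequentially. real (g n) / real n > (v + w) / 2"
    using assms unfolding dens_def by (intro order_tendstoD) auto
  ultimately show ?thesis
  proof eventually_elim
    case (elim n)
    then have "real (f n) / real n < real (g n) / real n" by linarith
    then have "real (f n) < real (g n)" by (cases "n = 0") (auto simp: divide_simps)
    then show ?case by simp
  qed
qed

text \<open>Slots of a schedule count from 0 and erasures from 1, hence \<open>Suc t\<close>. All
  slots are counted, whether or not node \<open>i\<close> transmits; a phase then picks a window of
  them.\<close>

definition freq :: "erasures \<Rightarrow> node \<Rightarrow> ((node \<Rightarrow> bool) \<Rightarrow> bool) \<Rightarrow> real \<Rightarrow> bool" where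
  "freq z i E p \<longleftrightarrow> dens (occ (\<lambda>t. E (link_state (z (Suc t)) i)) 0) p"

lemma occ_mono: "(\<And>t. P t \<Longrightarrow> Q t) \<Longrightarrow> occ P a b \<le> occ Q a b"
  unfolding occ_def by (intro card_mono) auto

lemma occ_diff:
  assumes "\<And>t. Q t \<Longrightarrow> P t"
  shows "occ (\<lambda>t. P t \<and> \<not> Q t) a b = occ P a b - occ Q a b"
proof -
  have "{t \<in> {a..<b}. P t \<and> \<not> Q t} = {t \<in> {a..<b}. P t} - {t \<in> {a..<b}. Q t}" by auto
  then show ?thesis unfolding occ_def using assms by (simp add: card_Diff_subset subset_iff)
qed

lemma freq_diff:
  assumes "freq z i P p" "freq z i Q q" "\<And>r. Q r \<Longrightarrow> P r"
  shows "freq z i (\<lambda>r. P r \<and> \<not> Q r) (p - q)"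
proof -
  have "q \<le> p"
    using assms(1,2) occ_mono[of "\<lambda>t. Q (link_state (z (Suc t)) i)" "\<lambda>t. P (link_state (z (Suc t)) i)"] assms(3)
    unfolding freq_def dens_def
    by (intro LIMSEQ_le[OF assms(2)[unfolded freq_def dens_def] assms(1)[unfolded freq_def dens_def]])
      (auto intro!: divide_right_mono)
  then show ?thesis
    using dens_diff_trunc[OF assms(1,2)[unfolded freq_def]]
      occ_diff[of "\<lambda>t. Q (link_state (z (Suc t)) i)" "\<lambda>t. P (link_state (z (Suc t)) i)", OF assms(3)]
    unfolding freq_def by (simp add: dens_def)
qed

lemma freq_False: "freq z i (\<lambda>r. False) 0"
  by (simp add: freq_def occ_def dens_def)

lemma floor_ratio:
  assumes "\<beta> \<ge> 0"
  shows "(\<lambda>n. real (nat \<lfloor>real n * \<beta>\<rfloor>) / real n) \<longlonglongrightarrow> \<beta>"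
proof (rule real_tendsto_sandwich)
  have *: "real n * \<beta> - 1 \<le> real (nat \<lfloor>real n * \<beta>\<rfloor>)" "real (nat \<lfloor>real n * \<beta>\<rfloor>) \<le> real n * \<beta>" for n
    using assms by (auto simp: of_nat_nat, linarith?)
  show "\<forall>\<^sub>F n in sequentially. \<beta> - 1 / real n \<le> real (nat \<lfloor>real n * \<beta>\<rfloor>) / real n"
    using eventually_gt_at_top[of 0]
  proof eventually_elim
    case (elim n)
    have "\<beta> - 1 / real n = (real n * \<beta> - 1) / real n" using elim by (simp add: field_simps)
    also have "\<dots> \<le> real (nat \<lfloor>real n * \<beta>\<rfloor>) / real n" by (intro divide_right_mono *) simp
    finally show ?case .
  qed
  show "\<forall>\<^sub>F n in sequentially. real (nat \<lfloor>real n * \<beta>\<rfloor>) / real n \<le> \<beta>"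
    using eventually_gt_at_top[of 0] by eventually_elim (use * in \<open>simp add: field_simps\<close>)
  have "(\<lambda>n. \<beta> - 1 / real n) \<longlonglongrightarrow> \<beta> - 0"
    by (intro tendsto_intros lim_1_over_n)
  then show "(\<lambda>n. \<beta> - 1 / real n) \<longlonglongrightarrow> \<beta>" by simp
qed simp

lemma dens_at_floor:
  assumes "dens f p" "\<beta> \<ge> 0" "f 0 = 0"
  shows "dens (\<lambda>n. f (nat \<lfloor>real n * \<beta>\<rfloor>)) (p * \<beta>)"
proof (cases "\<beta> = 0")
  case False
  have "filterlim (\<lambda>n. nat \<lfloor>real n * \<beta>\<rfloor>) at_top sequentially"
  proof (rule filterlim_compose[OF filterlim_nat_sequentially filterlim_compose[OF filterlim_floor_sequentially]])
    show "filterlim (\<lambda>n. real n * \<beta>) at_top sequentially"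
      using False assms(2)
      by (intro filterlim_at_top_mult_tendsto_pos[OF tendsto_const _ filterlim_real_sequentially]) auto
  qed
  from filterlim_compose[OF assms(1)[unfolded dens_def] this]
  have "(\<lambda>n. real (f (nat \<lfloor>real n * \<beta>\<rfloor>)) / real (nat \<lfloor>real n * \<beta>\<rfloor>)
      * (real (nat \<lfloor>real n * \<beta>\<rfloor>) / real n)) \<longlonglongrightarrow> p * \<beta>"
    using assms(2) by (intro tendsto_mult floor_ratio)
  moreover have "real (f m) / real m * (real m / real n) = real (f m) / real n" for m n
    using \<open>f 0 = 0\<close> by (cases "m = 0") simp_all
  ultimately show ?thesis unfolding dens_def by (simp only:)
qed (use assms in \<open>simp add: dens_0\<close>)

lemma occ_split: "a \<le> b \<Longrightarrow> occ P a b = occ P 0 b - occ P 0 a"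
proof -
  assume "a \<le> b"
  then have "{t \<in> {a..<b}. P t} = {t \<in> {0..<b}. P t} - {t \<in> {0..<a}. P t}" by auto
  then show ?thesis unfolding occ_def using \<open>a \<le> b\<close> by (simp add: card_Diff_subset subset_iff)
qed

lemma freq_window:
  assumes "freq z i E p" "0 \<le> \<alpha>" "\<alpha> \<le> \<beta>"
  shows "dens (\<lambda>n. occ (\<lambda>t. E (link_state (z (Suc t)) i)) (nat \<lfloor>real n * \<alpha>\<rfloor>) (nat \<lfloor>real n * \<beta>\<rfloor>))
    (p * (\<beta> - \<alpha>))"
proof -
  have le: "nat \<lfloor>real n * \<alpha>\<rfloor> \<le> nat \<lfloor>real n * \<beta>\<rfloor>" for n
    using assms by (intro nat_mono floor_mono mult_left_mono) auto
  have "p \<ge> 0" using assms(1) unfolding freq_def by (rule dens_nonneg)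
  then have "p * \<alpha> \<le> p * \<beta>" using assms by (intro mult_left_mono) auto
  moreover have "dens (\<lambda>n. occ (\<lambda>t. E (link_state (z (Suc t)) i)) 0 (nat \<lfloor>real n * \<beta>\<rfloor>)
      - occ (\<lambda>t. E (link_state (z (Suc t)) i)) 0 (nat \<lfloor>real n * \<alpha>\<rfloor>)) (max 0 (p * \<beta> - p * \<alpha>))"
    using assms unfolding freq_def
    by (intro dens_diff_trunc dens_at_floor) auto
  ultimately show ?thesis
    by (simp add: occ_split[OF le] right_diff_distrib)
qed

text \<open>The first eight phases follow the fluid solution without leaving slots idle in the limit; the
  remaining ones clear the \<open>o(n)\<close> packets left over and then empty the queues of node 2 at nodes 3 and 4.\<close>

definition phase_list :: "phase list" where
  "phase_list = [New1, At4, At2_by1, At2_by2, New2, Mix, Pend_by1, Link,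
     New1, At4, At2_by2, New2, Pend_by2, Final]"

definition boundary :: "(nat \<Rightarrow> real) \<Rightarrow> nat \<Rightarrow> nat \<Rightarrow> nat" where
  "boundary L n k = nat \<lfloor>real n * (\<Sum>j<k. L j)\<rfloor>"

definition plan :: "(nat \<Rightarrow> real) \<Rightarrow> nat \<Rightarrow> nat \<Rightarrow> phase" where
  "plan L n t = phase_list ! (LEAST k. t < boundary L n (Suc k))"

lemma boundary_mono:
  assumes "\<And>j. L j \<ge> 0" "k \<le> l"
  shows "boundary L n k \<le> boundary L n l"
  unfolding boundary_def using assms
  by (intro nat_mono floor_mono mult_left_mono sum_mono2) auto

lemma plan_eq:
  assumes "\<And>j. L j \<ge> 0" "boundary L n k \<le> t" "t < boundary L n (Suc k)"
  shows "plan L n t = phase_list ! k"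
proof -
  have "(LEAST k. t < boundary L n (Suc k)) = k"
  proof (rule Least_equality)
    fix l assume "t < boundary L n (Suc l)"
    then show "k \<le> l"
      using assms(2) boundary_mono[of L "Suc l" k n] assms(1) by (cases "k \<le> l") auto
  qed fact
  then show ?thesis by (simp add: plan_def)
qed

section \<open>Queue densities from phase to phase\<close>

locale fluid_run =
  fixes z :: erasures and L :: "nat \<Rightarrow> real" and K1 K2 :: "nat \<Rightarrow> nat"
  assumes L_nonneg: "\<And>j. L j \<ge> 0"
begin

definition path :: "nat \<Rightarrow> nat \<Rightarrow> queues" where
  "path n = evolve (plan L n) (init_queues (K1 n) (K2 n)) (\<lambda>s. link_state (z (Suc s)) (tx (plan L n s)))"

definition state :: "nat \<Rightarrow> nat \<Rightarrow> queues" where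
  "state n k = path n (boundary L n k)"

definition fluid :: "nat \<Rightarrow> (queue \<Rightarrow> real) \<Rightarrow> bool" where
  "fluid k v \<longleftrightarrow> (\<forall>q. dens (\<lambda>n. len (state n k) q) (v q))"

text \<open>Density 0 would still allow o(n) undelivered packets, hence literal emptiness.\<close>

definition cleared :: "nat \<Rightarrow> queue \<Rightarrow> bool" where
  "cleared k q \<longleftrightarrow> (\<forall>\<^sub>F n in sequentially. len (state n k) q = 0)"

lemma path_Suc:
  assumes "phase_list ! k = ph" "boundary L n k \<le> t" "t < boundary L n (Suc k)"
  shows "path n (Suc t) = step ph (link_state (z (Suc t)) (tx ph)) (path n t)"
  using plan_eq[OF L_nonneg assms(2,3)] assms(1) by (simp add: path_def)

lemma boundary_Suc: "boundary L n k \<le> boundary L n (Suc k)"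
  by (rule boundary_mono[OF L_nonneg]) simp

lemma serves_run_state:
  assumes "phase_list ! k = ph" and "serves ph k0 S E"
  defines "c \<equiv> \<lambda>E n. occ (\<lambda>t. E (link_state (z (Suc t)) (tx ph))) (boundary L n k) (boundary L n (Suc k))"
  shows "len (state n (Suc k)) k0 = len (state n k) k0 - c S n"
    and "q \<noteq> k0 \<Longrightarrow> len (state n k) q \<le> len (state n (Suc k)) q \<and>
      len (state n (Suc k)) q + len (state n (Suc k)) k0 \<le> len (state n k) q + len (state n k) k0 \<and>
      len (state n (Suc k)) q \<le> len (state n k) q + c (E q) n \<and>
      len (state n k) q + c (E q) n \<le> len (state n (Suc k)) q + (c S n - len (state n k) k0)"
  unfolding c_def state_def
  using serves_run[where \<sigma> = "path n" and r = "\<lambda>t. link_state (z (Suc t)) (tx ph)",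
      OF assms(2) boundary_Suc path_Suc[OF assms(1)]] by blast+

lemma freq_phase:
  assumes "freq z i E p"
  shows "dens (\<lambda>n. occ (\<lambda>t. E (link_state (z (Suc t)) i)) (boundary L n k) (boundary L n (Suc k))) (p * L k)"
  using freq_window[OF assms, of "\<Sum>j<k. L j" "\<Sum>j<Suc k. L j"] L_nonneg
  by (simp add: boundary_def sum_nonneg)

text \<open>The condition \<open>s * L k \<le> v k0\<close> keeps the phase no longer than the queue
  lasts, so the surplus in \<open>serves_run\<close> has density 0 and the entry counts are exact in
  the limit.\<close>

lemma fluid_serve:
  assumes k: "phase_list ! k = ph" and sv: "serves ph k0 S E"
    and s: "freq z (tx ph) S s" and e: "\<And>q. freq z (tx ph) (E q) (e q)"
    and v: "fluid k v" and le: "s * L k \<le> v k0"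
  shows "fluid (Suc k) (\<lambda>q. if q = k0 then v k0 - s * L k else v q + e q * L k)"
proof -
  note run = serves_run_state[OF k sv]
  let ?c = "\<lambda>E n. occ (\<lambda>t. E (link_state (z (Suc t)) (tx ph))) (boundary L n k) (boundary L n (Suc k))"
  have v0: "dens (\<lambda>n. len (state n k) k0) (v k0)" using v by (simp add: fluid_def)
  have S: "dens (?c S) (s * L k)" by (rule freq_phase[OF s])
  have src: "dens (\<lambda>n. len (state n (Suc k)) k0) (v k0 - s * L k)"
    using dens_diff_trunc[OF v0 S] le by (simp add: run(1))
  have "dens (\<lambda>n. len (state n (Suc k)) q) (v q + e q * L k)" if q: "q \<noteq> k0" for q
  proof (rule dens_near)
    show "dens (\<lambda>n. len (state n k) q + ?c (E q) n) (v q + e q * L k)"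
      using v by (intro dens_add freq_phase e) (simp add: fluid_def)
    show "dens (\<lambda>n. ?c S n - len (state n k) k0) 0"
      using dens_diff_trunc[OF S v0] le by simp
    show "0 \<le> v q + e q * L k"
      using dens_nonneg[OF e[of q, unfolded freq_def]] dens_nonneg[of "\<lambda>n. len (state n k) q" "v q"] v L_nonneg[of k]
      by (auto simp: fluid_def)
    fix n
    show "len (state n (Suc k)) q \<le> len (state n k) q + ?c (E q) n"
      "len (state n k) q + ?c (E q) n \<le> len (state n (Suc k)) q + (?c S n - len (state n k) k0)"
      using run(2)[OF q, of n] by linarith+
  qed
  with src show ?thesis by (auto simp: fluid_def)
qed

text \<open>The regime opposite to \<open>fluid_serve\<close>: the queue has density 0 and the
  window has positive length, so receptions eventually exceed the queue, while only o(n) packets can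
  move to other queues. The third claim dictates the order of the clearing phases: none of them
  feeds a queue cleared earlier.\<close>

lemma fluid_clear:
  assumes k: "phase_list ! k = ph" and sv: "serves ph k0 S E"
    and s: "freq z (tx ph) S s" and pos: "s * L k > 0"
    and v: "fluid k v" "v k0 = 0"
  shows "fluid (Suc k) v" and "cleared (Suc k) k0"
    and "\<And>q. (\<And>r. \<not> E q r) \<Longrightarrow> q \<noteq> k0 \<Longrightarrow> cleared k q \<Longrightarrow> cleared (Suc k) q"
proof -
  note run = serves_run_state[OF k sv]
  let ?c = "\<lambda>E n. occ (\<lambda>t. E (link_state (z (Suc t)) (tx ph))) (boundary L n k) (boundary L n (Suc k))"
  have v0: "dens (\<lambda>n. len (state n k) k0) 0" using v(1)[unfolded fluid_def, rule_format, of k0] v(2) by simp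
  have "dens (\<lambda>n. len (state n (Suc k)) q) (v q)" for q
  proof (cases "q = k0")
    case True
    have "dens (\<lambda>n. len (state n (Suc k)) k0) 0"
      by (rule dens_sandwich[OF dens_0 v0]) (simp_all add: run(1))
    then show ?thesis using True v(2) by simp
  next
    case False
    show ?thesis
    proof (rule dens_sandwich)
      show "dens (\<lambda>n. len (state n k) q) (v q)" using v(1) by (simp add: fluid_def)
      then show "dens (\<lambda>n. len (state n k) q + len (state n k) k0) (v q)"
        using dens_add[OF _ v0, of "\<lambda>n. len (state n k) q"] by simp
      fix n
      show "len (state n k) q \<le> len (state n (Suc k)) q"
        "len (state n (Suc k)) q \<le> len (state n k) q + len (state n k) k0"
        using run(2)[OF False, of n] by linarith+
    qed
  qed
  then show "fluid (Suc k) v" by (simp add: fluid_def)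
  show "cleared (Suc k) k0"
    using dens_less[OF v0 freq_phase[OF s] pos] by (simp add: cleared_def run(1))
  show "cleared (Suc k) q" if "\<And>r. \<not> E q r" "q \<noteq> k0" "cleared k q" for q
  proof -
    have occ0: "occ (\<lambda>t. E q (link_state (z (Suc t)) (tx ph))) a b = 0" for a b
      using that(1) by (simp add: occ_def)
    show ?thesis
      using that(3) unfolding cleared_def
    proof (rule eventually_mono)
      fix n assume "len (state n k) q = 0"
      then show "len (state n (Suc k)) q = 0"
        using run(2)[OF that(2), of n] occ0 by simp
    qed
  qed
qed

lemma fluid_Mix:
  assumes k: "phase_list ! k = Mix"
    and s: "freq z N2 (\<lambda>r. r N3 \<or> r N4) s" and s4: "freq z N2 (\<lambda>r. r N4) s4"
    and sB: "freq z N2 (\<lambda>r. r N3 \<and> r N4) sB" and sO: "freq z N2 (\<lambda>r. r N4 \<and> \<not> r N3) sO"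
    and v: "fluid k (case_queue a b X c d e f g)" and "s * L k \<le> X" "s4 * L k \<le> g"
  shows "fluid (Suc k) (case_queue a b (X - s * L k) c (d + sO * L k) (e + sB * L k) f (g - s4 * L k))"
proof -
  have "\<forall>t\<in>{boundary L n k..<boundary L n (Suc k)}.
      path n (Suc t) = step Mix (link_state (z (Suc t)) N2) (path n t)" for n
    using path_Suc[OF k, unfolded tx.simps] by (auto simp del: step.simps)
  note run = Mix_run[where \<sigma> = "path n" and r = "\<lambda>t. link_state (z (Suc t)) N2" for n,
      OF boundary_Suc this, folded state_def]
  let ?c = "\<lambda>E n. occ (\<lambda>t. E (link_state (z (Suc t)) N2)) (boundary L n k) (boundary L n (Suc k))"
  have len: "dens (\<lambda>n. len (state n k) QNew1) a" "dens (\<lambda>n. len (state n k) QAt4) b"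
    "dens (\<lambda>n. len (state n k) QAt2) X" "dens (\<lambda>n. len (state n k) QAt24) c"
    "dens (\<lambda>n. len (state n k) QPend) d" "dens (\<lambda>n. len (state n k) QLink) e"
    "dens (\<lambda>n. len (state n k) QNew2) f" "dens (\<lambda>n. len (state n k) QAt3) g"
    using v unfolding fluid_def queue_all by simp_all
  note c34 = freq_phase[OF s, of k] and c4 = freq_phase[OF s4, of k]
    and cB = freq_phase[OF sB, of k] and cO = freq_phase[OF sO, of k]
  have x34: "dens (\<lambda>n. ?c (\<lambda>r. r N3 \<or> r N4) n - len (state n k) QAt2) 0"
    using dens_diff_trunc[OF c34 len(3)] \<open>s * L k \<le> X\<close> by simp
  have x4: "dens (\<lambda>n. ?c (\<lambda>r. r N4) n - len (state n k) QAt3) 0"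
    using dens_diff_trunc[OF c4 len(8)] \<open>s4 * L k \<le> g\<close> by simp
  have xx: "dens (\<lambda>n. (?c (\<lambda>r. r N3 \<or> r N4) n - len (state n k) QAt2)
      + (?c (\<lambda>r. r N4) n - len (state n k) QAt3)) 0"
    using dens_add[OF x34 x4] by simp
  have r2: "len (state n (Suc k)) QAt2 = len (state n k) QAt2 - ?c (\<lambda>r. r N3 \<or> r N4) n" for n
    using run[of n] by blast
  have r3: "len (state n (Suc k)) QAt3 \<le> (len (state n k) QAt3 - ?c (\<lambda>r. r N4) n)
      + (?c (\<lambda>r. r N3 \<or> r N4) n - len (state n k) QAt2)"
    "len (state n k) QAt3 - ?c (\<lambda>r. r N4) n \<le> len (state n (Suc k)) QAt3" for n
    using run[of n] by linarith+
  have rL: "len (state n (Suc k)) QLink \<le> len (state n k) QLink + ?c (\<lambda>r. r N3 \<and> r N4) n"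
    "len (state n k) QLink + ?c (\<lambda>r. r N3 \<and> r N4) n \<le> len (state n (Suc k)) QLink
      + ((?c (\<lambda>r. r N3 \<or> r N4) n - len (state n k) QAt2)
      + (?c (\<lambda>r. r N4) n - len (state n k) QAt3))" for n
    using run[of n] by linarith+
  have rP: "len (state n (Suc k)) QPend \<le> len (state n k) QPend + ?c (\<lambda>r. r N4 \<and> \<not> r N3) n"
    "len (state n k) QPend + ?c (\<lambda>r. r N4 \<and> \<not> r N3) n \<le> len (state n (Suc k)) QPend
      + ((?c (\<lambda>r. r N3 \<or> r N4) n - len (state n k) QAt2)
      + (?c (\<lambda>r. r N4) n - len (state n k) QAt3))" for n
    using run[of n] by linarith+
  have r24: "len (state n k) QAt24 \<le> len (state n (Suc k)) QAt24"
    "len (state n (Suc k)) QAt24 \<le> len (state n k) QAt24 + (?c (\<lambda>r. r N4) n - len (state n k) QAt3)" for n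
    using run[of n] by linarith+
  have r0: "len (state n (Suc k)) QNew1 = len (state n k) QNew1"
    "len (state n (Suc k)) QAt4 = len (state n k) QAt4"
    "len (state n (Suc k)) QNew2 = len (state n k) QNew2" for n
    using run[of n] by blast+
  have "dens (\<lambda>n. len (state n (Suc k)) QAt2) (X - s * L k)"
    unfolding r2 using dens_diff_trunc[OF len(3) c34] \<open>s * L k \<le> X\<close> by simp
  moreover have "dens (\<lambda>n. len (state n (Suc k)) QPend) (d + sO * L k)"
    using dens_add[OF len(5) cO] dens_nonneg[OF dens_add[OF len(5) cO]]
    by (intro dens_near[OF _ xx rP])
  moreover have "dens (\<lambda>n. len (state n (Suc k)) QLink) (e + sB * L k)"
    using dens_add[OF len(6) cB] dens_nonneg[OF dens_add[OF len(6) cB]]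
    by (intro dens_near[OF _ xx rL])
  moreover have "dens (\<lambda>n. len (state n (Suc k)) QAt3) (g - s4 * L k)"
  proof -
    have lo: "dens (\<lambda>n. len (state n k) QAt3 - ?c (\<lambda>r. r N4) n) (g - s4 * L k)"
      using dens_diff_trunc[OF len(8) c4] \<open>s4 * L k \<le> g\<close> by simp
    show ?thesis
      using dens_add[OF lo x34] by (intro dens_sandwich[OF lo _ r3(2) r3(1)]) simp
  qed
  moreover have "dens (\<lambda>n. len (state n (Suc k)) QAt24) c"
    using dens_add[OF len(4) x4] by (intro dens_sandwich[OF len(4) _ r24]) simp
  moreover have "dens (\<lambda>n. len (state n (Suc k)) QNew1) a" "dens (\<lambda>n. len (state n (Suc k)) QAt4) b"
    "dens (\<lambda>n. len (state n (Suc k)) QNew2) f"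
    unfolding r0 by (rule len)+
  ultimately show ?thesis unfolding fluid_def queue_all by simp
qed

end

text \<open>Only joint erasures are listed, because \<open>eps\<close> speaks of nothing else; the
  frequencies of other reception patterns follow as differences.\<close>

definition typical :: "(node \<Rightarrow> node set \<Rightarrow> real) \<Rightarrow> erasures \<Rightarrow> bool" where
  "typical eps z \<longleftrightarrow>
     (\<forall>i\<in>{N1, N2}. \<forall>S. S \<subseteq> nbrs i \<longrightarrow> freq z i (\<lambda>r. \<forall>j\<in>S. \<not> r j) (eps i S))"

lemma freq_cong: "freq z i E p \<Longrightarrow> (\<And>r. E r \<longleftrightarrow> E' r) \<Longrightarrow> p = p' \<Longrightarrow> freq z i E' p'"
  unfolding freq_def by simp

lemma freq_True: "freq z i (\<lambda>r. True) 1"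
proof -
  have "(\<lambda>n. real n / real n) \<longlonglongrightarrow> 1"
    by (rule tendsto_eventually) (use eventually_gt_at_top[of 0] in eventually_elim, simp)
  then show ?thesis by (simp add: freq_def occ_def dens_def)
qed

lemma typical_none:
  "typical eps z \<Longrightarrow> i \<in> {N1, N2} \<Longrightarrow> S \<subseteq> nbrs i \<Longrightarrow> freq z i (\<lambda>r. \<forall>j\<in>S. \<not> r j) (eps i S)"
  unfolding typical_def by blast

lemma typical_any:
  assumes "typical eps z" "i \<in> {N1, N2}" "S \<subseteq> nbrs i"
  shows "freq z i (\<lambda>r. \<exists>j\<in>S. r j) (1 - eps i S)"
  by (rule freq_cong[OF freq_diff[OF freq_True typical_none[OF assms]]]) auto

lemma typical_diff:
  assumes "typical eps z" "i \<in> {N1, N2}" "S \<subseteq> T" "T \<subseteq> nbrs i"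
  shows "freq z i (\<lambda>r. (\<forall>j\<in>S. \<not> r j) \<and> (\<exists>j\<in>T. r j)) (eps i S - eps i T)"
  by (rule freq_cong[OF freq_diff[OF typical_none[OF assms(1,2)] typical_none[OF assms(1,2,4)]]])
    (use assms in auto)

context fluid_run
begin

lemma fluid_eqI: "fluid k v \<Longrightarrow> k = k' \<Longrightarrow> (\<And>q. v q = w q) \<Longrightarrow> fluid k' w"
  by (simp add: fluid_def)

lemma fluid_init:
  assumes "dens K1 R1" "dens K2 R2"
  shows "fluid 0 (case_queue R1 0 0 0 0 0 R2 0)"
  using assms by (simp add: fluid_def queue_all state_def path_def boundary_def init_queues_def dens_0)

lemma cleared_Final:
  assumes k: "phase_list ! k = Final"
    and "freq z N2 (\<lambda>r. r N3) s3" "freq z N2 (\<lambda>r. r N4) s4"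
    and v: "fluid k v" "v QAt24 < s3 * L k" "v QAt3 + v QLink < s4 * L k"
    and cl: "\<And>q. q \<notin> {QAt24, QAt3, QLink} \<Longrightarrow> cleared k q"
  shows "cleared (Suc k) q"
proof -
  have "\<forall>t\<in>{boundary L n k..<boundary L n (Suc k)}.
      path n (Suc t) = step Final (link_state (z (Suc t)) N2) (path n t)" for n
    using path_Suc[OF k, unfolded tx.simps] by (auto simp del: step.simps)
  note run = Final_run[where \<sigma> = "path n" and r = "\<lambda>t. link_state (z (Suc t)) N2" for n,
      OF boundary_Suc this, folded state_def]
  have d: "dens (\<lambda>n. len (state n k) QAt24) (v QAt24)"
    "dens (\<lambda>n. len (state n k) QAt3 + len (state n k) QLink) (v QAt3 + v QLink)"
    using v(1) by (auto simp: fluid_def simp del: len.simps intro!: dens_add)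
  have 1: "cleared (Suc k) QAt24"
    using dens_less[OF d(1) freq_phase[OF assms(2), of k]] v(2) unfolding cleared_def
    by (auto elim!: eventually_mono simp del: len.simps simp: run)
  have "\<forall>\<^sub>F n in sequentially. len (state n (Suc k)) QAt3 + len (state n (Suc k)) QLink = 0"
    using dens_less[OF d(2) freq_phase[OF assms(3), of k]] v(3)
    by (auto elim!: eventually_mono simp del: len.simps simp: run)
  then have 2: "cleared (Suc k) QAt3" "cleared (Suc k) QLink"
    unfolding cleared_def by (auto elim!: eventually_mono simp del: len.simps)
  have "cleared (Suc k) q" if "q \<notin> {QAt24, QAt3, QLink}"
    using cl[OF that] that run unfolding cleared_def
    by (auto elim!: eventually_mono simp del: len.simps)
  with 1 2 show ?thesis by auto
qed

text \<open>\<open>L j\<close> is the fraction of time spent in phase \<open>j\<close>; the hypotheses are the flow balance equations of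
  the queues.\<close>

lemma queues_drain:
  assumes typical: "typical eps z"
    and eps: "e3 = eps N1 {N3}" "e4 = eps N1 {N4}" "e23 = eps N1 {N2,N3}" "e34 = eps N1 {N3,N4}"
      "e234 = eps N1 {N2,N3,N4}" "f3 = eps N2 {N3}" "f4 = eps N2 {N4}" "f34 = eps N2 {N3,N4}"
    and K: "dens K1 R1" "dens K2 R2"
    and sum_L: "(\<Sum>j<14. L j) = 1"
    and less1: "e234 < 1" "e23 < 1" "f34 < 1" "f3 < 1"
    and h0: "(1 - e234) * L 0 = R1"
    and h1: "(1 - e23) * L 1 = (e23 - e234) * L 0"
    and h3: "(1 - f34) * (L 3 + L 5)
      = (e34 - e234) * L 0 - (1 - e34) * L 2"
    and h4: "(1 - f34) * L 4 = R2"
    and h5: "(1 - f4) * L 5 \<le> (f4 - f34) * L 4"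
    and h6: "(1 - e34) * L 6 = (f3 - f34) * L 5"
    and h7: "(1 - e4) * L 7 \<le> (1 - f3 - f4 + f34) * L 5
      + (e4 - e34) * L 6"
    and slack: "\<And>j. j \<in> {8, 9, 10, 11, 12} \<Longrightarrow> L j > 0"
    and fin3: "(e3 - e23 - e34 + e234) * L 0
      + (e3 - e23) * L 1 + (e3 - e34) * L 2
      + (f3 - f34) * L 3 + (e3 - e34) * L 6
      < (1 - f3) * L 13"
    and fin4: "(f4 - f34) * L 4 - (1 - f4) * L 5
      + (1 - f3 - f4 + f34) * L 5
      + (e4 - e34) * L 6 - (1 - e4) * L 7
      < (1 - f4) * L 13"
  shows "\<forall>\<^sub>F n in sequentially. path n n =
    empty_queues"
proof -
  note any = typical_any[OF typical] and diff = typical_diff[OF typical]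
  have a234: "freq z N1 (\<lambda>r. r N2 \<or> r N3 \<or> r N4) (1 - e234)"
    unfolding eps by (rule freq_cong[OF any[of N1 "{N2,N3,N4}"]]) auto
  have a23: "freq z N1 (\<lambda>r. r N2 \<or> r N3) (1 - e23)"
    unfolding eps by (rule freq_cong[OF any[of N1 "{N2,N3}"]]) auto
  have a34: "freq z N1 (\<lambda>r. r N3 \<or> r N4) (1 - e34)"
    unfolding eps by (rule freq_cong[OF any[of N1 "{N3,N4}"]]) auto
  have a4: "freq z N1 (\<lambda>r. r N4) (1 - e4)"
    unfolding eps by (rule freq_cong[OF any[of N1 "{N4}"]]) auto
  have b34: "freq z N2 (\<lambda>r. r N3 \<or> r N4) (1 - f34)"
    unfolding eps by (rule freq_cong[OF any[of N2 "{N3,N4}"]]) auto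
  have b3: "freq z N2 (\<lambda>r. r N3) (1 - f3)"
    unfolding eps by (rule freq_cong[OF any[of N2 "{N3}"]]) auto
  have b4: "freq z N2 (\<lambda>r. r N4) (1 - f4)"
    unfolding eps by (rule freq_cong[OF any[of N2 "{N4}"]]) auto
  have a4_23: "freq z N1 (\<lambda>r. r N4 \<and> \<not> r N2 \<and> \<not> r N3) (e23 - e234)"
    unfolding eps by (rule freq_cong[OF diff[of N1 "{N2,N3}" "{N2,N3,N4}"]]) auto
  have a2_34: "freq z N1 (\<lambda>r. r N2 \<and> \<not> r N3 \<and> \<not> r N4) (e34 - e234)"
    unfolding eps by (rule freq_cong[OF diff[of N1 "{N3,N4}" "{N2,N3,N4}"]]) auto
  have a2_3: "freq z N1 (\<lambda>r. r N2 \<and> \<not> r N3) (e3 - e23)"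
    unfolding eps by (rule freq_cong[OF diff[of N1 "{N3}" "{N2,N3}"]]) auto
  have a24_3: "freq z N1 (\<lambda>r. r N2 \<and> r N4 \<and> \<not> r N3)
      (e3 - e23 - (e34 - e234))"
    by (rule freq_cong[OF freq_diff[OF a2_3 a2_34]]) auto
  have a4_3: "freq z N1 (\<lambda>r. r N4 \<and> \<not> r N3) (e3 - e34)"
    unfolding eps by (rule freq_cong[OF diff[of N1 "{N3}" "{N3,N4}"]]) auto
  have a3_4: "freq z N1 (\<lambda>r. r N3 \<and> \<not> r N4) (e4 - e34)"
    unfolding eps by (rule freq_cong[OF diff[of N1 "{N4}" "{N3,N4}"]]) auto
  have b4_3: "freq z N2 (\<lambda>r. r N4 \<and> \<not> r N3) (f3 - f34)"
    unfolding eps by (rule freq_cong[OF diff[of N2 "{N3}" "{N3,N4}"]]) auto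
  have b3_4: "freq z N2 (\<lambda>r. r N3 \<and> \<not> r N4) (f4 - f34)"
    unfolding eps by (rule freq_cong[OF diff[of N2 "{N4}" "{N3,N4}"]]) auto
  have b34_0: "freq z N2 (\<lambda>r. r N3 \<and> r N4) (1 - f3 - f4 + f34)"
    by (rule freq_cong[OF freq_diff[OF b4 b4_3]]) auto
  have nn: "0 \<le> L j" for j by (rule L_nonneg)
  let ?A4 = "(e23 - e234) * L 0"
  let ?A2 = "(e34 - e234) * L 0"
  let ?q0 = "(e3 - e23 - (e34 - e234)) * L 0"
  have ph [simp]: "phase_list ! 0 = New1" "phase_list ! 1 = At4" "phase_list ! 2 = At2_by1"
    "phase_list ! 3 = At2_by2" "phase_list ! 4 = New2" "phase_list ! 5 = Mix"
    "phase_list ! 6 = Pend_by1" "phase_list ! 7 = Link" "phase_list ! 8 = New1"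
    "phase_list ! 9 = At4" "phase_list ! 10 = At2_by2" "phase_list ! 11 = New2"
    "phase_list ! 12 = Pend_by2" "phase_list ! 13 = Final"
    by (simp_all add: phase_list_def)
  have F1: "fluid 1 (case_queue 0 ?A4 ?A2 ?q0 0 0 R2 0)"
    by (rule fluid_eqI[OF fluid_serve[where k = 0 and e = "case_queue 0
          (e23 - e234) (e34 - e234)
          (e3 - e23 - (e34 - e234)) 0 0 0 0",
          OF ph(1) serves_New1 _ _ fluid_init[OF K]]])
      (use a234 a4_23 a2_34 a24_3 freq_False h0 in \<open>auto split: queue.splits\<close>)
  let ?q1 = "?q0 + (e3 - e23) * L 1"
  have F2: "fluid 2 (case_queue 0 0 ?A2 ?q1 0 0 R2 0)"
    by (rule fluid_eqI[OF fluid_serve[where k = 1 and e = "case_queue 0 0 0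
          (e3 - e23) 0 0 0 0",
          OF ph(2) serves_At4 _ _ F1]])
      (use a23 a2_3 freq_False h1 in \<open>auto split: queue.splits\<close>)
  let ?q2 = "?q1 + (e3 - e34) * L 2"
  have le34: "(1 - e34) * L 2 \<le> ?A2"
    using h3 nn[of 3] nn[of 5] less1 mult_nonneg_nonneg[of "1 - f34" "L 3 + L 5"] by linarith
  have F3: "fluid 3 (case_queue 0 0 (?A2 - (1 - e34) * L 2) ?q2 0 0 R2 0)"
    by (rule fluid_eqI[OF fluid_serve[where k = 2 and e = "case_queue 0 0 0
          (e3 - e34) 0 0 0 0",
          OF ph(3) serves_At2 _ _ F2]])
      (use a34 a4_3 freq_False le34 in \<open>auto split: queue.splits\<close>)
  let ?q3 = "?q2 + (f3 - f34) * L 3"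
  let ?X = "(1 - f34) * L 5"
  \<comment> \<open>The packets still in \<open>at2\<close> split here: phase 3 sends some of them
    uncoded, and \<open>?X\<close> remains for \<open>Mix\<close>.\<close>
  have X: "?A2 - (1 - e34) * L 2 = (1 - f34) * L 3 + ?X"
    using h3 by (simp add: distrib_left)
  have Xnn: "0 \<le> ?X" using nn less1 by (intro mult_nonneg_nonneg) auto
  have F4: "fluid 4 (case_queue 0 0 ?X ?q3 0 0 R2 0)"
    by (rule fluid_eqI[OF fluid_serve[where k = 3 and e = "case_queue 0 0 0
          (f3 - f34) 0 0 0 0",
          OF ph(4) serves_At2 _ _ F3[unfolded X]]])
      (use b34 b4_3 freq_False Xnn in \<open>auto split: queue.splits\<close>)
  let ?t = "(f4 - f34) * L 4"
  have F5: "fluid 5 (case_queue 0 0 ?X ?q3 0 0 0 ?t)"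
    by (rule fluid_eqI[OF fluid_serve[where k = 4 and e = "case_queue 0 0 0
          0 0 0 0 (f4 - f34)",
          OF ph(5) serves_New2 _ _ F4]])
      (use b34 b3_4 freq_False h4 in \<open>auto split: queue.splits\<close>)
  let ?B = "(1 - f3 - f4 + f34) * L 5"
  have F6: "fluid 6 (case_queue 0 0 0 ?q3 ((f3 - f34) * L 5) ?B 0
      (?t - (1 - f4) * L 5))"
    by (rule fluid_eqI[OF fluid_Mix[where k = 5, OF ph(6) b34 b4 b34_0 b4_3 F5 _ h5]])
      (auto split: queue.splits)
  let ?q6 = "?q3 + (e3 - e34) * L 6"
  let ?l6 = "?B + (e4 - e34) * L 6"
  have F7: "fluid 7 (case_queue 0 0 0 ?q6 0 ?l6 0 (?t - (1 - f4) * L 5))"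
    by (rule fluid_eqI[OF fluid_serve[where k = 6 and e = "case_queue 0 0 0
          (e3 - e34) 0 (e4 - e34) 0 0",
          OF ph(7) serves_Pend_by1 _ _ F6]])
      (use a34 a4_3 a3_4 freq_False h6 in \<open>auto split: queue.splits\<close>)
  \<comment> \<open>This state persists up to \<open>Final\<close>, because the five clearing phases
    move only o(n) packets.\<close>
  let ?v = "case_queue 0 0 0 ?q6 0 (?l6 - (1 - e4) * L 7) 0 (?t - (1 - f4) * L 5)"
  have F8: "fluid 8 ?v"
    by (rule fluid_eqI[OF fluid_serve[where k = 7 and e = "\<lambda>_. 0",
          OF ph(8) serves_Link _ _ F7]])
      (use a4 freq_False h7 in \<open>auto split: queue.splits\<close>)
  have pos: "s * L j > 0" if "s > 0" "j \<in> {8, 9, 10, 11, 12}" for s j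
    using slack[OF that(2)] that(1) by simp
  have C8: "fluid (Suc 8) ?v" "cleared (Suc 8) QNew1"
    using fluid_clear[OF ph(9) serves_New1 _ pos F8] a234 less1 by auto
  have C9: "fluid (Suc 9) ?v" "cleared (Suc 9) QAt4" "cleared (Suc 9) QNew1"
    using fluid_clear[OF ph(10) serves_At4 _ pos C8(1)[simplified]] C8(2) a23 less1 by auto
  have C10: "fluid (Suc 10) ?v" "cleared (Suc 10) QAt2" "cleared (Suc 10) QAt4" "cleared (Suc 10) QNew1"
    using fluid_clear[OF ph(11) serves_At2 _ pos C9(1)[simplified]] C9 b34 less1 by auto
  have C11: "fluid (Suc 11) ?v" "cleared (Suc 11) QNew2" "cleared (Suc 11) QAt2"
    "cleared (Suc 11) QAt4" "cleared (Suc 11) QNew1"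
    using fluid_clear[OF ph(12) serves_New2 _ pos C10(1)[simplified]] C10 b34 less1 by auto
  have C12: "fluid (Suc 12) ?v" "cleared (Suc 12) QPend" "cleared (Suc 12) QNew2"
    "cleared (Suc 12) QAt2" "cleared (Suc 12) QAt4" "cleared (Suc 12) QNew1"
    using fluid_clear[OF ph(13) serves_Pend_by2 _ pos C11(1)[simplified]] C11 b3 less1 by auto
  have "cleared (Suc 13) q" for q
  proof (rule cleared_Final[OF ph(14) b3 b4])
    show "fluid 13 ?v" using C12(1) by simp
    show "?v QAt24 < (1 - f3) * L 13" "?v QAt3 + ?v QLink < (1 - f4) * L 13"
      using fin3 fin4 by (simp_all add: algebra_simps)
    show "cleared 13 q" if "q \<notin> {QAt24, QAt3, QLink}" for q
      using C12 that by (cases q) auto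
  qed
  then have "\<forall>\<^sub>F n in sequentially. \<forall>q. len (state n 14) q = 0"
    unfolding cleared_def queue_all eventually_conj_iff by (simp del: len.simps)
  moreover have "state n 14 = path n n" for n
    using sum_L by (simp add: state_def boundary_def)
  ultimately show ?thesis
    by (auto elim!: eventually_mono simp: queue_all empty_queues_def)
qed

end

section \<open>Achievability\<close>

lemma occ_eq_sum: "occ P 0 n = (\<Sum>t\<in>{1..n}. of_bool (P (t - 1)))"
proof -
  have "occ P 0 n = (\<Sum>t<n. of_bool (P t))"
    by (auto simp: occ_def lessThan_atLeast0 intro!: arg_cong[of _ _ card])
  also have "\<dots> = (\<Sum>t\<in>{1..n}. of_bool (P (t - 1)))"
    by (rule sum.reindex_bij_witness[of _ "\<lambda>t. t - 1" Suc]) auto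
  finally show ?thesis .
qed

context erasure_network
begin

lemma measurable_link [measurable]:
  "t \<ge> 1 \<Longrightarrow> (\<lambda>\<omega>. link_state (Z t \<omega>)) \<in> measurable M (count_space UNIV)"
  using indep_Z by (auto simp: indep_vars_def)

lemma prob_none:
  assumes "t \<ge> 1" "i \<in> {N1, N2}" "S \<subseteq> nbrs i"
  shows "prob {\<omega> \<in> space M. \<forall>j\<in>S. \<not> link_state (Z t \<omega>) i j} = eps i S"
proof -
  have "{\<omega> \<in> space M. \<forall>j\<in>S. \<not> link_state (Z t \<omega>) i j} = {\<omega> \<in> space M. \<forall>j\<in>S. \<not> Z t \<omega> i j}"
    using assms(3) by (auto simp: link_state_def)
  then show ?thesis using eps[OF assms] by simp
qed

text \<open>The indicators of a joint erasure are independent with the same mean, even if the law of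
  the whole tuple varies with time. Hoeffding's inequality makes the deviation probabilities
  summable, and Borel-Cantelli gives the limit.\<close>

lemma AE_freq_none:
  assumes "i \<in> {N1, N2}" "S \<subseteq> nbrs i"
  shows "AE \<omega> in M. freq (\<lambda>t. Z t \<omega>) i (\<lambda>r. \<forall>j\<in>S. \<not> r j) (eps i S)"
proof -
  define f :: "(node \<Rightarrow> node \<Rightarrow> bool) \<Rightarrow> real" where "f = (\<lambda>r. of_bool (\<forall>j\<in>S. \<not> r i j))"
  define X where "X = (\<lambda>t \<omega>. f (link_state (Z t \<omega>)))"
  define s where "s = (\<lambda>n \<omega>. \<Sum>t\<in>{1..n}. X t \<omega>)"
  have X_meas: "X t \<in> borel_measurable M" if "t \<ge> 1" for t
    unfolding X_def using measurable_link[OF that] by simp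
  have s_meas [measurable]: "s n \<in> borel_measurable M" for n
    unfolding s_def by (intro borel_measurable_sum X_meas) auto
  have ind: "indep_vars (\<lambda>_. borel) X {1..n}" for n
    unfolding X_def
    by (rule indep_vars_compose2[OF indep_vars_subset[OF indep_Z]]) auto
  have EX: "expectation (X t) = eps i S" if "t \<ge> 1" for t
  proof -
    have "X t \<omega> = indicator {\<omega> \<in> space M. \<forall>j\<in>S. \<not> link_state (Z t \<omega>) i j} \<omega>" if "\<omega> \<in> space M" for \<omega>
      using that by (auto simp: X_def f_def indicator_def)
    then have "expectation (X t) = expectation (indicator {\<omega> \<in> space M. \<forall>j\<in>S. \<not> link_state (Z t \<omega>) i j})"
      by (intro Bochner_Integration.integral_cong) auto
    also have "\<dots> = eps i S" using prob_none[OF that assms]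
      by (simp add: Int_absorb1 Int_absorb2 Collect_conj_eq)
    finally show ?thesis .
  qed
  have hoeff: "prob {\<omega> \<in> space M. \<bar>s n \<omega> - n * eps i S\<bar> \<ge> d * n} \<le> 2 * exp (- 2 * d\<^sup>2) ^ n"
    if "d > 0" "n > 0" for d :: real and n :: nat
  proof -
    interpret H: Hoeffding_ineq M "{1..n}" X "\<lambda>_. 0" "\<lambda>_. 1" "n * eps i S"
    proof unfold_locales
      show "real n * eps i S \<equiv> \<Sum>i\<in>{1..n}. expectation (X i)"
        using EX by (intro eq_reflection) simp
    qed (use ind in \<open>auto simp: X_def f_def\<close>)
    have "- 2 * (d * n)\<^sup>2 / (\<Sum>i\<in>{1..n}. (1 - 0 :: real)\<^sup>2) = n * (- 2 * d\<^sup>2)"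
      using that by (simp add: power2_eq_square)
    then show ?thesis
      using H.Hoeffding_ineq_abs_ge[of "d * n"] that
      by (simp add: s_def exp_of_nat_mult[symmetric])
  qed
  have "AE \<omega> in M. \<forall>\<^sub>F n in sequentially. \<bar>s n \<omega> - n * eps i S\<bar> < d * n" if "d > 0" for d :: real
  proof -
    \<comment> \<open>The index is shifted because \<open>hoeff\<close> covers only positive block
      lengths.\<close>
    have "AE \<omega> in M. \<forall>\<^sub>F n in sequentially. \<omega> \<in> space M - {\<omega> \<in> space M. \<bar>s (Suc n) \<omega> - (Suc n) * eps i S\<bar> \<ge> d * Suc n}"
    proof (rule borel_cantelli_AE1)
      show "summable (\<lambda>n. prob {\<omega> \<in> space M. \<bar>s (Suc n) \<omega> - (Suc n) * eps i S\<bar> \<ge> d * Suc n})"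
      proof (rule summable_comparison_test')
        have "exp (- 2 * d\<^sup>2) < 1" using that by simp
        then show "summable (\<lambda>n. 2 * exp (- 2 * d\<^sup>2) ^ Suc n)"
          by (intro summable_mult) (simp add: summable_geometric)
        show "norm (prob {\<omega> \<in> space M. \<bar>s (Suc n) \<omega> - (Suc n) * eps i S\<bar> \<ge> d * Suc n})
           \<le> 2 * exp (- 2 * d\<^sup>2) ^ Suc n" if "n \<ge> 0" for n
          using hoeff[OF \<open>d > 0\<close>, of "Suc n"] by simp
      qed
    qed (auto simp: emeasure_eq_measure)
    then show ?thesis
    proof (rule AE_mp, intro AE_I2 impI)
      fix \<omega> assume "\<omega> \<in> space M"
        and "\<forall>\<^sub>F n in sequentially. \<omega> \<in> space M - {\<omega> \<in> space M. \<bar>s (Suc n) \<omega> - (Suc n) * eps i S\<bar> \<ge> d * Suc n}"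
      then have "\<forall>\<^sub>F n in sequentially. \<bar>s (Suc n) \<omega> - (Suc n) * eps i S\<bar> < d * Suc n"
        by (auto elim!: eventually_mono)
      then show "\<forall>\<^sub>F n in sequentially. \<bar>s n \<omega> - n * eps i S\<bar> < d * n"
        by (rule eventually_sequentially_Suc[THEN iffD1])
    qed
  qed
  then have "AE \<omega> in M. \<forall>k. \<forall>\<^sub>F n in sequentially. \<bar>s n \<omega> - n * eps i S\<bar> < inverse (Suc k) * n"
    unfolding AE_all_countable by simp
  then show ?thesis
  proof (rule AE_mp, intro AE_I2 impI)
    fix \<omega> assume *: "\<forall>k. \<forall>\<^sub>F n in sequentially. \<bar>s n \<omega> - n * eps i S\<bar> < inverse (Suc k) * n"
    have "(\<lambda>n. s n \<omega> / real n) \<longlonglongrightarrow> eps i S"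
    proof (rule tendstoI)
      fix e :: real assume "e > 0"
      then obtain k where k: "inverse (Suc k) < e" using reals_Archimedean by blast
      show "\<forall>\<^sub>F n in sequentially. dist (s n \<omega> / real n) (eps i S) < e"
        using *[rule_format, of k] eventually_gt_at_top[of 0]
      proof eventually_elim
        case (elim n)
        have "dist (s n \<omega> / real n) (eps i S) = \<bar>s n \<omega> - n * eps i S\<bar> / n"
          using elim by (simp add: dist_real_def field_simps abs_div_pos[symmetric])
        also have "\<dots> < inverse (Suc k)" using elim by (simp add: field_simps)
        finally show ?case using k by simp
      qed
    qed
    moreover have "real (occ (\<lambda>t. \<forall>j\<in>S. \<not> link_state (Z (Suc t) \<omega>) i j) 0 n) = s n \<omega>" for n
      unfolding occ_eq_sum s_def X_def f_def by simp
    ultimately show "freq (\<lambda>t. Z t \<omega>) i (\<lambda>r. \<forall>j\<in>S. \<not> r j) (eps i S)"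
      unfolding freq_def dens_def by simp
  qed
qed

lemma AE_typical: "AE \<omega> in M. typical eps (\<lambda>t. Z t \<omega>)"
proof -
  have "finite (nbrs i)" for i by (cases i) auto
  then have "AE \<omega> in M. \<forall>S\<in>Pow (nbrs i). freq (\<lambda>t. Z t \<omega>) i (\<lambda>r. \<forall>j\<in>S. \<not> r j) (eps i S)"
    if "i \<in> {N1, N2}" for i
    using AE_freq_none[OF that] by (intro AE_finite_allI) auto
  then have "AE \<omega> in M. \<forall>i\<in>{N1, N2}. \<forall>S\<in>Pow (nbrs i).
      freq (\<lambda>t. Z t \<omega>) i (\<lambda>r. \<forall>j\<in>S. \<not> r j) (eps i S)"
    by (rule AE_finite_allI[rotated]) simp_all
  then show ?thesis unfolding typical_def by (rule AE_mp) (rule AE_I2, blast)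
qed

end

section \<open>Functions of finitely many slots: measurability and expectation\<close>

definition causal :: "nat \<Rightarrow> (erasures \<Rightarrow> 'b) \<Rightarrow> bool" where
  "causal n G \<longleftrightarrow> (\<forall>z z'. (\<forall>t. 1 \<le> t \<and> t \<le> n \<longrightarrow> link_state (z t) = link_state (z' t)) \<longrightarrow> G z = G z')"

lemma causalI:
  "(\<And>z z'. (\<And>t. 1 \<le> t \<Longrightarrow> t \<le> n \<Longrightarrow> link_state (z t) = link_state (z' t)) \<Longrightarrow> G z = G z')
    \<Longrightarrow> causal n G"
  unfolding causal_def by blast

lemma causalD:
  "causal n G \<Longrightarrow> (\<And>t. 1 \<le> t \<Longrightarrow> t \<le> n \<Longrightarrow> link_state (z t) = link_state (z' t)) \<Longrightarrow> G z = G z'"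
  unfolding causal_def by blast

lemma causal_mono: "causal m G \<Longrightarrow> m \<le> n \<Longrightarrow> causal n G"
  unfolding causal_def by (meson order_trans)

lemma causal_const: "causal n (\<lambda>z. c)"
  by (simp add: causal_def)

lemma causal_map: "causal n G \<Longrightarrow> causal n (\<lambda>z. f (G z))"
  unfolding causal_def by (intro allI impI arg_cong[where f = f]) blast

lemma causal_map2: "causal n G \<Longrightarrow> causal n H \<Longrightarrow> causal n (\<lambda>z. f (G z) (H z))"
  unfolding causal_def by (intro allI impI arg_cong2[where f = f]) blast+

lemma causal_link: "1 \<le> t \<Longrightarrow> t \<le> n \<Longrightarrow> causal n (\<lambda>z. link_state (z t))"
  by (simp add: causal_def)

lemma link_state_idem [simp]: "link_state (link_state z) = link_state z"
  by (auto simp: link_state_def fun_eq_iff)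

lemma feedback_cong:
  "(\<And>t. 1 \<le> t \<Longrightarrow> t \<le> n \<Longrightarrow> link_state (z t) = link_state (z' t)) \<Longrightarrow> feedback c z n = feedback c z' n"
  by (induction n) auto

lemma causal_feedback: "t \<le> n \<Longrightarrow> causal n (\<lambda>z. feedback c z t)"
  by (intro causalI feedback_cong) auto

lemma causal_Y1: "t \<le> n \<Longrightarrow> causal n (\<lambda>z. Y1 c z w1 j t)"
proof (rule causalI)
  fix z z' assume "t \<le> n" and eq: "\<And>t. 1 \<le> t \<Longrightarrow> t \<le> n \<Longrightarrow> link_state (z t) = link_state (z' t)"
  have "feedback c z s = feedback c z' s" if "s \<le> n" for s
    using eq that by (intro feedback_cong) auto
  then show "Y1 c z w1 j t = Y1 c z' w1 j t"
    unfolding Y1_def using \<open>t \<le> n\<close> eq by (auto simp: channel_out_def X1_def sender_def)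
qed

lemma causal_Y2: "t \<le> n \<Longrightarrow> causal n (\<lambda>z. Y2 c z w1 w2 j t)"
proof (rule causalI)
  fix z z' assume "t \<le> n" and eq: "\<And>t. 1 \<le> t \<Longrightarrow> t \<le> n \<Longrightarrow> link_state (z t) = link_state (z' t)"
  have "feedback c z s = feedback c z' s" if "s \<le> n" for s
    using eq that by (intro feedback_cong) auto
  moreover have "Y1 c z w1 N2 s = Y1 c z' w1 N2 s" if "s \<le> n" for s
    by (rule causalD[OF causal_Y1[OF that] eq])
  ultimately show "Y2 c z w1 w2 j t = Y2 c z' w1 w2 j t"
    unfolding Y2_def using \<open>t \<le> n\<close> eq by (auto simp: channel_out_def X2_def sender_def)
qed

lemma causal_decoding_error: "causal n (\<lambda>z. decoding_error n c z w1 w2)"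
proof (rule causalI)
  fix z z' assume eq: "\<And>t. 1 \<le> t \<Longrightarrow> t \<le> n \<Longrightarrow> link_state (z t) = link_state (z' t)"
  have "Y1 c z w1 j n = Y1 c z' w1 j n" for j
    by (rule causalD[OF causal_Y1[OF order_refl] eq])
  moreover have "Y2 c z w1 w2 j n = Y2 c z' w1 w2 j n" for j
    by (rule causalD[OF causal_Y2[OF order_refl] eq])
  moreover have "feedback c z n = feedback c z' n"
    by (rule feedback_cong[OF eq])
  ultimately show "decoding_error n c z w1 w2 = decoding_error n c z' w1 w2"
    unfolding decoding_error_def by simp
qed

lemma causal_prob_error:
  "causal n (\<lambda>z. measure_pmf.prob p {(w1, w2). decoding_error n c z w1 w2})"
proof (rule causalI)
  fix z z' assume eq: "\<And>t. 1 \<le> t \<Longrightarrow> t \<le> n \<Longrightarrow> link_state (z t) = link_state (z' t)"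
  have "decoding_error n c z w1 w2 = decoding_error n c z' w1 w2" for w1 w2
    by (rule causalD[OF causal_decoding_error eq])
  then show "measure_pmf.prob p {(w1, w2). decoding_error n c z w1 w2}
      = measure_pmf.prob p {(w1, w2). decoding_error n c z' w1 w2}" by simp
qed

context erasure_network
begin

lemma countable_link: "countable (UNIV :: (node \<Rightarrow> node \<Rightarrow> bool) set)"
  by (rule countable_finite) simp

lemma measurable_map_list:
  fixes f :: "nat \<Rightarrow> 'a \<Rightarrow> node \<Rightarrow> node \<Rightarrow> bool"
  assumes "\<And>t. t \<in> set ts \<Longrightarrow> f t \<in> measurable M (count_space UNIV)"
  shows "(\<lambda>\<omega>. map (\<lambda>t. f t \<omega>) ts) \<in> measurable M (count_space UNIV)"
proof -
  have "countable (UNIV :: (node \<Rightarrow> node \<Rightarrow> bool) list set)"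
    using countable_lists[OF countable_link] by simp
  moreover have "(\<lambda>\<omega>. map (\<lambda>t. f t \<omega>) ts) -` {l} \<inter> space M \<in> sets M" for l
    using assms
  proof (induction ts arbitrary: l)
    case (Cons t ts)
    show ?case
    proof (cases l)
      case (Cons a l')
      have "(\<lambda>\<omega>. map (\<lambda>t. f t \<omega>) (t # ts)) -` {l} \<inter> space M =
          (f t -` {a} \<inter> space M) \<inter> ((\<lambda>\<omega>. map (\<lambda>t. f t \<omega>) ts) -` {l'} \<inter> space M)"
        using Cons by auto
      also have "\<dots> \<in> sets M"
        using Cons.IH[of l'] Cons.prems by (intro sets.Int[OF measurable_sets[of "f t" M "count_space UNIV"]]) auto
      finally show ?thesis .
    qed (simp add: vimage_def)
  qed (cases "l = []", auto)
  ultimately show ?thesis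
    by (subst measurable_count_space_eq2_countable) auto
qed

text \<open>A finite list of link states, read again as a realization, determines the value. Only
  finitely many such lists exist, which gives measurability, finite range and integrability for
  arbitrary codes.\<close>

lemma causal_factor:
  assumes "causal n G"
  shows "G (\<lambda>t. Z t \<omega>) = (\<lambda>l. G (\<lambda>t. l ! (t - 1))) (map (\<lambda>t. link_state (Z t \<omega>)) [1..<Suc n])"
proof (rule causalD[OF assms])
  fix t assume "1 \<le> t" "t \<le> n"
  then show "link_state (Z t \<omega>) = link_state (map (\<lambda>t. link_state (Z t \<omega>)) [1..<Suc n] ! (t - 1))"
    by (cases t) (simp_all del: upt_Suc)
qed

lemma causal_measurable:
  assumes "causal n G"
  shows "(\<lambda>\<omega>. G (\<lambda>t. Z t \<omega>)) \<in> measurable M (count_space UNIV)"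
  unfolding causal_factor[OF assms]
  by (rule measurable_compose[OF measurable_map_list]) auto

lemma causal_borel:
  assumes "causal n (G :: _ \<Rightarrow> real)"
  shows "(\<lambda>\<omega>. G (\<lambda>t. Z t \<omega>)) \<in> borel_measurable M"
  using measurable_compose[OF causal_measurable[OF assms], of id borel] by simp

lemma causal_range_finite:
  assumes "causal n G"
  shows "finite (range (\<lambda>\<omega>. G (\<lambda>t. Z t \<omega>)))"
proof (rule finite_subset)
  show "range (\<lambda>\<omega>. G (\<lambda>t. Z t \<omega>)) \<subseteq> (\<lambda>l. G (\<lambda>t. l ! (t - 1))) ` {l. set l \<subseteq> UNIV \<and> length l = n}"
    unfolding causal_factor[OF assms] by (auto simp del: upt_Suc)
  show "finite ((\<lambda>l. G (\<lambda>t. l ! (t - 1))) ` {l. set l \<subseteq> UNIV \<and> length l = n})"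
    by (intro finite_imageI finite_lists_length_eq) simp
qed

lemma causal_integrable:
  assumes "causal n (G :: _ \<Rightarrow> real)"
  shows "integrable M (\<lambda>\<omega>. G (\<lambda>t. Z t \<omega>))"
proof -
  obtain B where "\<forall>x\<in>range (\<lambda>\<omega>. G (\<lambda>t. Z t \<omega>)). norm x \<le> B"
    using finite_imp_bounded[OF causal_range_finite[OF assms]] bounded_iff by blast
  then show ?thesis
    by (intro integrable_const_bound[of _ B] causal_borel[OF assms]) auto
qed

text \<open>Fubini. The error event is measurable as a countable union of rectangles, one for each
  message pair.\<close>

lemma error_prob_eq:
  fixes c :: "'f::{field, finite} channel_code"
  defines "m \<equiv> \<lambda>r n. message_pmf (num_packets n r) :: 'f list pmf"
  shows "error_prob M Z n R c = expectation (\<lambda>\<omega>.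
    measure_pmf.prob (pair_pmf (m (fst R) n) (m (snd R) n)) {(w1, w2). decoding_error n c (\<lambda>t. Z t \<omega>) w1 w2})"
proof -
  let ?p = "pair_pmf (m (fst R) n) (m (snd R) n)"
  let ?P = "M \<Otimes>\<^sub>M measure_pmf ?p"
  let ?E = "{(\<omega>, w1, w2) \<in> space ?P. decoding_error n c (\<lambda>t. Z t \<omega>) w1 w2}"
  have "countable (UNIV :: ('f list \<times> 'f list) set)"
    using countable_lists[OF countable_finite[OF finite, of "UNIV :: 'f set"]]
    by (simp add: UNIV_Times_UNIV[symmetric] del: UNIV_Times_UNIV)
  moreover have "{\<omega> \<in> space M. decoding_error n c (\<lambda>t. Z t \<omega>) w1 w2} \<in> events" for w1 w2
    using measurable_sets[OF causal_measurable[OF causal_decoding_error[of n c w1 w2]], of "{True}"]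
    by (simp add: vimage_def Int_def conj_commute)
  moreover have "?E = (\<Union>w\<in>UNIV. {\<omega> \<in> space M. decoding_error n c (\<lambda>t. Z t \<omega>) (fst w) (snd w)} \<times> {w})"
    by (auto simp: space_pair_measure)
  ultimately have E: "?E \<in> sets ?P"
    by (simp only:) (intro sets.countable_UN' image_subsetI pair_measureI; simp)
  have "emeasure ?P ?E = (\<integral>\<^sup>+\<omega>. emeasure (measure_pmf ?p) (Pair \<omega> -` ?E) \<partial>M)"
    by (rule measure_pmf.emeasure_pair_measure_alt[OF E])
  also have "\<dots> = (\<integral>\<^sup>+\<omega>. ennreal (measure_pmf.prob ?p {(w1, w2). decoding_error n c (\<lambda>t. Z t \<omega>) w1 w2}) \<partial>M)"
    by (intro nn_integral_cong)
      (auto simp: measure_pmf.emeasure_eq_measure space_pair_measure vimage_def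
        intro!: arg_cong[of _ _ "measure_pmf.prob ?p"])
  also have "\<dots> = ennreal (expectation (\<lambda>\<omega>.
      measure_pmf.prob ?p {(w1, w2). decoding_error n c (\<lambda>t. Z t \<omega>) w1 w2}))"
  proof (rule nn_integral_eq_integral)
    show "integrable M (\<lambda>\<omega>. measure_pmf.prob ?p {(w1, w2). decoding_error n c (\<lambda>t. Z t \<omega>) w1 w2})"
      by (rule causal_integrable[OF causal_prob_error])
  qed simp
  finally have "measure ?P ?E = expectation (\<lambda>\<omega>.
      measure_pmf.prob ?p {(w1, w2). decoding_error n c (\<lambda>t. Z t \<omega>) w1 w2})"
    by (simp add: measure_def integral_nonneg_AE)
  then show ?thesis unfolding error_prob_def m_def Let_def .
qed

lemma set_message_pmf: "set_pmf (message_pmf k :: 'f::{field,finite} list pmf) = {w. length w = k}"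
proof -
  have "finite {w :: 'f list. length w = k}"
    using finite_lists_length_eq[of "UNIV :: 'f set" k] by simp
  moreover have "replicate k 0 \<in> {w :: 'f list. length w = k}" by simp
  ultimately show ?thesis unfolding message_pmf_def by (intro set_pmf_of_set) blast
qed

lemma dens_num_packets:
  assumes "r \<ge> 0"
  shows "dens (\<lambda>n. num_packets n r) r"
  unfolding dens_def
proof (rule real_tendsto_sandwich)
  have *: "real n * r \<le> real (num_packets n r)" "real (num_packets n r) \<le> real n * r + 1" for n
  proof -
    have "0 \<le> real n * r" using assms by simp
    then have "real (num_packets n r) = of_int \<lceil>real n * r\<rceil>"
      unfolding num_packets_def by (intro of_nat_nat) simp
    then show "real n * r \<le> real (num_packets n r)" "real (num_packets n r) \<le> real n * r + 1"
      by linarith+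
  qed
  show "\<forall>\<^sub>F n in sequentially. r \<le> real (num_packets n r) / real n"
    using eventually_gt_at_top[of 0] by eventually_elim (use * in \<open>simp add: field_simps\<close>)
  show "\<forall>\<^sub>F n in sequentially. real (num_packets n r) / real n \<le> r + 1 / real n"
    using eventually_gt_at_top[of 0]
  proof eventually_elim
    case (elim n)
    have "real (num_packets n r) / real n \<le> (real n * r + 1) / real n" by (intro divide_right_mono *) simp
    then show ?case using elim by (simp add: field_simps)
  qed
  have "(\<lambda>n. r + 1 / real n) \<longlonglongrightarrow> r + 0"
    by (intro tendsto_intros lim_1_over_n)
  then show "(\<lambda>n. r + 1 / real n) \<longlonglongrightarrow> r" by simp
qed simp

text \<open>Along a typical realization the conditional error probability is eventually 0, so
  dominated convergence gives the limit. \<open>R1 > 0\<close> guarantees that node 1 always has a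
  packet to name.\<close>

lemma achievable_if_queues_drain:
  assumes R: "R1 > 0" "R2 \<ge> 0"
    and queues_drain: "\<And>z. typical eps z \<Longrightarrow> \<forall>\<^sub>F n in sequentially.
      evolve (plan L n) (init_queues (num_packets n R1) (num_packets n R2))
        (\<lambda>s. link_state (z (Suc s)) (tx (plan L n s))) n =
      empty_queues"
  shows "achievable TYPE('f::{field, finite}) M Z (R1, R2)"
proof -
  define C :: "nat \<Rightarrow> 'f channel_code"
    where "C n = scheme_code (num_packets n R1) (num_packets n R2) (plan L n)" for n
  let ?p = "\<lambda>n. pair_pmf (message_pmf (num_packets n R1)) (message_pmf (num_packets n R2)) :: ('f list \<times> 'f list) pmf"
  have "is_code n (R1, R2) (C n)" if "n \<ge> 1" for n
    unfolding C_def using scheme_code_is_code[of n "(R1, R2)"] that R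
    by (simp add: num_packets_def)
  moreover have "(\<lambda>n. expectation (\<lambda>\<omega>. measure_pmf.prob (?p n)
      {(w1, w2). decoding_error n (C n) (\<lambda>t. Z t \<omega>) w1 w2})) \<longlonglongrightarrow> expectation (\<lambda>\<omega>. 0)"
  proof (rule integral_dominated_convergence[where w = "\<lambda>_. 1"])
    show "AE \<omega> in M. (\<lambda>n. measure_pmf.prob (?p n)
      {(w1, w2). decoding_error n (C n) (\<lambda>t. Z t \<omega>) w1 w2}) \<longlonglongrightarrow> 0"
      using AE_typical
    proof (rule AE_mp, intro AE_I2 impI)
      fix \<omega> assume "typical eps (\<lambda>t. Z t \<omega>)"
      from queues_drain[OF this]
      show "(\<lambda>n. measure_pmf.prob (?p n) {(w1, w2). decoding_error n (C n) (\<lambda>t. Z t \<omega>) w1 w2}) \<longlonglongrightarrow> 0"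
      proof (intro tendsto_eventually, eventually_elim)
        case (elim n)
        have "\<not> decoding_error n (C n) (\<lambda>t. Z t \<omega>) w1 w2" if "(w1, w2) \<in> set_pmf (?p n)" for w1 w2
          using that scheme_decodes[OF _ _ elim(2)] unfolding C_def by (auto simp: set_message_pmf)
        then show ?case
          by (subst measure_pmf_zero_iff) auto
      qed
    qed
  qed (use causal_borel[OF causal_prob_error] in auto)
  ultimately show ?thesis
    unfolding achievable_def error_prob_eq using R by (auto intro!: exI[of _ C])
qed

section \<open>From rate constraints to phase lengths\<close>

abbreviation "e3 \<equiv> eps N1 {N3}"
abbreviation "e4 \<equiv> eps N1 {N4}"
abbreviation "e23 \<equiv> eps N1 {N2, N3}"
abbreviation "e34 \<equiv> eps N1 {N3, N4}"
abbreviation "e234 \<equiv> eps N1 {N2, N3, N4}"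
abbreviation "f3 \<equiv> eps N2 {N3}"
abbreviation "f4 \<equiv> eps N2 {N4}"
abbreviation "f34 \<equiv> eps N2 {N3, N4}"

text \<open>Expected slots per packet of \<open>W_1\<close> on its way to node 3:
  \<open>1 / (1 - e23)\<close> by node 1 until node 2 or 3 has it; with probability
  \<open>(e3 - e23) / (1 - e23)\<close> it then falls to node 2, which needs
  \<open>1 / (1 - f3)\<close> more.\<close>

definition "coef3 = (e3 - e23) / ((1 - f3) * (1 - e23))
  + 1 / (1 - e23)"

text \<open>\<open>(e34 - e234) / (1 - e234)\<close> is the fraction of \<open>W_1\<close> that node
  2 alone holds once somebody has received it; such a packet occupies node 2 for
  \<open>1 / (1 - f34)\<close> slots until node 3 or 4 has it.\<close>

definition "coef4 = (e34 - e234) / ((1 - e234) * (1 - f34))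
  + 1 / (1 - e23)"

text \<open>The three gains compare a slot of node 1 with a slot of node 2 by the chance of
  reception at node 3, at node 3 or 4, and at node 4.\<close>

definition "gain3 = (1 - e3) / (1 - f3)"

definition "gain34 = (1 - e34) / (1 - f34)"

definition "gain4 = (1 - e4) / (1 - f4)"

text \<open>The time, per unit of \<open>R1\<close>, in which node 1 could bring every packet that
  only node 2 holds to node 3 or 4.\<close>

definition "capG = (e34 - e234) / ((1 - e234) * (1 - e34))"

lemma eps_mono:
  assumes "i \<in> {N1, N2}" "S \<subseteq> T" "T \<subseteq> nbrs i"
  shows "eps i T \<le> eps i S"
proof -
  have "{\<omega> \<in> space M. \<forall>j\<in>S. \<not> link_state (Z 1 \<omega>) i j} \<in> events"
    using measurable_sets[OF measurable_link[OF order_refl], of "{r. \<forall>j\<in>S. \<not> r i j}"]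
    by (simp add: vimage_def Int_def conj_commute)
  then show ?thesis
    unfolding prob_none[OF order_refl assms(1,3), symmetric]
      prob_none[OF order_refl assms(1) order_trans[OF assms(2,3)], symmetric]
    using assms(2) by (intro finite_measure_mono) auto
qed

lemma eps_nonneg: "i \<in> {N1, N2} \<Longrightarrow> S \<subseteq> nbrs i \<Longrightarrow> eps i S \<ge> 0"
  by (subst prob_none[OF order_refl, symmetric]) auto

lemma eps_le_1: "i \<in> {N1, N2} \<Longrightarrow> S \<subseteq> nbrs i \<Longrightarrow> eps i S \<le> 1"
  by (subst prob_none[OF order_refl, symmetric]) auto

lemma eps_order:
  "e234 \<le> e23" "e234 \<le> e34"
  "e23 \<le> e3" "e34 \<le> e3" "e34 \<le> e4"
  "f34 \<le> f3" "f34 \<le> f4"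
  "e3 \<le> 1" "e4 \<le> 1" "e34 \<le> 1" "e234 \<ge> 0"
  "f34 \<ge> 0"
  by (intro eps_mono eps_le_1 eps_nonneg; auto)+

text \<open>\<open>X\<close> is the amount of \<open>W_1\<close>-packets that enter phase \<open>Mix\<close>.\<close>

lemma achievable_if_feasible:
  assumes R: "R1 > 0" "R2 \<ge> 0" and nn: "G \<ge> 0" "S \<ge> 0" "U \<ge> 0" "X \<ge> 0"
    and X1: "(1 - e34) * G + X
      \<le> (e34 - e234) / (1 - e234) * R1"
    and X2: "(1 - e34) * S * (1 - f34) = (f3 - f34) * X"
    and X3: "(1 - e4) * (U + S) * (1 - f34) \<le> (1 - f4) * X"
    and X4: "(1 - f4) * X \<le> (f4 - f34) * R2"
    and T3: "coef3 * R1 + R2 / (1 - f34) < 1 - G - S - U + gain3 * (G + S)"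
    and T4: "coef4 * R1 + R2 / (1 - f4) < 1 - G - S - U + gain34 * G + gain4 * (S + U)"
  shows "achievable TYPE('f::{field, finite}) M Z (R1, R2)"
proof -
  note ord = eps_order
  have less: "e23 < 1" "f3 < 1" "f4 < 1" "e234 < 1" "f34 < 1"
    using eps_less_1 ord by linarith+
  \<comment> \<open>The lengths solve the flow balance with phases 2, 6 and 7 of lengths
    \<open>G\<close>, \<open>S\<close> and \<open>U\<close>; phase 3 stops when the density
    \<open>X\<close> is left for \<open>Mix\<close>.\<close>
  define l0 l1 l3 l4 l5 where l:
    "l0 = R1 / (1 - e234)" "l1 = (e23 - e234) / (1 - e23) * l0"
    "l3 = ((e34 - e234) * l0 - (1 - e34) * G - X) / (1 - f34)"
    "l4 = R2 / (1 - f34)" "l5 = X / (1 - f34)"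
  \<comment> \<open>\<open>base\<close> is the time before the clearing phases. \<open>q3\<close>
    and \<open>q4\<close> are the loads that \<open>Final\<close> must deliver to nodes 3 and 4, so
    its length has to exceed \<open>q3 / (1 - f3)\<close> and \<open>q4 / (1 - f4)\<close>; after
    simplification these are the conditions \<open>T3\<close> and \<open>T4\<close>.\<close>
  define base where "base = l0 + l1 + G + l3 + l4 + l5 + S + U"
  define q3 where "q3 = (e3 - e23 - e34 + e234) * l0 + (e3 - e23) * l1 + (e3 - e34) * G
    + (f3 - f34) * l3 + (e3 - e34) * S"
  define q4 where "q4 = (f4 - f34) * l4 - (1 - f4) * l5 + (1 - f3 - f4 + f34) * l5
    + (e4 - e34) * S - (1 - e4) * U"
  have a0: "(1 - e234) * l0 = R1" and a1: "(1 - e23) * l1 = (e23 - e234) * l0"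
    and a3: "(1 - f34) * l3 = (e34 - e234) * l0 - (1 - e34) * G - X"
    and a4: "(1 - f34) * l4 = R2" and a5: "(1 - f34) * l5 = X"
    using less by (simp_all add: l)
  have a6: "(1 - e34) * S = (f3 - f34) * l5"
    using X2 less by (simp add: l field_simps)
  have a5': "(1 - f4) * l5 \<le> (f4 - f34) * l4"
    using X4 less by (simp add: l divide_right_mono)
  have a7: "(1 - e4) * (U + S) \<le> (1 - f4) * l5"
    using X3 less by (simp add: l pos_le_divide_eq)
  have c01: "l0 + l1 = R1 / (1 - e23)"
  proof -
    have "(l0 + l1) * (1 - e23) = R1" using a0 a1 by (simp add: algebra_simps)
    then show ?thesis using less by (intro eq_divide_imp) auto
  qed
  have q3_eq: "q3 = (e3 - e23) * (R1 / (1 - e23)) - (1 - e3) * (G + S) - (1 - f3) * (l3 + l5)"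
    unfolding q3_def c01[symmetric] using a3 a5 a6 by (simp add: algebra_simps)
  have q4_eq: "q4 = (f4 - f34) * l4 - (1 - e4) * (S + U)"
    unfolding q4_def using a6 by (simp add: algebra_simps)
  have b35: "l3 + l5 = ((e34 - e234) * l0 - (1 - e34) * G) / (1 - f34)"
  proof -
    have "(l3 + l5) * (1 - f34) = (e34 - e234) * l0 - (1 - e34) * G"
      using a3 a5 by (simp add: algebra_simps)
    then show ?thesis using less by (intro eq_divide_imp) auto
  qed
  have "base + q3 / (1 - f3) = ((e3 - e23) / ((1 - f3) * (1 - e23)) + 1 / (1 - e23)) * R1
      + R2 / (1 - f34) + G + S + U - ((1 - e3) / (1 - f3)) * (G + S)"
  proof -
    have "q3 / (1 - f3) = (e3 - e23) * (R1 / (1 - e23)) / (1 - f3)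
        - (1 - e3) * (G + S) / (1 - f3) - (l3 + l5)"
      unfolding q3_eq using less by (simp add: diff_divide_distrib)
    moreover have "base = (l0 + l1) + l4 + (l3 + l5) + G + S + U" by (simp add: base_def)
    moreover have "(e3 - e23) * (R1 / (1 - e23)) / (1 - f3) = (e3 - e23) / ((1 - f3) * (1 - e23)) * R1"
      by (simp add: field_simps)
    ultimately show ?thesis unfolding c01 l(4) by (simp add: distrib_right)
  qed
  then have t3: "base + q3 / (1 - f3) < 1" using T3[unfolded coef3_def gain3_def] by linarith
  have "base + q4 / (1 - f4) = ((e34 - e234) / ((1 - e234) * (1 - f34)) + 1 / (1 - e23)) * R1
      + R2 / (1 - f4) + G + S + U - (1 - e34) / (1 - f34) * G - (1 - e4) / (1 - f4) * (S + U)"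
  proof -
    have "l4 + (f4 - f34) * l4 / (1 - f4) = R2 / (1 - f4)"
      unfolding a4[symmetric] using less by (simp add: field_simps)
    moreover have "q4 / (1 - f4) = (f4 - f34) * l4 / (1 - f4) - (1 - e4) / (1 - f4) * (S + U)"
      unfolding q4_eq by (subst diff_divide_distrib) simp
    moreover have "base = (l0 + l1) + l4 + (l3 + l5) + G + S + U" by (simp add: base_def)
    moreover have "l3 + l5 = (e34 - e234) / ((1 - e234) * (1 - f34)) * R1 - (1 - e34) / (1 - f34) * G"
      unfolding b35 l(1) by (subst diff_divide_distrib) simp
    ultimately show ?thesis unfolding c01 by (simp add: distrib_right)
  qed
  then have t4: "base + q4 / (1 - f4) < 1" using T4[unfolded coef4_def gain34_def gain4_def] by linarith
  \<comment> \<open>\<open>X3\<close> and \<open>X4\<close> keep the load of node 4 nonnegative, so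
    that \<open>t4\<close> already bounds \<open>base\<close>.\<close>
  have q4_nn: "q4 \<ge> 0" unfolding q4_eq using a5' a7 by (simp add: add.commute)
  have base: "base < 1" using t4 q4_nn less divide_nonneg_nonneg[of q4 "1 - f4"] by linarith
  \<comment> \<open>Five clearing phases, each of one sixth of the smallest slack, leave
    \<open>Final\<close> strictly long enough.\<close>
  define h where "h = min (1 - base) (min (1 - base - q3 / (1 - f3)) (1 - base - q4 / (1 - f4))) / 6"
  have h: "h > 0" "5 * h < 1 - base" "5 * h < 1 - base - q3 / (1 - f3)" "5 * h < 1 - base - q4 / (1 - f4)"
    unfolding h_def using base t3 t4 by (auto simp: min_def)
  define L where "L = (\<lambda>j. if j < 14 then [l0, l1, G, l3, l4, l5, S, U, h, h, h, h, h, 1 - base - 5 * h] ! j else 0)"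
  have L: "L 0 = l0" "L 1 = l1" "L 2 = G" "L 3 = l3" "L 4 = l4" "L 5 = l5" "L 6 = S" "L 7 = U"
    "L 8 = h" "L 9 = h" "L 10 = h" "L 11 = h" "L 12 = h" "L 13 = 1 - base - 5 * h"
    by (simp_all add: L_def)
  have l_nn: "l0 \<ge> 0" "l1 \<ge> 0" "l3 \<ge> 0" "l4 \<ge> 0" "l5 \<ge> 0"
    using X1 R nn less ord by (simp_all add: l)
  have L_nn: "L j \<ge> 0" for j
  proof (cases "j < 14")
    case True
    have "\<forall>x\<in>set [l0, l1, G, l3, l4, l5, S, U, h, h, h, h, h, 1 - base - 5 * h]. x \<ge> 0"
      using l_nn nn h by simp
    then show ?thesis using True unfolding L_def by (simp del: list.set nth_Cons_numeral add: all_set_conv_all_nth)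
  qed (simp add: L_def)
  have sum_L: "(\<Sum>j<14. L j) = 1"
    using L by (simp add: numeral_eq_Suc base_def)
  show ?thesis
  proof (rule achievable_if_queues_drain[OF R, where L = L])
    fix z assume "typical eps z"
    interpret fluid_run z L "\<lambda>n. num_packets n R1" "\<lambda>n. num_packets n R2"
      by unfold_locales (rule L_nn)
    have "\<forall>\<^sub>F n in sequentially. path n n =
      empty_queues"
    proof (rule queues_drain[OF \<open>typical eps z\<close> refl refl refl refl refl refl refl refl dens_num_packets dens_num_packets sum_L], unfold L)
      show "(e3 - e23 - e34 + e234) * l0 + (e3 - e23) * l1 + (e3 - e34) * G
          + (f3 - f34) * l3 + (e3 - e34) * S < (1 - f3) * (1 - base - 5 * h)"
        using h(3) less unfolding q3_def[symmetric] by (simp add: field_simps)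
      show "(f4 - f34) * l4 - (1 - f4) * l5 + (1 - f3 - f4 + f34) * l5
          + (e4 - e34) * S - (1 - e4) * U < (1 - f4) * (1 - base - 5 * h)"
        using h(4) less unfolding q4_def[symmetric] by (simp add: field_simps)
      show "(1 - f34) * (l3 + l5) = (e34 - e234) * l0 - (1 - e34) * G"
        using a3 a5 by (simp add: algebra_simps)
      show "(1 - e4) * U \<le> (1 - f3 - f4 + f34) * l5 + (e4 - e34) * S"
        using a7 a6 by (simp add: algebra_simps)
      show "0 < L j" if "j \<in> {8, 9, 10, 11, 12}" for j
        using that h L by auto
    qed (use less a0 a1 a4 a5' a6 R in auto)
    then show "\<forall>\<^sub>F n in sequentially.
      evolve (plan L n) (init_queues (num_packets n R1) (num_packets n R2))
        (\<lambda>s. link_state (z (Suc s)) (tx (plan L n s))) n =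
      empty_queues"
      unfolding path_def .
  qed
qed

end

text \<open>A convex combination with the strictly feasible rate pair \<open>(\<eta>, 0)\<close>,
  taken with auxiliary variables 0, makes a weak constraint strict.\<close>

lemma perturbed_less:
  fixes \<alpha> :: real
  assumes "\<alpha> * R + r \<le> 1 + k" "\<alpha> * \<eta> < 1" "0 < \<delta>" "\<delta> < 1"
  shows "\<alpha> * ((1 - \<delta>) * R + \<delta> * \<eta>) + (1 - \<delta>) * r < 1 + (1 - \<delta>) * k"
proof -
  have "(1 - \<delta>) * (\<alpha> * R + r) \<le> (1 - \<delta>) * (1 + k)" using assms by (intro mult_left_mono) auto
  moreover have "\<delta> * (\<alpha> * \<eta>) < \<delta> * 1" using assms by (intro mult_strict_left_mono) auto
  ultimately show ?thesis by (simp add: algebra_simps)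
qed

context erasure_network
begin

text \<open>The expression is the probability that nodes 2 and 4 receive from node 1 while node 3
  does not. It is read off as a limiting frequency along one typical realization, which exists since
  almost all are typical.\<close>

lemma eps_supermodular: "e3 - e23 - e34 + e234 \<ge> 0"
proof -
  obtain \<omega> where typical: "typical eps (\<lambda>t. Z t \<omega>)"
    using eventually_happens[OF AE_typical] ae_filter_eq_bot_iff emeasure_space_1 by force
  have "freq (\<lambda>t. Z t \<omega>) N1 (\<lambda>r. (\<not> r N3 \<and> r N2) \<and> \<not> (\<not> r N3 \<and> \<not> r N4 \<and> r N2))
      (e3 - e23 - (e34 - e234))"
  proof (rule freq_diff)
    show "freq (\<lambda>t. Z t \<omega>) N1 (\<lambda>r. \<not> r N3 \<and> r N2) (e3 - e23)"
      by (rule freq_cong[OF typical_diff[OF typical, of N1 "{N3}" "{N2,N3}"]]) auto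
    show "freq (\<lambda>t. Z t \<omega>) N1 (\<lambda>r. \<not> r N3 \<and> \<not> r N4 \<and> r N2) (e34 - e234)"
      by (rule freq_cong[OF typical_diff[OF typical, of N1 "{N3,N4}" "{N2,N3,N4}"]]) auto
  qed auto
  from dens_nonneg[OF this[unfolded freq_def]] show ?thesis by simp
qed

text \<open>The perturbation supplies both strictness and a positive first rate, and the closure
  absorbs it.\<close>

lemma in_capacity_region_if_feasible:
  assumes R: "R1 \<ge> 0" "R2 \<ge> 0" and nn: "G \<ge> 0" "S \<ge> 0" "U \<ge> 0" "X \<ge> 0"
    and X1: "(1 - e34) * G + X
      \<le> (e34 - e234) / (1 - e234) * R1"
    and X2: "(1 - e34) * S * (1 - f34) = (f3 - f34) * X"
    and X3: "(1 - e4) * (U + S) * (1 - f34) \<le> (1 - f4) * X"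
    and X4: "(1 - f4) * X \<le> (f4 - f34) * R2"
    and T3: "coef3 * R1 + R2 / (1 - f34) \<le> 1 - G - S - U + gain3 * (G + S)"
    and T4: "coef4 * R1 + R2 / (1 - f4) \<le> 1 - G - S - U + gain34 * G + gain4 * (S + U)"
  shows "(R1, R2) \<in> capacity_region TYPE('f::{field, finite}) M Z"
proof -
  define K where "K = (e34 - e234) / (1 - e234)"
  note ord = eps_order eps_less_1
  have pos: "coef3 \<ge> 0" "coef4 \<ge> 0" "K \<ge> 0"
    unfolding coef3_def coef4_def K_def using ord
    by (auto intro!: add_nonneg_nonneg divide_nonneg_nonneg mult_nonneg_nonneg)
  define \<eta> where "\<eta> = 1 / (coef3 + coef4 + 1)"
  have \<eta>: "\<eta> > 0" "coef3 * \<eta> < 1" "coef4 * \<eta> < 1" unfolding \<eta>_def using pos by (auto simp: field_simps)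
  have ach: "achievable TYPE('f) M Z ((1 - \<delta>) * R1 + \<delta> * \<eta>, (1 - \<delta>) * R2)" if d: "0 < \<delta>" "\<delta> < 1" for \<delta>
  proof (rule achievable_if_feasible[where G = "(1 - \<delta>) * G" and S = "(1 - \<delta>) * S" and U = "(1 - \<delta>) * U"
        and X = "(1 - \<delta>) * X"], fold K_def)
    have scale: "(1 - \<delta>) * x \<le> (1 - \<delta>) * y" if "x \<le> y" for x y :: real
      using that d by (intro mult_left_mono) auto
    show "0 < (1 - \<delta>) * R1 + \<delta> * \<eta>"
      using d \<eta> R by (intro add_nonneg_pos) auto
    have "K * (\<delta> * \<eta>) \<ge> 0" using pos d \<eta> by simp
    then show "(1 - e34) * ((1 - \<delta>) * G) + (1 - \<delta>) * X \<le> K * ((1 - \<delta>) * R1 + \<delta> * \<eta>)"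
      using scale[OF X1[folded K_def]] by (simp add: algebra_simps)
    show "(1 - e34) * ((1 - \<delta>) * S) * (1 - f34)
        = (f3 - f34) * ((1 - \<delta>) * X)"
      using arg_cong[OF X2, of "\<lambda>x. (1 - \<delta>) * x"] by (simp only: ac_simps)
    have "(1 - e4) * ((1 - \<delta>) * U + (1 - \<delta>) * S) * (1 - f34)
        = (1 - \<delta>) * ((1 - e4) * (U + S) * (1 - f34))"
      by (simp add: algebra_simps)
    also have "\<dots> \<le> (1 - \<delta>) * ((1 - f4) * X)" by (rule scale[OF X3])
    finally show "(1 - e4) * ((1 - \<delta>) * U + (1 - \<delta>) * S) * (1 - f34)
        \<le> (1 - f4) * ((1 - \<delta>) * X)" by (simp only: ac_simps)
    show "(1 - f4) * ((1 - \<delta>) * X) \<le> (f4 - f34) * ((1 - \<delta>) * R2)"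
      using scale[OF X4] by (simp only: ac_simps)
    show "coef3 * ((1 - \<delta>) * R1 + \<delta> * \<eta>) + (1 - \<delta>) * R2 / (1 - f34)
        < 1 - (1 - \<delta>) * G - (1 - \<delta>) * S - (1 - \<delta>) * U + gain3 * ((1 - \<delta>) * G + (1 - \<delta>) * S)"
      using perturbed_less[of coef3 R1 "R2 / (1 - f34)" "- G - S - U + gain3 * (G + S)", OF _ \<eta>(2) d]
        T3 by (simp add: algebra_simps)
    show "coef4 * ((1 - \<delta>) * R1 + \<delta> * \<eta>) + (1 - \<delta>) * R2 / (1 - f4)
        < 1 - (1 - \<delta>) * G - (1 - \<delta>) * S - (1 - \<delta>) * U + gain34 * ((1 - \<delta>) * G)
          + gain4 * ((1 - \<delta>) * S + (1 - \<delta>) * U)"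
      using perturbed_less[of coef4 R1 "R2 / (1 - f4)" "- G - S - U + gain34 * G + gain4 * (S + U)", OF _ \<eta>(3) d]
        T4 by (simp add: algebra_simps)
  qed (use R nn d in auto)
  have "(\<lambda>n. ((1 - inverse (real (n + 2))) * R1 + inverse (real (n + 2)) * \<eta>, (1 - inverse (real (n + 2))) * R2))
      \<longlonglongrightarrow> ((1 - 0) * R1 + 0 * \<eta>, (1 - 0) * R2)"
    by (intro tendsto_intros LIMSEQ_ignore_initial_segment[OF lim_inverse_n])
  moreover have "((1 - inverse (real (n + 2))) * R1 + inverse (real (n + 2)) * \<eta>, (1 - inverse (real (n + 2))) * R2)
      \<in> {R. achievable TYPE('f) M Z R}" for n
    using ach[of "inverse (real (n + 2))"] by (simp add: inverse_less_1_iff)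
  ultimately show ?thesis
    unfolding capacity_region_def closure_sequential
    by (intro exI[of _ "\<lambda>n. ((1 - inverse (real (n + 2))) * R1 + inverse (real (n + 2)) * \<eta>,
      (1 - inverse (real (n + 2))) * R2)"]) simp
qed

text \<open>If node 4 never receives from node 2 what node 3 misses, then \<open>S = 0\<close> and the constraint meant to
  bound \<open>U\<close> is void. In this case \<open>U\<close> is cut down to the time in which node 1 can resolve all the
  \<open>W_2\<close>-packets that node 4 misses; the first rate constraint then implies the second.\<close>

lemma in_capacity_region_GSU:
  assumes R: "R1 \<ge> 0" "R2 \<ge> 0" and nn: "G \<ge> 0" "S \<ge> 0" "U \<ge> 0"
    and c4: "1 - e4 > 0"
    and T3: "coef3 * R1 + R2 / (1 - f34) \<le> 1 - G - S - U + gain3 * (G + S)"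
    and T4: "coef4 * R1 + R2 / (1 - f4) \<le> 1 - G - S - U + gain34 * G + gain4 * (S + U)"
    and C3: "(f3 - f34) * G + (1 - f34) * S
      \<le> ((f3 - f34) * (e34 - e234))
              / ((1 - e34) * (1 - e234)) * R1"
    and C4: "(f3 - f34) * U
      \<le> (((1 - f4) * (1 - e34)) / (1 - e4)
               - (f3 - f34)) * S"
    and C5: "G + ((1 - e4) * (1 - f34))
                / ((1 - f4) * (1 - e34)) * (U + S)
      \<le> (e34 - e234) / ((1 - e34) * (1 - e234)) * R1"
    and C6: "S \<le> ((f3 - f34) * (f4 - f34))
                / ((1 - e34) * (1 - f4) * (1 - f34)) * R2"
  shows "(R1, R2) \<in> capacity_region TYPE('f::{field, finite}) M Z"
proof -
  note ord = eps_order eps_supermodular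
  have less: "e23 < 1" "f3 < 1" "f4 < 1" "e234 < 1" "f34 < 1" "e4 < 1" "e34 < 1"
    using eps_less_1 ord c4 by linarith+
  let ?K = "(e34 - e234) / (1 - e234)"
  note F = in_capacity_region_if_feasible[OF R]
  show ?thesis
  proof (cases "f3 - f34 = 0")
    case False
    then have p: "f3 - f34 > 0" using ord by linarith
    \<comment> \<open>The value forced by the flow balance of \<open>pend\<close>: what
      \<open>Mix\<close> puts there is served in time \<open>S\<close>.\<close>
    define X where "X = (1 - f34) * (1 - e34) * S / (f3 - f34)"
    have X: "(f3 - f34) * X = (1 - f34) * (1 - e34) * S" using p by (simp add: X_def)
    show ?thesis
    proof (rule F[OF nn, of X])
      show "X \<ge> 0" unfolding X_def using p less nn by simp
      have "(f3 - f34) * ((1 - e34) * G + X) = (1 - e34) * ((f3 - f34) * G + (1 - f34) * S)"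
        using X by (simp add: algebra_simps)
      also have "\<dots> \<le> (1 - e34) * (((f3 - f34) * (e34 - e234)) / ((1 - e34) * (1 - e234)) * R1)"
        using C3 less by (intro mult_left_mono) auto
      also have "\<dots> = (f3 - f34) * (?K * R1)" using less by simp
      finally show "(1 - e34) * G + X \<le> ?K * R1" by (rule mult_left_le_imp_le[OF _ p])
      show "(1 - e34) * S * (1 - f34) = (f3 - f34) * X" using X by (simp only: ac_simps)
      have "(1 - e4) * ((f3 - f34) * (U + S)) \<le> (1 - e4) * ((1 - f4) * (1 - e34) / (1 - e4) * S)"
        using C4 less by (intro mult_left_mono) (auto simp: algebra_simps)
      also have "\<dots> = (1 - f4) * (1 - e34) * S" using less by simp
      finally have "(1 - f34) * ((1 - e4) * ((f3 - f34) * (U + S))) \<le> (1 - f34) * ((1 - f4) * (1 - e34) * S)"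
        using less by (intro mult_left_mono) auto
      then have "(f3 - f34) * ((1 - e4) * (U + S) * (1 - f34)) \<le> (f3 - f34) * ((1 - f4) * X)"
        using arg_cong[OF X, of "\<lambda>x. (1 - f4) * x"] by (simp only: ac_simps)
      then show "(1 - e4) * (U + S) * (1 - f34) \<le> (1 - f4) * X" by (rule mult_left_le_imp_le[OF _ p])
      have "(f3 - f34) * ((1 - f4) * X) = ((1 - e34) * (1 - f4) * (1 - f34)) * S"
        using arg_cong[OF X, of "\<lambda>x. (1 - f4) * x"] by (simp only: ac_simps)
      also have "\<dots> \<le> ((1 - e34) * (1 - f4) * (1 - f34)) *
          (((f3 - f34) * (f4 - f34)) / ((1 - e34) * (1 - f4) * (1 - f34)) * R2)"
        using C6 less by (intro mult_left_mono) auto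
      also have "\<dots> = (f3 - f34) * ((f4 - f34) * R2)" using less by simp
      finally show "(1 - f4) * X \<le> (f4 - f34) * R2" by (rule mult_left_le_imp_le[OF _ p])
    qed (fact T3, fact T4)
  next
    case True
    have "S = 0"
      using C3 True nn less by (simp add: mult_le_0_iff)
    define V where "V = min U ((f4 - f34) * R2 / ((1 - f34) * (1 - e4)))"
    have V: "V \<ge> 0" "V \<le> U" "(1 - f34) * ((1 - e4) * V) \<le> (f4 - f34) * R2"
    proof -
      show "V \<ge> 0" "V \<le> U" unfolding V_def using nn less ord R by auto
      have "(1 - f34) * (1 - e4) * V \<le> (1 - f34) * (1 - e4) * ((f4 - f34) * R2 / ((1 - f34) * (1 - e4)))"
        unfolding V_def using less by (intro mult_left_mono) auto
      then show "(1 - f34) * ((1 - e4) * V) \<le> (f4 - f34) * R2" using less by simp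
    qed
    \<comment> \<open>Now \<open>Mix\<close> never feeds \<open>pend\<close>, and \<open>X\<close>
      is just large enough to keep node 1 busy with \<open>link\<close> during time
      \<open>V\<close>.\<close>
    define X where "X = (1 - e4) * V * (1 - f34) / (1 - f4)"
    have X: "(1 - f4) * X = (1 - e4) * V * (1 - f34)" using less by (simp add: X_def)
    show ?thesis
    proof (rule F[of G 0 V X])
      show "X \<ge> 0" unfolding X_def using less V by simp
      have "(1 - e34) * G + X \<le> (1 - e34) * (G + (1 - e4) * (1 - f34) / ((1 - f4) * (1 - e34)) * (U + S))"
      proof -
        have "X \<le> (1 - e4) * U * (1 - f34) / (1 - f4)" unfolding X_def
          using V less by (intro divide_right_mono mult_right_mono mult_left_mono) auto
        then show ?thesis using less \<open>S = 0\<close> by (simp add: distrib_left mult_ac)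
      qed
      also have "\<dots> \<le> (1 - e34) * ((e34 - e234) / ((1 - e34) * (1 - e234)) * R1)"
        using C5 less by (intro mult_left_mono) auto
      also have "\<dots> = ?K * R1" using less by simp
      finally show "(1 - e34) * G + X \<le> ?K * R1" .
      show "(1 - e34) * 0 * (1 - f34) = (f3 - f34) * X" using True by simp
      show "(1 - e4) * (V + 0) * (1 - f34) \<le> (1 - f4) * X" using X by simp
      show "(1 - f4) * X \<le> (f4 - f34) * R2" using X V(3) by (simp add: mult_ac)
      show T3': "coef3 * R1 + R2 / (1 - f34) \<le> 1 - G - 0 - V + gain3 * (G + 0)"
        using T3 \<open>S = 0\<close> V(2) by simp
      show "coef4 * R1 + R2 / (1 - f4) \<le> 1 - G - 0 - V + gain34 * G + gain4 * (0 + V)"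
      proof (cases "V = U")
        case True
        then show ?thesis using T4 \<open>S = 0\<close> by simp
      next
        \<comment> \<open>With the cap on \<open>V\<close> active, no packet of \<open>at3\<close>
          or \<open>link\<close> is left over for node 4, and the second constraint follows by
          comparing its terms with those of the first.\<close>
        case False
        then have "(1 - e4) * V = (f4 - f34) * R2 / (1 - f34)" unfolding V_def using less by (auto simp: min_def)
        then have "(1 - e4) / (1 - f4) * V = (f4 - f34) * R2 / (1 - f34) / (1 - f4)"
          by (metis times_divide_eq_left)
        moreover have "R2 / (1 - f4) = R2 / (1 - f34) + (f4 - f34) * R2 / (1 - f34) / (1 - f4)"
        proof -
          have "R2 / E = R2 / D + (D - E) * R2 / D / E" if "D \<noteq> 0" "E \<noteq> 0" for D E :: real
            using that by (simp add: field_simps)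
          from this[of "1 - f34" "1 - f4"] show ?thesis using less by simp
        qed
        moreover have "(e34 - e234) / (1 - e234) \<le> (e3 - e23) / (1 - e23)"
        proof -
          \<comment> \<open>Here \<open>eps_supermodular\<close> enters, as
            \<open>e23 - e234 \<le> e3 - e34\<close>.\<close>
          have "(1 - e3) * (e23 - e234) \<le> (1 - e23) * (e3 - e34)"
            using ord less by (intro mult_mono) auto
          then show ?thesis using less by (simp add: field_simps)
        qed
        then have "(e34 - e234) / (1 - e234) / (1 - f34) * R1 \<le> (e3 - e23) / (1 - e23) / (1 - f34) * R1"
          using less R by (intro mult_right_mono divide_right_mono) auto
        moreover have "(1 - e3) / (1 - f34) * G \<le> (1 - e34) / (1 - f34) * G"
          using less nn ord by (intro mult_right_mono divide_right_mono) auto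
        moreover have "f3 = f34" using \<open>f3 - f34 = 0\<close> by simp
        ultimately show ?thesis using T3' unfolding coef3_def coef4_def gain3_def gain34_def gain4_def
          by (simp add: distrib_left distrib_right mult.commute)
      qed
    qed (use nn V in auto)
  qed
qed

end

section \<open>Entropy of functions on a finite uniform sample\<close>

definition fiber :: "'w set \<Rightarrow> ('w \<Rightarrow> 'b) \<Rightarrow> 'w \<Rightarrow> 'w set" where
  "fiber \<Omega> g w = {v \<in> \<Omega>. g v = g w}"

text \<open>Conditional entropy H(f | g) in nats for a uniform point of \<open>\<Omega>\<close>: the
  quotient is the reciprocal of the conditional probability of \<open>f w\<close> given
  \<open>g w\<close>.\<close>

definition hcond :: "'w set \<Rightarrow> ('w \<Rightarrow> 'b) \<Rightarrow> ('w \<Rightarrow> 'c) \<Rightarrow> real" where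
  "hcond \<Omega> f g = (\<Sum>w\<in>\<Omega>. ln (card (fiber \<Omega> g w) / card (fiber \<Omega> (\<lambda>w. (f w, g w)) w))) / card \<Omega>"

lemma fiber_cong:
  "(\<And>v. v \<in> \<Omega> \<Longrightarrow> g v = g w \<longleftrightarrow> g' v = g' w) \<Longrightarrow> fiber \<Omega> g w = fiber \<Omega> g' w"
  by (auto simp: fiber_def)

lemma hcond_cong:
  assumes "\<And>v w. v \<in> \<Omega> \<Longrightarrow> w \<in> \<Omega> \<Longrightarrow> g v = g w \<longleftrightarrow> g' v = g' w"
    and "\<And>v w. v \<in> \<Omega> \<Longrightarrow> w \<in> \<Omega> \<Longrightarrow> g v = g w \<Longrightarrow> f v = f w \<longleftrightarrow> f' v = f' w"
  shows "hcond \<Omega> f g = hcond \<Omega> f' g'"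
proof -
  have "fiber \<Omega> g w = fiber \<Omega> g' w" "fiber \<Omega> (\<lambda>w. (f w, g w)) w = fiber \<Omega> (\<lambda>w. (f' w, g' w)) w"
    if "w \<in> \<Omega>" for w
    using assms that by (auto intro!: fiber_cong)
  then show ?thesis by (simp add: hcond_def)
qed

locale finite_sample =
  fixes \<Omega> :: "'w set"
  assumes fin: "finite \<Omega>" and ne: "\<Omega> \<noteq> {}"
begin

lemma card_pos: "card \<Omega> > 0"
  using fin ne by (simp add: card_gt_0_iff)

lemma fiber_pos: "w \<in> \<Omega> \<Longrightarrow> card (fiber \<Omega> g w) > 0"
  using fin by (auto simp: fiber_def card_gt_0_iff)

lemma hcond_nonneg: "hcond \<Omega> f g \<ge> 0"
  unfolding hcond_def
proof (intro divide_nonneg_nonneg sum_nonneg ln_ge_zero)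
  fix w assume w: "w \<in> \<Omega>"
  have "card (fiber \<Omega> (\<lambda>w. (f w, g w)) w) \<le> card (fiber \<Omega> g w)"
    using fin by (intro card_mono) (auto simp: fiber_def)
  then show "1 \<le> real (card (fiber \<Omega> g w)) / real (card (fiber \<Omega> (\<lambda>w. (f w, g w)) w))"
    using fiber_pos[OF w, of "\<lambda>w. (f w, g w)"] by (simp add: field_simps)
qed auto

lemma hcond_chain: "hcond \<Omega> (\<lambda>w. (f w, h w)) g = hcond \<Omega> f g + hcond \<Omega> h (\<lambda>w. (f w, g w))"
proof -
  have "ln (card (fiber \<Omega> g w) / card (fiber \<Omega> (\<lambda>w. ((f w, h w), g w)) w))
      = ln (card (fiber \<Omega> g w) / card (fiber \<Omega> (\<lambda>w. (f w, g w)) w))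
      + ln (card (fiber \<Omega> (\<lambda>w. (f w, g w)) w) / card (fiber \<Omega> (\<lambda>w. (h w, (f w, g w))) w))"
    if w: "w \<in> \<Omega>" for w
  proof -
    have "fiber \<Omega> (\<lambda>w. ((f w, h w), g w)) w = fiber \<Omega> (\<lambda>w. (h w, (f w, g w))) w"
      by (rule fiber_cong) auto
    then show ?thesis
      using fiber_pos[OF w, of g] fiber_pos[OF w, of "\<lambda>w. (f w, g w)"]
        fiber_pos[OF w, of "\<lambda>w. (h w, (f w, g w))"]
      by (simp add: ln_div)
  qed
  then show ?thesis
    unfolding hcond_def by (simp add: sum.distrib add_divide_distrib)
qed

lemma hcond_swap:
  "hcond \<Omega> f g + hcond \<Omega> h (\<lambda>w. (f w, g w)) = hcond \<Omega> h g + hcond \<Omega> f (\<lambda>w. (h w, g w))"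
  unfolding hcond_chain[symmetric] by (rule hcond_cong) auto

lemma hcond_determined:
  assumes "\<And>v w. v \<in> \<Omega> \<Longrightarrow> w \<in> \<Omega> \<Longrightarrow> g v = g w \<Longrightarrow> f v = f w"
  shows "hcond \<Omega> f g = 0"
proof -
  have "fiber \<Omega> (\<lambda>w. (f w, g w)) w = fiber \<Omega> g w" if "w \<in> \<Omega>" for w
    using assms that by (auto intro!: fiber_cong)
  then have "ln (card (fiber \<Omega> g w) / card (fiber \<Omega> (\<lambda>w. (f w, g w)) w)) = 0" if "w \<in> \<Omega>" for w
    using that fiber_pos[OF that, of g] by simp
  then show ?thesis unfolding hcond_def by simp
qed

text \<open>Gibbs' inequality: no subnormalized guess \<open>Q\<close> has smaller cross entropy
  than the true conditional law. By \<open>ln x \<le> x - 1\<close> it suffices that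
  \<open>Q\<close> times the quotient has average at most 1, which holds on each fiber of
  \<open>g\<close>. Conditioning, the cardinality bound and Fano's inequality all arise from choices
  of \<open>Q\<close>.\<close>

lemma hcond_le_Gibbs:
  assumes pos: "\<And>w. w \<in> \<Omega> \<Longrightarrow> Q (f w) (g w) > 0"
    and sub: "\<And>y. y \<in> g ` \<Omega> \<Longrightarrow> (\<Sum>v\<in>f ` {w \<in> \<Omega>. g w = y}. Q v y) \<le> 1"
  shows "hcond \<Omega> f g \<le> (\<Sum>w\<in>\<Omega>. ln (1 / Q (f w) (g w))) / card \<Omega>"
proof -
  let ?r = "\<lambda>w. real (card (fiber \<Omega> g w)) / real (card (fiber \<Omega> (\<lambda>w. (f w, g w)) w))"
  have inner: "(\<Sum>w | w \<in> \<Omega> \<and> g w = y. Q (f w) (g w) * ?r w)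
      \<le> card {w \<in> \<Omega>. g w = y}" if "y \<in> g ` \<Omega>" for y
  proof -
    let ?A = "{w \<in> \<Omega>. g w = y}"
    have finA: "finite ?A" using fin by simp
    have "(\<Sum>w\<in>?A. Q (f w) (g w) * ?r w)
        = (\<Sum>v\<in>f ` ?A. \<Sum>w | w \<in> ?A \<and> f w = v. Q (f w) (g w) * ?r w)"
      by (rule sum.image_gen[OF finA])
    also have "\<dots> = (\<Sum>v\<in>f ` ?A. card ?A * Q v y)"
    proof (rule sum.cong[OF refl])
      fix v assume "v \<in> f ` ?A"
      let ?B = "{w. w \<in> ?A \<and> f w = v}"
      have B: "card ?B > 0" using \<open>v \<in> f ` ?A\<close> fin by (auto simp: card_gt_0_iff)
      have "Q (f w) (g w) * ?r w = Q v y * (card ?A / card ?B)" if "w \<in> ?B" for w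
      proof -
        have "fiber \<Omega> g w = ?A" "fiber \<Omega> (\<lambda>w. (f w, g w)) w = ?B"
          using that by (auto simp: fiber_def)
        then show ?thesis using that by simp
      qed
      then have "(\<Sum>w\<in>?B. Q (f w) (g w) * ?r w) = (\<Sum>w\<in>?B. Q v y * (card ?A / card ?B))"
        by (rule sum.cong[OF refl])
      also have "\<dots> = card ?A * Q v y" using B by simp
      finally show "(\<Sum>w\<in>?B. Q (f w) (g w) * ?r w) = card ?A * Q v y" .
    qed
    also have "\<dots> = card ?A * (\<Sum>v\<in>f ` ?A. Q v y)"
      by (simp add: sum_distrib_left)
    also have "\<dots> \<le> real (card ?A) * 1"
      by (intro mult_left_mono sub that) simp
    finally show ?thesis by simp
  qed
  have "(\<Sum>w\<in>\<Omega>. ln (?r w)) - (\<Sum>w\<in>\<Omega>. ln (1 / Q (f w) (g w))) = (\<Sum>w\<in>\<Omega>. ln (Q (f w) (g w) * ?r w))"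
    unfolding sum_subtractf[symmetric]
  proof (rule sum.cong[OF refl])
    fix w assume w: "w \<in> \<Omega>"
    have "?r w > 0" by (intro divide_pos_pos) (simp_all add: fiber_pos w)
    then show "ln (?r w) - ln (1 / Q (f w) (g w)) = ln (Q (f w) (g w) * ?r w)"
      using pos[OF w] by (subst ln_mult_pos) (simp_all add: ln_div)
  qed
  also have "\<dots> \<le> (\<Sum>w\<in>\<Omega>. Q (f w) (g w) * ?r w - 1)"
  proof (rule sum_mono)
    fix w assume w: "w \<in> \<Omega>"
    have "?r w > 0" by (intro divide_pos_pos) (simp_all add: fiber_pos w)
    then show "ln (Q (f w) (g w) * ?r w) \<le> Q (f w) (g w) * ?r w - 1"
      using pos[OF w] by (intro ln_le_minus_one mult_pos_pos)
  qed
  also have "\<dots> = (\<Sum>w\<in>\<Omega>. Q (f w) (g w) * ?r w) - card \<Omega>"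
    by (simp add: sum_subtractf)
  also have "(\<Sum>w\<in>\<Omega>. Q (f w) (g w) * ?r w)
      = (\<Sum>y\<in>g ` \<Omega>. \<Sum>w | w \<in> \<Omega> \<and> g w = y. Q (f w) (g w) * ?r w)"
    by (rule sum.image_gen[OF fin])
  also have "\<dots> \<le> (\<Sum>y\<in>g ` \<Omega>. real (card {w \<in> \<Omega>. g w = y}))"
    by (rule sum_mono) (rule inner)
  also have "(\<Sum>y\<in>g ` \<Omega>. real (card {w \<in> \<Omega>. g w = y})) = card \<Omega>"
    using sum.image_gen[OF fin, of "\<lambda>_. 1::nat" g] by (simp flip: of_nat_sum)
  finally have "(\<Sum>w\<in>\<Omega>. ln (?r w)) \<le> (\<Sum>w\<in>\<Omega>. ln (1 / Q (f w) (g w)))" by simp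
  then show ?thesis unfolding hcond_def by (intro divide_right_mono) auto
qed

lemma hcond_mono:
  fixes f :: "'w \<Rightarrow> 'b" and g :: "'w \<Rightarrow> 'c" and g' :: "'w \<Rightarrow> 'd"
  assumes "\<And>v w. v \<in> \<Omega> \<Longrightarrow> w \<in> \<Omega> \<Longrightarrow> g' v = g' w \<Longrightarrow> g v = g w"
  shows "hcond \<Omega> f g' \<le> hcond \<Omega> f g"
proof -
  \<comment> \<open>The true conditional law given the coarser \<open>g\<close>, used as a guess by
    someone who also knows \<open>g'\<close>; its cross entropy is exactly
    \<open>hcond \<Omega> f g\<close>.\<close>
  define Q where "Q v y = real (card {w \<in> \<Omega>. f w = v \<and> g w = fst y}) / card {w \<in> \<Omega>. g w = fst y}"
    for v :: 'b and y :: "'c \<times> 'd"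
  have pos: "Q (f w) (g w, g' w) > 0" if "w \<in> \<Omega>" for w
    unfolding Q_def using that fin by (auto intro!: divide_pos_pos simp: card_gt_0_iff)
  have "hcond \<Omega> f g' = hcond \<Omega> f (\<lambda>w. (g w, g' w))"
  proof (rule hcond_cong)
    show "g' v = g' w \<longleftrightarrow> (g v, g' v) = (g w, g' w)" if "v \<in> \<Omega>" "w \<in> \<Omega>" for v w
      unfolding prod.inject using assms[OF that] by blast
  qed simp
  also have "\<dots> \<le> (\<Sum>w\<in>\<Omega>. ln (1 / Q (f w) (g w, g' w))) / card \<Omega>"
  proof (rule hcond_le_Gibbs[where Q = Q])
    fix y assume "y \<in> (\<lambda>w. (g w, g' w)) ` \<Omega>"
    let ?A = "{w \<in> \<Omega>. g w = fst y}"
    have A: "card ?A > 0" using \<open>y \<in> _\<close> fin by (auto simp: card_gt_0_iff)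
    have "(\<Sum>v\<in>f ` {w \<in> \<Omega>. (g w, g' w) = y}. Q v y) \<le> (\<Sum>v\<in>f ` ?A. Q v y)"
      using fin by (intro sum_mono2) (auto simp: Q_def)
    also have "\<dots> = (\<Sum>v\<in>f ` ?A. real (card {w \<in> ?A. f w = v})) / card ?A"
      unfolding Q_def sum_divide_distrib
      by (intro sum.cong refl arg_cong2[of _ _ _ _ "(/)"] arg_cong[of _ _ real] arg_cong[of _ _ card]) auto
    also have "(\<Sum>v\<in>f ` ?A. real (card {w \<in> ?A. f w = v})) = card ?A"
      using sum.image_gen[of ?A "\<lambda>_. 1::nat" f] fin by (simp flip: of_nat_sum)
    finally show "(\<Sum>v\<in>f ` {w \<in> \<Omega>. (g w, g' w) = y}. Q v y) \<le> 1" using A by simp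
  qed (use pos in simp)
  also have "\<dots> = hcond \<Omega> f g"
    unfolding hcond_def Q_def fiber_def by simp
  finally show ?thesis .
qed

lemma hcond_le_ln_card:
  assumes "finite V" "f ` \<Omega> \<subseteq> V"
  shows "hcond \<Omega> f g \<le> ln (card V)"
proof -
  have V: "card V > 0" using assms ne by (auto simp: card_gt_0_iff)
  have "hcond \<Omega> f g \<le> (\<Sum>w\<in>\<Omega>. ln (1 / (1 / card V))) / card \<Omega>"
  proof (rule hcond_le_Gibbs[where Q = "\<lambda>_ _. 1 / card V"])
    fix y
    have "card (f ` {w \<in> \<Omega>. g w = y}) \<le> card V"
      using assms by (intro card_mono) auto
    then show "(\<Sum>v\<in>f ` {w \<in> \<Omega>. g w = y}. 1 / real (card V)) \<le> 1"
      using V by (simp add: field_simps)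
  qed (use V in simp)
  then show ?thesis using card_pos by simp
qed

text \<open>Fano's inequality, from the guess that puts mass one half on the decoded value and
  spreads the rest uniformly.\<close>

lemma hcond_Fano:
  assumes "finite V" "f ` \<Omega> \<subseteq> V"
  shows "hcond \<Omega> f g \<le> ln 2 + card {w \<in> \<Omega>. D (g w) \<noteq> f w} / card \<Omega> * ln (card V)"
proof -
  have V: "card V > 0" using assms ne by (auto simp: card_gt_0_iff)
  define Q where "Q v y = of_bool (v = D y) / 2 + 1 / (2 * real (card V))" for v y
  have pos: "Q v y > 0" for v y unfolding Q_def using V by (auto intro!: add_nonneg_pos)
  have "hcond \<Omega> f g \<le> (\<Sum>w\<in>\<Omega>. ln (1 / Q (f w) (g w))) / card \<Omega>"
  proof (rule hcond_le_Gibbs[where Q = Q])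
    fix y
    let ?B = "f ` {w \<in> \<Omega>. g w = y}"
    have "finite ?B" using fin by simp
    have "(\<Sum>v\<in>?B. of_bool (v = D y) / 2) \<le> (1/2 :: real)"
    proof -
      have "(\<Sum>v\<in>?B. of_bool (v = D y) / 2) = (\<Sum>v\<in>?B. if v = D y then 1/2 else (0::real))"
        by (intro sum.cong) auto
      then show ?thesis using \<open>finite ?B\<close> by simp
    qed
    moreover have "(\<Sum>v\<in>?B. 1 / (2 * real (card V))) \<le> 1/2"
    proof -
      have "card ?B \<le> card V" using assms by (intro card_mono) auto
      then show ?thesis using V by (simp add: field_simps)
    qed
    ultimately show "(\<Sum>v\<in>?B. Q v y) \<le> 1" unfolding Q_def sum.distrib by linarith
  qed (use pos in simp)
  also have "(\<Sum>w\<in>\<Omega>. ln (1 / Q (f w) (g w)))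
      \<le> (\<Sum>w\<in>\<Omega>. ln 2 + of_bool (D (g w) \<noteq> f w) * ln (card V))"
  proof (rule sum_mono)
    fix w
    have "Q (f w) (g w) \<ge> 1 / 2" if "D (g w) = f w" unfolding Q_def using that by simp
    then have "ln (1 / Q (f w) (g w)) \<le> ln 2" if "D (g w) = f w"
      using that pos[of "f w" "g w"] by (subst ln_le_cancel_iff) (simp_all add: field_simps)
    moreover have "Q (f w) (g w) \<ge> 1 / (2 * card V)" unfolding Q_def by simp
    then have "ln (1 / Q (f w) (g w)) \<le> ln (2 * card V)"
      using pos[of "f w" "g w"] V by (subst ln_le_cancel_iff) (simp_all add: field_simps)
    ultimately show "ln (1 / Q (f w) (g w)) \<le> ln 2 + of_bool (D (g w) \<noteq> f w) * ln (card V)"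
      using V by (cases "D (g w) = f w") (auto simp: ln_mult)
  qed
  also have "\<dots> = card \<Omega> * ln 2 + card {w \<in> \<Omega>. D (g w) \<noteq> f w} * ln (card V)"
    using fin by (simp add: sum.distrib flip: sum_distrib_right) (simp add: Int_def)
  finally show ?thesis using card_pos by (simp add: add_divide_distrib divide_right_mono)
qed

end

section \<open>Entropies along a realization of the erasures\<close>

text \<open>Slot \<open>s\<close> is time \<open>Suc s\<close> of the model, so its sender depends
  on the feedback of length \<open>s\<close>.\<close>

definition active :: "'f channel_code \<Rightarrow> erasures \<Rightarrow> nat \<Rightarrow> node" where
  "active c z s = sched c (feedback c z s)"

definition pkt :: "'f channel_code \<Rightarrow> erasures \<Rightarrow> nat \<Rightarrow> nat" where
  "pkt c z s = index c (feedback c z s)"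

definition heard :: "'f channel_code \<Rightarrow> erasures \<Rightarrow> node set \<Rightarrow> nat \<Rightarrow> bool" where
  "heard c z S s \<longleftrightarrow> (\<exists>j\<in>S. link_state (z (Suc s)) (active c z s) j)"

definition sym_at :: "'f channel_code \<Rightarrow> erasures \<Rightarrow> nat \<Rightarrow> 'f list \<times> 'f list \<Rightarrow> 'f" where
  "sym_at c z s w = (if active c z s = N1 then fst w ! pkt c z s
     else enc2 c (snd w) (Y1 c z (fst w) N2 s) (feedback c z s))"

text \<open>All hearers of a slot receive the same symbol, so one list describes the joint knowledge
  of \<open>S\<close>. The sender of each entry is determined by \<open>z\<close>, which lets
  \<open>obs_Y1\<close> and \<open>obs_Y2\<close> recover the two streams that a decoder
  sees.\<close>

definition obs :: "'f channel_code \<Rightarrow> erasures \<Rightarrow> node set \<Rightarrow> nat \<Rightarrow>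
    'f list \<times> 'f list \<Rightarrow> 'f option list" where
  "obs c z S t w = map (\<lambda>s. if heard c z S s then Some (sym_at c z s w) else None) [0..<t]"

definition msgs :: "nat \<Rightarrow> nat \<Rightarrow> ('f list \<times> 'f list) set" where
  "msgs K1 K2 = {w. length (fst w) = K1 \<and> length (snd w) = K2}"

lemma msgs_Times: "msgs K1 K2 = {w. length w = K1} \<times> {w. length w = K2}"
  by (auto simp: msgs_def)

lemma card_lists_length: "card {w :: 'f::finite list. length w = k} = CARD('f) ^ k"
  using card_lists_length_eq[of "UNIV :: 'f set" k] by simp

lemma finite_lists_length: "finite {w :: 'f::finite list. length w = k}"
  using finite_lists_length_eq[of "UNIV :: 'f set" k] by simp

lemma finite_sample_msgs: "finite_sample (msgs K1 K2 :: ('f::finite list \<times> 'f list) set)"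
proof
  show "finite (msgs K1 K2 :: ('f list \<times> 'f list) set)"
    unfolding msgs_Times by (intro finite_cartesian_product finite_lists_length)
  have "(replicate K1 undefined, replicate K2 undefined) \<in> (msgs K1 K2 :: ('f list \<times> 'f list) set)"
    by (simp add: msgs_def)
  then show "(msgs K1 K2 :: ('f list \<times> 'f list) set) \<noteq> {}" by blast
qed

lemma obs_eq_iff: "obs c z S t v = obs c z S t w \<longleftrightarrow> (\<forall>s<t. heard c z S s \<longrightarrow> sym_at c z s v = sym_at c z s w)"
  by (auto simp: obs_def)

lemma obs_mono: "S \<subseteq> T \<Longrightarrow> obs c z T t v = obs c z T t w \<Longrightarrow> obs c z S t v = obs c z S t w"
  unfolding obs_eq_iff heard_def by blast

lemma Y1_eq:
  assumes "\<And>s. s < t \<Longrightarrow> active c z s = N1 \<Longrightarrow> link_state (z (Suc s)) N1 j \<Longrightarrow> v ! pkt c z s = w ! pkt c z s"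
  shows "Y1 c z v j t = Y1 c z w j t"
  unfolding Y1_def map_upt_shift
  using assms by (auto simp: channel_out_def X1_def sender_def active_def pkt_def)

lemma obs_Y1:
  assumes "obs c z {j} t v = obs c z {j} t w"
  shows "Y1 c z (fst v) j t = Y1 c z (fst w) j t"
proof (rule Y1_eq)
  fix s assume "s < t" and a: "active c z s = N1" and l: "link_state (z (Suc s)) N1 j"
  then have "heard c z {j} s" by (simp add: heard_def)
  then have "sym_at c z s v = sym_at c z s w" using assms \<open>s < t\<close> by (simp add: obs_eq_iff)
  then show "fst v ! pkt c z s = fst w ! pkt c z s" using a by (simp add: sym_at_def)
qed

lemma obs_Y2:
  assumes "obs c z {j} t v = obs c z {j} t w"
  shows "Y2 c z (fst v) (snd v) j t = Y2 c z (fst w) (snd w) j t"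
proof -
  have "channel_out c z (X2 c z (fst v) (snd v)) N2 j (Suc s)
      = channel_out c z (X2 c z (fst w) (snd w)) N2 j (Suc s)" if "s < t" for s
  proof (cases "active c z s = N2 \<and> link_state (z (Suc s)) N2 j")
    case True
    then have "heard c z {j} s" by (simp add: heard_def)
    then have "sym_at c z s v = sym_at c z s w" using assms that by (simp add: obs_eq_iff)
    then show ?thesis using True
      by (simp add: channel_out_def X2_def sender_def sym_at_def active_def)
  qed (auto simp: channel_out_def sender_def active_def)
  then show ?thesis unfolding Y2_def map_upt_shift by simp
qed

text \<open>A packet that node 2 has not received leaves no trace in what node 2 sends.\<close>

lemma sym_at_update:
  assumes "\<And>s'. s' \<le> s \<Longrightarrow> active c z s' = N1 \<Longrightarrow> heard c z T s' \<Longrightarrow> pkt c z s' \<noteq> i"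
    and "N2 \<in> T" "heard c z T s"
  shows "sym_at c z s (w1[i := a], w2) = sym_at c z s (w1, w2)"
proof (cases "active c z s = N1")
  case False
  have "Y1 c z (w1[i := a]) N2 s = Y1 c z w1 N2 s"
  proof (rule Y1_eq)
    fix s' assume "s' < s" "active c z s' = N1" "link_state (z (Suc s')) N1 N2"
    moreover from this have "heard c z T s'" using assms(2) by (auto simp: heard_def)
    ultimately have "pkt c z s' \<noteq> i" using assms(1)[of s'] by simp
    then show "w1[i := a] ! pkt c z s' = w1 ! pkt c z s'" by simp
  qed
  then show ?thesis using False by (simp add: sym_at_def)
qed (use assms(1)[of s] assms(3) in \<open>simp add: sym_at_def\<close>)

lemma obs_update:
  assumes "\<And>s. s < t \<Longrightarrow> active c z s = N1 \<Longrightarrow> heard c z T s \<Longrightarrow> pkt c z s \<noteq> i"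
    and "N2 \<in> T" "S \<subseteq> T"
  shows "obs c z S t (w1[i := a], w2) = obs c z S t (w1, w2)"
  unfolding obs_eq_iff
proof (intro allI impI)
  fix s assume "s < t" "heard c z S s"
  then show "sym_at c z s (w1[i := a], w2) = sym_at c z s (w1, w2)"
  proof (cases "heard c z T s")
    case True
    then show ?thesis using assms(1) \<open>s < t\<close> by (intro sym_at_update[OF _ assms(2)]) auto
  qed (use assms(3) in \<open>auto simp: heard_def\<close>)
qed

lemma card_first_occurrences:
  fixes A :: "nat set"
  assumes "finite A"
  shows "card {s \<in> A. \<not> (\<exists>s'\<in>A. s' < s \<and> f s' = f s)} = card (f ` A)"
proof (rule bij_betw_same_card[of f])
  show "bij_betw f {s \<in> A. \<not> (\<exists>s'\<in>A. s' < s \<and> f s' = f s)} (f ` A)"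
  proof (rule bij_betw_imageI)
    show "inj_on f {s \<in> A. \<not> (\<exists>s'\<in>A. s' < s \<and> f s' = f s)}"
      by (rule inj_onI) (auto, metis linorder_neqE_nat)
    show "f ` {s \<in> A. \<not> (\<exists>s'\<in>A. s' < s \<and> f s' = f s)} = f ` A"
    proof (intro equalityI subsetI)
      fix y assume "y \<in> f ` A"
      then have ex: "\<exists>s. s \<in> A \<and> f s = y" by auto
      define m where "m = (LEAST s. s \<in> A \<and> f s = y)"
      have "m \<in> A \<and> f m = y" unfolding m_def by (rule LeastI_ex[OF ex])
      moreover have "\<not> (\<exists>s'\<in>A. s' < m \<and> f s' = f m)"
      proof
        assume "\<exists>s'\<in>A. s' < m \<and> f s' = f m"
        then obtain s' where s': "s' \<in> A" "s' < m" "f s' = y" using calculation by auto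
        have "m \<le> s'" unfolding m_def by (rule Least_le) (use s' in simp)
        then show False using s' by simp
      qed
      ultimately show "y \<in> f ` {s \<in> A. \<not> (\<exists>s'\<in>A. s' < s \<and> f s' = f s)}" by blast
    qed auto
  qed
qed

text \<open>Node 1 repeats uncoded packets. A slot of node 1 is unresolved for \<open>T\<close> if no node in \<open>T\<close> has received
  its packet from node 1 before.\<close>

definition unresolved :: "'f channel_code \<Rightarrow> erasures \<Rightarrow> node set \<Rightarrow> nat \<Rightarrow> bool" where
  "unresolved c z T s \<longleftrightarrow> active c z s = N1 \<and>
     \<not> (\<exists>s'<s. active c z s' = N1 \<and> heard c z T s' \<and> pkt c z s' = pkt c z s)"

definition resolved_pkts :: "'f channel_code \<Rightarrow> erasures \<Rightarrow> node set \<Rightarrow> nat \<Rightarrow> nat set" where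
  "resolved_pkts c z T n = pkt c z ` {s. s < n \<and> active c z s = N1 \<and> heard c z T s}"

text \<open>The slots counted are first receptions in \<open>T\<close>, one for each packet.\<close>

lemma sum_unresolved_heard:
  "(\<Sum>s<n. of_bool (unresolved c z T s \<and> heard c z T s)) = (of_nat (card (resolved_pkts c z T n)) :: real)"
proof -
  let ?A = "{s. s < n \<and> active c z s = N1 \<and> heard c z T s}"
  have "{s. s < n \<and> unresolved c z T s \<and> heard c z T s} = {s \<in> ?A. \<not> (\<exists>s'\<in>?A. s' < s \<and> pkt c z s' = pkt c z s)}"
    by (auto simp: unresolved_def)
  then have "card {s. s < n \<and> unresolved c z T s \<and> heard c z T s} = card (resolved_pkts c z T n)"
    using card_first_occurrences[of ?A "pkt c z"] by (simp add: resolved_pkts_def)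
  moreover have "{..<n} \<inter> {s. unresolved c z T s \<and> heard c z T s} = {s. s < n \<and> unresolved c z T s \<and> heard c z T s}"
    by auto
  ultimately show ?thesis by simp
qed

text \<open>Such a packet has reached node 4 but neither node 2 nor node 3. This is the pointwise
  form of the count \<open>T23 + U4 \<le> F + T1\<close>.\<close>

lemma unresolved_cases:
  "unresolved c z {N2, N3} s \<Longrightarrow> \<not> unresolved c z {N2, N3, N4} s \<Longrightarrow> \<not> unresolved c z {N4} s"
  unfolding unresolved_def heard_def by auto metis

section \<open>Entropies slot by slot and their decoding constraints\<close>

definition slot_entropy :: "nat \<Rightarrow> nat \<Rightarrow> 'f channel_code \<Rightarrow> erasures \<Rightarrow> node set \<Rightarrow>
    ('f list \<times> 'f list \<Rightarrow> 'b) \<Rightarrow> nat \<Rightarrow> real" where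
  "slot_entropy K1 K2 c z S g s = hcond (msgs K1 K2) (sym_at c z s) (\<lambda>w. (obs c z S s w, g w))"

definition err_frac :: "nat \<Rightarrow> nat \<Rightarrow> nat \<Rightarrow> 'f channel_code \<Rightarrow> erasures \<Rightarrow> real" where
  "err_frac K1 K2 n c z = card {w \<in> msgs K1 K2. decoding_error n c z (fst w) (snd w)} / card (msgs K1 K2 :: ('f list \<times> 'f list) set)"

context
  fixes K1 K2 n :: nat and c :: "'f::{field, finite} channel_code"
    and z :: erasures
begin

interpretation finite_sample "msgs K1 K2 :: ('f list \<times> 'f list) set"
  by (rule finite_sample_msgs)

abbreviation "H f g \<equiv> hcond (msgs K1 K2 :: ('f list \<times> 'f list) set) f g"

text \<open>For fixed \<open>z\<close> it is known which slots \<open>S\<close> hears, so unheard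
  slots drop out of the chain rule.\<close>

lemma obs_chain:
  "H (obs c z S t) g = (\<Sum>s<t. of_bool (heard c z S s) * slot_entropy K1 K2 c z S g s)"
proof (induction t)
  case 0
  show ?case by (simp, rule hcond_determined) (simp add: obs_def)
next
  case (Suc t)
  show ?case
  proof (cases "heard c z S t")
    case True
    have "H (obs c z S (Suc t)) g = H (\<lambda>w. (obs c z S t w, sym_at c z t w)) g"
      by (rule hcond_cong) (auto simp: obs_def True)
    also have "\<dots> = H (obs c z S t) g + slot_entropy K1 K2 c z S g t"
      unfolding hcond_chain slot_entropy_def ..
    finally show ?thesis using Suc True by simp
  next
    case False
    have "H (obs c z S (Suc t)) g = H (obs c z S t) g"
      by (rule hcond_cong) (auto simp: obs_def False)
    then show ?thesis using Suc False by simp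
  qed
qed

lemma slot_entropy_nonneg: "slot_entropy K1 K2 c z S g s \<ge> 0"
  unfolding slot_entropy_def by (rule hcond_nonneg)

lemma slot_entropy_le: "slot_entropy K1 K2 c z S g s \<le> ln (real CARD('f))"
  unfolding slot_entropy_def by (rule hcond_le_ln_card) auto

lemma slot_entropy_mono: "S \<subseteq> T \<Longrightarrow> slot_entropy K1 K2 c z T g s \<le> slot_entropy K1 K2 c z S g s"
  unfolding slot_entropy_def by (rule hcond_mono) (auto dest: obs_mono)

lemma slot_entropy_cond: "slot_entropy K1 K2 c z S g s \<le> slot_entropy K1 K2 c z S (\<lambda>_. ()) s"
  unfolding slot_entropy_def by (rule hcond_mono) auto

lemma slot_entropy_fst: "active c z s = N1 \<Longrightarrow> slot_entropy K1 K2 c z S fst s = 0"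
  unfolding slot_entropy_def by (rule hcond_determined) (auto simp: sym_at_def)

lemma slot_entropy_known:
  assumes "active c z s = N1" "\<not> unresolved c z S s"
  shows "slot_entropy K1 K2 c z S g s = 0"
  unfolding slot_entropy_def
proof (rule hcond_determined)
  fix v w :: "'f list \<times> 'f list"
  assume "(obs c z S s v, g v) = (obs c z S s w, g w)"
  then have "\<forall>s'<s. heard c z S s' \<longrightarrow> sym_at c z s' v = sym_at c z s' w" by (simp add: obs_eq_iff)
  moreover obtain s' where "s' < s" "active c z s' = N1" "heard c z S s'" "pkt c z s' = pkt c z s"
    using assms by (auto simp: unresolved_def)
  ultimately show "sym_at c z s v = sym_at c z s w"
    using assms(1) by (metis sym_at_def)
qed

text \<open>What nodes 3 and 4 have received, including everything from node 2, does not depend on a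
  packet that nodes 2, 3 and 4 have all missed. Resampling this coordinate therefore stays in the
  larger fiber, which must exceed the smaller one by a factor of at least the field size.\<close>

lemma slot_entropy_fresh:
  assumes "unresolved c z {N2, N3, N4} s" "pkt c z s < K1"
  shows "slot_entropy K1 K2 c z {N3, N4} snd s \<ge> ln (real CARD('f))"
proof -
  let ?i = "pkt c z s" and ?g = "\<lambda>w. (obs c z {N3, N4} s w, snd w)"
  let ?F = "\<lambda>w. fiber (msgs K1 K2 :: ('f list \<times> 'f list) set) (\<lambda>w. (sym_at c z s w, ?g w)) w"
  let ?G = "\<lambda>w. fiber (msgs K1 K2 :: ('f list \<times> 'f list) set) ?g w"
  have act: "active c z s = N1" using assms(1) by (simp add: unresolved_def)
  have card: "CARD('f) * card (?F w) \<le> card (?G w)" for w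
  proof -
    let ?h = "\<lambda>(a, v). ((fst v)[?i := a], snd v)"
    have upd: "obs c z {N3, N4} s ((fst v)[?i := a], snd v) = obs c z {N3, N4} s v" for v a
      using obs_update[of s c z "{N2, N3, N4}" ?i "{N3, N4}" "fst v" a "snd v"] assms(1)
      by (auto simp: unresolved_def)
    have "inj_on ?h (UNIV \<times> ?F w)"
    proof (rule inj_onI)
      fix x y assume x: "x \<in> UNIV \<times> ?F w" and y: "y \<in> UNIV \<times> ?F w" and eq: "?h x = ?h y"
      obtain a v b u where xy: "x = (a, v)" "y = (b, u)"
        by (cases x; cases y) blast
      have l: "length (fst v) = K1" "length (fst u) = K1" and e: "fst v ! ?i = fst u ! ?i"
        using x y xy act by (auto simp: fiber_def msgs_def sym_at_def)
      have eq': "(fst v)[?i := a] = (fst u)[?i := b]" "snd v = snd u" using eq xy by auto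
      then have "a = b" using l assms(2) by (metis nth_list_update_eq)
      moreover have "fst v = fst u" using eq'(1) e by (metis list_update_id list_update_overwrite)
      ultimately show "x = y" using eq'(2) xy by (simp add: prod_eq_iff)
    qed
    moreover have "?h ` (UNIV \<times> ?F w) \<subseteq> ?G w"
      using upd by (auto simp: fiber_def msgs_def)
    moreover have "finite (?G w)" using fin by (simp add: fiber_def)
    ultimately have "card (UNIV \<times> ?F w :: ('f \<times> _) set) \<le> card (?G w)"
      by (rule card_inj_on_le)
    then show ?thesis by (simp add: card_cartesian_product)
  qed
  have "ln (real CARD('f)) \<le> ln (card (?G w) / card (?F w))" if w: "w \<in> msgs K1 K2" for w
  proof -
    have "card (?F w) > 0" by (rule fiber_pos[OF w])
    moreover have "real CARD('f) * card (?F w) \<le> card (?G w)"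
      using of_nat_mono[OF card[of w], where 'a = real] by (simp only: of_nat_mult)
    ultimately have "real CARD('f) \<le> card (?G w) / card (?F w)" by (simp add: field_simps)
    then show ?thesis by (intro ln_mono) auto
  qed
  then have "(\<Sum>w\<in>(msgs K1 K2 :: ('f list \<times> 'f list) set). ln (real CARD('f))) \<le> (\<Sum>w\<in>msgs K1 K2. ln (card (?G w) / card (?F w)))"
    by (rule sum_mono)
  then show ?thesis using card_pos unfolding slot_entropy_def hcond_def by (simp add: field_simps)
qed

lemma H_fst: "g = (\<lambda>_. u) \<Longrightarrow> H fst g = K1 * ln (real CARD('f))" and H_fst_snd: "H fst snd = K1 * ln (real CARD('f))"
  and H_snd: "g = (\<lambda>_. u) \<Longrightarrow> H snd g = K2 * ln (real CARD('f))" and H_snd_fst: "H snd fst = K2 * ln (real CARD('f))"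
proof -
  let ?V = "\<lambda>k. {w :: 'f list. length w = k}"
  have f: "fiber (msgs K1 K2) (\<lambda>_. u) w = ?V K1 \<times> ?V K2"
    "fiber (msgs K1 K2) (\<lambda>w. (fst w, u)) w = {fst w} \<times> ?V K2"
    "fiber (msgs K1 K2) (\<lambda>w. (snd w, u)) w = ?V K1 \<times> {snd w}"
    "fiber (msgs K1 K2) fst w = {fst w} \<times> ?V K2"
    "fiber (msgs K1 K2) snd w = ?V K1 \<times> {snd w}"
    "fiber (msgs K1 K2) (\<lambda>w. (fst w, snd w)) w = {w}"
    "fiber (msgs K1 K2) (\<lambda>w. w) w = {w}"
    "fiber (msgs K1 K2) (\<lambda>w. (snd w, fst w)) w = {w}"
    if "w \<in> msgs K1 K2" for w :: "'f list \<times> 'f list" and u :: 'b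
    using that by (auto simp: fiber_def msgs_def)
  have q: "real CARD('f) > 0" by simp
  show "g = (\<lambda>_. u) \<Longrightarrow> H fst g = K1 * ln (real CARD('f))" "H fst snd = K1 * ln (real CARD('f))"
    "g = (\<lambda>_. u) \<Longrightarrow> H snd g = K2 * ln (real CARD('f))" "H snd fst = K2 * ln (real CARD('f))"
    using card_pos
    by (simp_all add: hcond_def f card_cartesian_product card_lists_length ln_realpow cong: sum.cong)
qed

lemma Fano3: "H fst (\<lambda>w. (obs c z {N3} n w, g w)) \<le> ln 2 + err_frac K1 K2 n c z * (K1 * ln (real CARD('f)))"
proof -
  let ?y = "\<lambda>w. (Y1 c z (fst w) N3 n, Y2 c z (fst w) (snd w) N3 n)"
  let ?D = "\<lambda>(y1, y2). dec3 c y1 y2 (feedback c z n)"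
  have "H fst (\<lambda>w. (obs c z {N3} n w, g w)) \<le> H fst ?y"
    by (rule hcond_mono) (auto dest: obs_Y1 obs_Y2)
  also have "\<dots> \<le> ln 2 + card {w \<in> msgs K1 K2. ?D (?y w) \<noteq> fst w} / card (msgs K1 K2 :: ('f list \<times> 'f list) set)
      * ln (card {w :: 'f list. length w = K1})"
    by (rule hcond_Fano) (auto simp: finite_lists_length msgs_def)
  also have "ln (card {w :: 'f list. length w = K1}) = K1 * ln (real CARD('f))"
    by (simp add: card_lists_length ln_realpow)
  also have "card {w \<in> msgs K1 K2. ?D (?y w) \<noteq> fst w} / card (msgs K1 K2 :: ('f list \<times> 'f list) set) \<le> err_frac K1 K2 n c z"
    unfolding err_frac_def using fin
    by (intro divide_right_mono) (auto intro!: card_mono simp: decoding_error_def)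
  finally show ?thesis by (simp add: mult_right_mono)
qed

lemma Fano4: "H snd (\<lambda>w. (obs c z {N4} n w, g w)) \<le> ln 2 + err_frac K1 K2 n c z * (K2 * ln (real CARD('f)))"
proof -
  let ?y = "\<lambda>w. (Y1 c z (fst w) N4 n, Y2 c z (fst w) (snd w) N4 n)"
  let ?D = "\<lambda>(y1, y2). dec4 c y1 y2 (feedback c z n)"
  have "H snd (\<lambda>w. (obs c z {N4} n w, g w)) \<le> H snd ?y"
    by (rule hcond_mono) (auto dest: obs_Y1 obs_Y2)
  also have "\<dots> \<le> ln 2 + card {w \<in> msgs K1 K2. ?D (?y w) \<noteq> snd w} / card (msgs K1 K2 :: ('f list \<times> 'f list) set)
      * ln (card {w :: 'f list. length w = K2})"
    by (rule hcond_Fano) (auto simp: finite_lists_length msgs_def)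
  also have "ln (card {w :: 'f list. length w = K2}) = K2 * ln (real CARD('f))"
    by (simp add: card_lists_length ln_realpow)
  also have "card {w \<in> msgs K1 K2. ?D (?y w) \<noteq> snd w} / card (msgs K1 K2 :: ('f list \<times> 'f list) set) \<le> err_frac K1 K2 n c z"
    unfolding err_frac_def using fin
    by (intro divide_right_mono) (auto intro!: card_mono simp: decoding_error_def)
  finally show ?thesis by (simp add: mult_right_mono)
qed

lemma H_fst_unit: "H fst (\<lambda>_. ()) = K1 * ln (real CARD('f))"
  and H_snd_unit: "H snd (\<lambda>_. ()) = K2 * ln (real CARD('f))"
  and H_fst_snd_msgs: "H fst snd = K1 * ln (real CARD('f))"
  and H_snd_fst_msgs: "H snd fst = K2 * ln (real CARD('f))"
  by (rule H_fst H_snd H_fst_snd H_snd_fst; rule refl)+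

text \<open>Two expansions of the joint entropy of \<open>W_1\<close> and the observation, with Fano
  for the last term. The entropy given \<open>fst\<close> is what the symbols at node 3 carry beyond
  \<open>W_1\<close>.\<close>

lemma decoded3_entropy:
  "K1 * ln (real CARD('f)) + H (obs c z {N3} n) fst
    \<le> H (obs c z {N3} n) (\<lambda>_. ()) + (ln 2 + err_frac K1 K2 n c z * (K1 * ln (real CARD('f))))"
proof -
  have "H fst (\<lambda>_. ()) + H (obs c z {N3} n) (\<lambda>w. (fst w, ())) =
      H (obs c z {N3} n) (\<lambda>_. ()) + H fst (\<lambda>w. (obs c z {N3} n w, ()))"
    by (rule hcond_swap)
  moreover have "H (obs c z {N3} n) (\<lambda>w. (fst w, ())) = H (obs c z {N3} n) fst"
    by (rule hcond_cong) auto
  ultimately show ?thesis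
    using Fano3[of "\<lambda>_. ()"] H_fst_unit by simp
qed

text \<open>Node 4 is also given the observations of node 3. The entropy of each slot is then at
  most that given the observations of node 3 alone, so the bound can be set against
  \<open>decoded3_entropy\<close>.\<close>

lemma decoded4_entropy_given_W1:
  "K2 * ln (real CARD('f)) \<le> H (obs c z {N3, N4} n) fst
    + (ln 2 + err_frac K1 K2 n c z * (K2 * ln (real CARD('f))))"
proof -
  have "H snd fst + H (obs c z {N3, N4} n) (\<lambda>w. (snd w, fst w)) =
      H (obs c z {N3, N4} n) fst + H snd (\<lambda>w. (obs c z {N3, N4} n w, fst w))"
    by (rule hcond_swap)
  moreover have "H snd (\<lambda>w. (obs c z {N3, N4} n w, fst w)) \<le> H snd (\<lambda>w. (obs c z {N4} n w, fst w))"
    by (rule hcond_mono) (auto dest: obs_mono[of "{N4}" "{N3, N4}", rotated])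
  ultimately show ?thesis
    using Fano4[of fst] H_snd_fst_msgs
      hcond_nonneg[of "obs c z {N3, N4} n" "\<lambda>w. (snd w, fst w)"] by simp
qed

lemma decoded4_entropy:
  "K2 * ln (real CARD('f)) + H (obs c z {N4} n) snd
    \<le> H (obs c z {N4} n) (\<lambda>_. ()) + (ln 2 + err_frac K1 K2 n c z * (K2 * ln (real CARD('f))))"
proof -
  have "H snd (\<lambda>_. ()) + H (obs c z {N4} n) (\<lambda>w. (snd w, ())) =
      H (obs c z {N4} n) (\<lambda>_. ()) + H snd (\<lambda>w. (obs c z {N4} n w, ()))"
    by (rule hcond_swap)
  moreover have "H (obs c z {N4} n) (\<lambda>w. (snd w, ())) = H (obs c z {N4} n) snd"
    by (rule hcond_cong) auto
  ultimately show ?thesis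
    using Fano4[of "\<lambda>_. ()"] H_snd_unit by simp
qed

lemma obs_determined: "H (obs c z S t) (\<lambda>w. (fst w, snd w)) = 0"
  by (rule hcond_determined) (simp add: prod_eq_iff[symmetric])

lemma decoded3_entropy_given_W2:
  "K1 * ln (real CARD('f)) \<le> H (obs c z {N3, N4} n) snd
    + (ln 2 + err_frac K1 K2 n c z * (K1 * ln (real CARD('f))))"
  and obs34_entropy_le: "H (obs c z {N3, N4} n) snd \<le> K1 * ln (real CARD('f))"
proof -
  have "H fst snd + H (obs c z {N3, N4} n) (\<lambda>w. (fst w, snd w)) =
      H (obs c z {N3, N4} n) snd + H fst (\<lambda>w. (obs c z {N3, N4} n w, snd w))"
    by (rule hcond_swap)
  moreover have "H fst (\<lambda>w. (obs c z {N3, N4} n w, snd w)) \<le> H fst (\<lambda>w. (obs c z {N3} n w, snd w))"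
    by (rule hcond_mono) (auto dest: obs_mono[of "{N3}" "{N3, N4}", rotated])
  ultimately show "K1 * ln (real CARD('f)) \<le> H (obs c z {N3, N4} n) snd
      + (ln 2 + err_frac K1 K2 n c z * (K1 * ln (real CARD('f))))"
    and "H (obs c z {N3, N4} n) snd \<le> K1 * ln (real CARD('f))"
    unfolding obs_determined
    using Fano3[of snd] H_fst_snd_msgs
      hcond_nonneg[of fst "\<lambda>w. (obs c z {N3, N4} n w, snd w)"] by simp_all
qed

text \<open>What node 4 learns about \<open>W_2\<close> it would also learn with \<open>W_1\<close> as side information,
  because the messages are independent.\<close>

lemma obs4_entropy_split:
  "H (obs c z {N4} n) (\<lambda>_. ()) \<le> H (obs c z {N4} n) fst + H (obs c z {N4} n) snd"
proof -
  let ?o = "obs c z {N4} n"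
  have 1: "H snd (\<lambda>_. ()) + H ?o (\<lambda>w. (snd w, ())) = H ?o (\<lambda>_. ()) + H snd (\<lambda>w. (?o w, ()))"
    by (rule hcond_swap)
  have 2: "H ?o (\<lambda>w. (snd w, ())) = H ?o snd"
    by (rule hcond_cong) auto
  have 3: "H snd fst + H ?o (\<lambda>w. (snd w, fst w)) = H ?o fst + H snd (\<lambda>w. (?o w, fst w))"
    by (rule hcond_swap)
  have 4: "H ?o (\<lambda>w. (snd w, fst w)) = 0"
    by (rule hcond_determined) (auto simp: prod_eq_iff[symmetric])
  have 5: "H snd (\<lambda>w. (?o w, fst w)) \<le> H snd (\<lambda>w. (?o w, ()))"
    by (rule hcond_mono) auto
  show ?thesis
    using 1 2 3 4 5 H_snd_unit H_snd_fst_msgs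
    by simp
qed

lemma err_frac_bounds: "0 \<le> err_frac K1 K2 n c z" "err_frac K1 K2 n c z \<le> 1"
proof -
  show "0 \<le> err_frac K1 K2 n c z" by (simp add: err_frac_def)
  have "card {w \<in> msgs K1 K2. decoding_error n c z (fst w) (snd w)} \<le> card (msgs K1 K2 :: ('f list \<times> 'f list) set)"
    using fin by (intro card_mono) auto
  then show "err_frac K1 K2 n c z \<le> 1" using card_pos by (simp add: err_frac_def)
qed

text \<open>If neither node 2 nor node 3 ever received packet \<open>i\<close>, then adding 1 to it goes unnoticed
  by node 3, so at least half of the message pairs are decoded wrongly.\<close>

lemma resolved_or_error:
  assumes "i < K1" "i \<notin> resolved_pkts c z {N2, N3} n"
  shows "err_frac K1 K2 n c z \<ge> 1 / 2"
proof -
  let ?h = "\<lambda>w :: 'f list \<times> 'f list. ((fst w)[i := fst w ! i + 1], snd w)"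
  let ?E = "{w \<in> msgs K1 K2. decoding_error n c z (fst w) (snd w)}"
  let ?C = "{w \<in> msgs K1 K2. \<not> decoding_error n c z (fst w) (snd w)}"
  have same: "obs c z {N3} n (?h w) = obs c z {N3} n w" for w
    using obs_update[of n c z "{N2, N3}" i "{N3}" "fst w" "fst w ! i + 1" "snd w"] assms(2)
    by (auto simp: resolved_pkts_def)
  have "?h ` ?C \<subseteq> ?E"
  proof
    fix v assume "v \<in> ?h ` ?C"
    then obtain w where w: "w \<in> msgs K1 K2" "\<not> decoding_error n c z (fst w) (snd w)" and v: "v = ?h w"
      by auto
    have "fst v \<noteq> fst w"
    proof
      assume "fst v = fst w"
      then have "(fst w)[i := fst w ! i + 1] ! i = fst w ! i" using v by simp
      then show False using assms(1) w(1) by (simp add: msgs_def)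
    qed
    moreover have "Y1 c z (fst v) N3 n = Y1 c z (fst w) N3 n"
      "Y2 c z (fst v) (snd v) N3 n = Y2 c z (fst w) (snd w) N3 n"
      using obs_Y1[OF same[of w]] obs_Y2[OF same[of w]] unfolding v by auto
    ultimately have "decoding_error n c z (fst v) (snd v)"
      using w(2) by (simp add: decoding_error_def)
    then show "v \<in> ?E" using w(1) v by (simp add: msgs_def)
  qed
  moreover have "inj_on ?h ?C"
  proof (rule inj_onI)
    fix v w assume v: "v \<in> ?C" and w: "w \<in> ?C" and eq: "?h v = ?h w"
    have "(fst v)[i := fst v ! i + 1] ! i = (fst w)[i := fst w ! i + 1] ! i" using eq by simp
    then have e: "fst v ! i = fst w ! i" using v w assms(1) by (simp add: msgs_def)
    have "((fst v)[i := fst v ! i + 1])[i := fst v ! i] = ((fst w)[i := fst w ! i + 1])[i := fst w ! i]"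
      using eq e by simp
    then show "v = w" using eq by (simp add: prod_eq_iff)
  qed
  ultimately have "card ?C \<le> card ?E" using fin by (intro card_inj_on_le[of ?h]) auto
  moreover have "card ?C + card ?E = card (msgs K1 K2 :: ('f list \<times> 'f list) set)"
    using fin by (subst card_Un_disjoint[symmetric]) (auto intro: arg_cong[of _ _ card])
  ultimately show ?thesis using card_pos unfolding err_frac_def by (simp add: field_simps)
qed

text \<open>If nodes 2 and 3 both missed some packet throughout, the error fraction is at least 1/2
  and the lower bound is at most 0; otherwise all packets count. A bound linear in the error
  fraction survives taking expectations.\<close>

lemma card_resolved_ge:
  assumes "resolved_pkts c z {N2, N3} n \<subseteq> {..<K1}"
  shows "real (card (resolved_pkts c z {N2, N3} n)) \<ge> K1 * (1 - 2 * err_frac K1 K2 n c z)"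
proof (cases "resolved_pkts c z {N2, N3} n = {..<K1}")
  case True
  then show ?thesis using err_frac_bounds by (simp add: algebra_simps)
next
  case False
  then obtain i where "i < K1" "i \<notin> resolved_pkts c z {N2, N3} n" using assms by auto
  then have "1 - 2 * err_frac K1 K2 n c z \<le> 0" using resolved_or_error by force
  then have "K1 * (1 - 2 * err_frac K1 K2 n c z) \<le> 0" by (simp add: mult_nonneg_nonpos)
  then show ?thesis by linarith
qed

end

section \<open>The outer bound\<close>

lemma sym_at_cong:
  assumes "\<And>t. 1 \<le> t \<Longrightarrow> t \<le> s \<Longrightarrow> link_state (z t) = link_state (z' t)"
  shows "sym_at c z s = sym_at c z' s"
proof -
  have "feedback c z s = feedback c z' s" by (rule feedback_cong[OF assms])
  moreover have "Y1 c z v N2 s = Y1 c z' v N2 s" for v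
    by (rule causalD[OF causal_Y1[OF order_refl] assms])
  ultimately show ?thesis by (simp add: sym_at_def fun_eq_iff active_def pkt_def)
qed

lemma obs_cong:
  assumes "\<And>t. 1 \<le> t \<Longrightarrow> t \<le> s \<Longrightarrow> link_state (z t) = link_state (z' t)"
  shows "obs c z S s = obs c z' S s"
proof -
  have "feedback c z t = feedback c z' t" if "t \<le> s" for t
    using assms that by (intro feedback_cong) auto
  then have "heard c z S t = heard c z' S t" if "t < s" for t
    using assms that by (simp add: heard_def active_def)
  moreover have "sym_at c z t = sym_at c z' t" if "t < s" for t
    using assms that by (intro sym_at_cong) auto
  ultimately show ?thesis by (auto simp: obs_def fun_eq_iff)
qed

text \<open>The entropy of slot \<open>s\<close> is fixed before the erasures of this slot, at time
  \<open>Suc s\<close>, are drawn.\<close>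

lemma causal_Hs: "causal s (\<lambda>z. slot_entropy K1 K2 c z S g s)"
proof (rule causalI)
  fix z z' assume eq: "\<And>t. 1 \<le> t \<Longrightarrow> t \<le> s \<Longrightarrow> link_state (z t) = link_state (z' t)"
  have "sym_at c z s = sym_at c z' s" by (rule sym_at_cong) (rule eq)
  moreover have "obs c z S s = obs c z' S s" by (rule obs_cong) (rule eq)
  ultimately show "slot_entropy K1 K2 c z S g s = slot_entropy K1 K2 c z' S g s" unfolding slot_entropy_def by simp
qed

lemma causal_active: "causal s (\<lambda>z. active c z s)"
  unfolding active_def by (rule causal_map[where f = "sched c"]) (rule causal_feedback, simp)

lemma causal_unresolved: "causal s (\<lambda>z. unresolved c z T s)"
proof (rule causalI)
  fix z z' assume eq: "\<And>t. 1 \<le> t \<Longrightarrow> t \<le> s \<Longrightarrow> link_state (z t) = link_state (z' t)"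
  have "feedback c z t = feedback c z' t" if "t \<le> s" for t
    using eq that by (intro feedback_cong) auto
  then have "active c z t = active c z' t" "pkt c z t = pkt c z' t" if "t \<le> s" for t
    using that by (auto simp: active_def pkt_def)
  moreover have "heard c z T t = heard c z' T t" if "t < s" for t
    using eq that calculation(1)[of t] by (simp add: heard_def)
  ultimately show "unresolved c z T s = unresolved c z' T s"
    unfolding unresolved_def by (metis less_or_eq_imp_le order_refl)
qed

lemma causal_err_frac: "causal n (\<lambda>z. err_frac K1 K2 n c z)"
proof (rule causalI)
  fix z z' assume "\<And>t. 1 \<le> t \<Longrightarrow> t \<le> n \<Longrightarrow> link_state (z t) = link_state (z' t)"
  then have "decoding_error n c z w1 w2 = decoding_error n c z' w1 w2" for w1 w2
    by (rule causalD[OF causal_decoding_error])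
  then show "err_frac K1 K2 n c z = err_frac K1 K2 n c z'" by (simp add: err_frac_def)
qed

context erasure_network
begin

text \<open>\<open>F\<close> and the sender are functions of the first \<open>s\<close> tuples,
  hence independent of the tuple at time \<open>Suc s\<close>, which decides whether
  \<open>S\<close> hears the symbol.\<close>

lemma expectation_heard:
  assumes F: "causal s (F :: _ \<Rightarrow> real)" and i: "i \<in> {N1, N2}" "S \<subseteq> nbrs i"
  shows "expectation (\<lambda>\<omega>. of_bool (active c (\<lambda>t. Z t \<omega>) s = i \<and> heard c (\<lambda>t. Z t \<omega>) S s) * F (\<lambda>t. Z t \<omega>))
    = (1 - eps i S) * expectation (\<lambda>\<omega>. of_bool (active c (\<lambda>t. Z t \<omega>) s = i) * F (\<lambda>t. Z t \<omega>))"
proof -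
  define G where "G = (\<lambda>z. of_bool (active c z s = i) * F z)"
  have G: "causal s G"
    unfolding G_def by (rule causal_map2[OF causal_active F, where f = "\<lambda>a x. of_bool (a = i) * x"])
  define r :: "(node \<Rightarrow> node \<Rightarrow> bool) \<Rightarrow> real" where "r = (\<lambda>l. of_bool (\<exists>j\<in>S. l i j))"
  let ?L = "\<lambda>t \<omega>. link_state (Z t \<omega>)"
  have ind: "indep_var (PiM {1..s} (\<lambda>_. count_space UNIV)) (\<lambda>\<omega>. restrict (\<lambda>t. ?L t \<omega>) {1..s})
      (PiM {Suc s} (\<lambda>_. count_space UNIV)) (\<lambda>\<omega>. restrict (\<lambda>t. ?L t \<omega>) {Suc s})"
    by (rule indep_var_restrict[OF indep_Z]) auto
  \<comment> \<open>The independent variables live in product spaces; turning a family into a list,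
    an element of a countable space, makes every function of it measurable.\<close>
  have "(\<lambda>l. map l [1..<Suc s]) \<in> measurable (PiM {1..s} (\<lambda>_. count_space UNIV))
      (count_space (UNIV :: (node \<Rightarrow> node \<Rightarrow> bool) list set))"
  proof -
    have "(\<lambda>l. map l ts) \<in> measurable (PiM {1..s} (\<lambda>_. count_space (UNIV :: (node \<Rightarrow> node \<Rightarrow> bool) set))) (count_space UNIV)"
      if "set ts \<subseteq> {1..s}" for ts
      using that
    proof (induction ts)
      case (Cons t ts)
      have "(\<lambda>l. l t # map l ts) \<in> measurable (PiM {1..s} (\<lambda>_. count_space (UNIV :: (node \<Rightarrow> node \<Rightarrow> bool) set))) (count_space UNIV)"
        using Cons countable_link
        by (intro measurable_compose_countable[where f = "\<lambda>a l. a # map l ts" and g = "\<lambda>l. l t"]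
            measurable_compose[OF Cons.IH] measurable_component_singleton[where M = "\<lambda>_. count_space UNIV"]) auto
      then show ?case by simp
    qed simp
    from this[of "[1..<Suc s]"] show ?thesis
      by (simp del: upt_Suc add: atLeastLessThanSuc_atLeastAtMost)
  qed
  then have "(\<lambda>l. G (\<lambda>t. map l [1..<Suc s] ! (t - 1))) \<in> borel_measurable (PiM {1..s} (\<lambda>_. count_space UNIV))"
    by (rule measurable_compose[where g = "\<lambda>l. G (\<lambda>t. l ! (t - 1))"]) simp
  moreover have "(\<lambda>l. r (l (Suc s))) \<in> borel_measurable (PiM {Suc s} (\<lambda>_. count_space UNIV))"
    by (rule measurable_compose[OF measurable_component_singleton]) auto
  ultimately have "indep_var borel ((\<lambda>l. G (\<lambda>t. map l [1..<Suc s] ! (t - 1))) \<circ> (\<lambda>\<omega>. restrict (\<lambda>t. ?L t \<omega>) {1..s}))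
      borel ((\<lambda>l. r (l (Suc s))) \<circ> (\<lambda>\<omega>. restrict (\<lambda>t. ?L t \<omega>) {Suc s}))"
    using ind by (intro indep_var_compose)
  moreover have "((\<lambda>l. G (\<lambda>t. map l [1..<Suc s] ! (t - 1))) \<circ> (\<lambda>\<omega>. restrict (\<lambda>t. ?L t \<omega>) {1..s}))
      = (\<lambda>\<omega>. G (\<lambda>t. Z t \<omega>))"
  proof (rule ext)
    fix \<omega>
    have "map (restrict (\<lambda>t. ?L t \<omega>) {1..s}) [1..<Suc s] = map (\<lambda>t. ?L t \<omega>) [1..<Suc s]"
      by (rule map_cong) (auto simp del: upt_Suc)
    then show "((\<lambda>l. G (\<lambda>t. map l [1..<Suc s] ! (t - 1))) \<circ> (\<lambda>\<omega>. restrict (\<lambda>t. ?L t \<omega>) {1..s})) \<omega>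
        = G (\<lambda>t. Z t \<omega>)"
      unfolding comp_def causal_factor[OF G, of \<omega>] by (simp only:)
  qed
  moreover have "((\<lambda>l. r (l (Suc s))) \<circ> (\<lambda>\<omega>. restrict (\<lambda>t. ?L t \<omega>) {Suc s})) = (\<lambda>\<omega>. r (?L (Suc s) \<omega>))"
    by (simp add: fun_eq_iff)
  ultimately have indep: "indep_var borel (\<lambda>\<omega>. G (\<lambda>t. Z t \<omega>)) borel (\<lambda>\<omega>. r (?L (Suc s) \<omega>))"
    by (simp only:)
  have r_causal: "causal (Suc s) (\<lambda>z. r (link_state (z (Suc s))))"
    by (rule causal_map[where f = r]) (rule causal_link; simp)
  have Er: "expectation (\<lambda>\<omega>. r (?L (Suc s) \<omega>)) = 1 - eps i S"
  proof -
    let ?A = "{\<omega> \<in> space M. \<forall>j\<in>S. \<not> ?L (Suc s) \<omega> i j}"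
    have A: "?A \<in> events"
      using measurable_sets[OF measurable_link[of "Suc s"], of "{r. \<forall>j\<in>S. \<not> r i j}"]
      by (simp add: vimage_def Int_def conj_commute)
    have "expectation (\<lambda>\<omega>. r (?L (Suc s) \<omega>)) = expectation (\<lambda>\<omega>. 1 - indicator ?A \<omega>)"
      by (intro Bochner_Integration.integral_cong) (auto simp: r_def indicator_def)
    also have "\<dots> = 1 - prob ?A"
      using A by (simp add: prob_space emeasure_eq_measure)
    finally show ?thesis using prob_none[of "Suc s", OF _ i] by simp
  qed
  have "expectation (\<lambda>\<omega>. G (\<lambda>t. Z t \<omega>) * r (?L (Suc s) \<omega>))
      = expectation (\<lambda>\<omega>. G (\<lambda>t. Z t \<omega>)) * expectation (\<lambda>\<omega>. r (?L (Suc s) \<omega>))"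
    by (rule indep_var_lebesgue_integral[OF indep causal_integrable[OF G] causal_integrable[OF r_causal]])
  moreover have eq: "of_bool (active c z s = i \<and> heard c z S s) * F z = G z * r (link_state (z (Suc s)))" for z
    by (auto simp: G_def r_def heard_def)
  have "(\<lambda>\<omega>. of_bool (active c (\<lambda>t. Z t \<omega>) s = i \<and> heard c (\<lambda>t. Z t \<omega>) S s) * F (\<lambda>t. Z t \<omega>))
      = (\<lambda>\<omega>. G (\<lambda>t. Z t \<omega>) * r (?L (Suc s) \<omega>))"
    by (rule ext) (rule eq)
  ultimately show ?thesis unfolding Er G_def by (simp only: mult.commute)
qed

definition EZ :: "(erasures \<Rightarrow> real) \<Rightarrow> real" where
  "EZ F = expectation (\<lambda>\<omega>. F (\<lambda>t. Z t \<omega>))"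

lemma EZ_mono: "causal m F \<Longrightarrow> causal n G \<Longrightarrow> (\<And>z. F z \<le> G z) \<Longrightarrow> EZ F \<le> EZ G"
  unfolding EZ_def by (intro integral_mono causal_integrable)

lemma EZ_add: "causal m F \<Longrightarrow> causal n G \<Longrightarrow> EZ (\<lambda>z. F z + G z) = EZ F + EZ G"
  unfolding EZ_def by (intro Bochner_Integration.integral_add causal_integrable)

lemma EZ_mult: "EZ (\<lambda>z. a * F z) = a * EZ F"
  unfolding EZ_def by simp

lemma EZ_const: "EZ (\<lambda>z. a) = a"
  unfolding EZ_def by (simp add: prob_space)

lemma EZ_sum: "(\<And>s. s < n \<Longrightarrow> causal n (F s)) \<Longrightarrow> EZ (\<lambda>z. \<Sum>s<n. F s z) = (\<Sum>s<n. EZ (F s))"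
  unfolding EZ_def by (intro Bochner_Integration.integral_sum causal_integrable) auto

definition slots :: "'f channel_code \<Rightarrow> nat \<Rightarrow> node \<Rightarrow> (nat \<Rightarrow> erasures \<Rightarrow> real) \<Rightarrow> real" where
  "slots c n i F = EZ (\<lambda>z. \<Sum>s<n. of_bool (active c z s = i) * F s z)"

lemma causal_active_mult:
  assumes "causal s (F :: _ \<Rightarrow> real)" "s \<le> n"
  shows "causal n (\<lambda>z. of_bool (active c z s = i) * F z)"
  by (rule causal_mono[OF causal_map2[OF causal_active assms(1), where f = "\<lambda>a x. of_bool (a = i) * x"] assms(2)])

lemma causal_sum:
  "(\<And>s. s < n \<Longrightarrow> causal m (F s :: _ \<Rightarrow> real)) \<Longrightarrow> causal m (\<lambda>z. \<Sum>s<n. F s z)"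
  unfolding causal_def by (intro allI impI sum.cong refl) blast

lemma slots_mono:
  assumes "\<And>s. s < n \<Longrightarrow> causal s (F s)" "\<And>s. s < n \<Longrightarrow> causal s (G s)"
    and "\<And>s z. s < n \<Longrightarrow> active c z s = i \<Longrightarrow> F s z \<le> G s z"
  shows "slots c n i F \<le> slots c n i G"
  unfolding slots_def
  using assms by (intro EZ_mono[where m = n and n = n] causal_sum causal_active_mult sum_mono) auto

lemma slots_heard:
  assumes F: "\<And>s. s < n \<Longrightarrow> causal s (F s)" and i: "i \<in> {N1, N2}" "S \<subseteq> nbrs i"
  shows "EZ (\<lambda>z. \<Sum>s<n. of_bool (active c z s = i \<and> heard c z S s) * F s z) = (1 - eps i S) * slots c n i F"
proof -
  have c1: "causal n (\<lambda>z. of_bool (active c z s = i \<and> heard c z S s) * F s z)" if "s < n" for s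
  proof (rule causalI)
    fix z z' assume eq: "\<And>t. 1 \<le> t \<Longrightarrow> t \<le> n \<Longrightarrow> link_state (z t) = link_state (z' t)"
    have "F s z = F s z'" by (rule causalD[OF F[OF that]]) (use eq that in auto)
    moreover have "active c z s = active c z' s" by (rule causalD[OF causal_active]) (use eq that in auto)
    ultimately show "of_bool (active c z s = i \<and> heard c z S s) * F s z
        = of_bool (active c z' s = i \<and> heard c z' S s) * F s z'"
      using eq[of "Suc s"] that by (simp add: heard_def)
  qed
  have "EZ (\<lambda>z. \<Sum>s<n. of_bool (active c z s = i \<and> heard c z S s) * F s z)
      = (\<Sum>s<n. EZ (\<lambda>z. of_bool (active c z s = i \<and> heard c z S s) * F s z))"
    by (rule EZ_sum[OF c1])
  also have "\<dots> = (\<Sum>s<n. (1 - eps i S) * EZ (\<lambda>z. of_bool (active c z s = i) * F s z))"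
    unfolding EZ_def by (intro sum.cong refl expectation_heard[OF F i]) simp
  also have "\<dots> = (1 - eps i S) * slots c n i F"
    unfolding slots_def sum_distrib_left[symmetric]
    by (subst EZ_sum) (use F in \<open>auto intro!: causal_active_mult\<close>)
  finally show ?thesis .
qed

lemma causal_H_obs: "causal n (\<lambda>z. hcond (msgs K1 K2) (obs c z S n) g)"
proof (rule causalI)
  fix z z' assume eq: "\<And>t. 1 \<le> t \<Longrightarrow> t \<le> n \<Longrightarrow> link_state (z t) = link_state (z' t)"
  have "obs c z S n = obs c z' S n" by (rule obs_cong) (rule eq)
  then show "hcond (msgs K1 K2) (obs c z S n) g = hcond (msgs K1 K2) (obs c z' S n) g" by simp
qed

lemma EZ_H_obs:
  fixes c :: "'f::{field, finite} channel_code"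
  assumes code: "is_code n R c" and S: "S \<subseteq> {N3, N4}"
  shows "EZ (\<lambda>z. hcond (msgs K1 K2) (obs c z S n) g)
    = (1 - eps N1 S) * slots c n N1 (\<lambda>s z. slot_entropy K1 K2 c z S g s)
    + (1 - eps N2 S) * slots c n N2 (\<lambda>s z. slot_entropy K1 K2 c z S g s)"
proof -
  let ?T = "\<lambda>i z. \<Sum>s<n. of_bool (active c z s = i \<and> heard c z S s) * slot_entropy K1 K2 c z S g s"
  have act: "active c z s = N1 \<or> active c z s = N2" if "s < n" for z s
    using code that unfolding is_code_def active_def by auto
  have "hcond (msgs K1 K2) (obs c z S n) g = ?T N1 z + ?T N2 z" for z
    unfolding obs_chain sum.distrib[symmetric]
  proof (rule sum.cong[OF refl])
    fix s assume "s \<in> {..<n}"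
    then show "of_bool (heard c z S s) * slot_entropy K1 K2 c z S g s
      = of_bool (active c z s = N1 \<and> heard c z S s) * slot_entropy K1 K2 c z S g s
      + of_bool (active c z s = N2 \<and> heard c z S s) * slot_entropy K1 K2 c z S g s"
      using act[of s z] by auto
  qed
  moreover have "causal n (?T i)" for i
  proof (rule causalI)
    fix z z' assume eq: "\<And>t. 1 \<le> t \<Longrightarrow> t \<le> n \<Longrightarrow> link_state (z t) = link_state (z' t)"
    show "?T i z = ?T i z'"
    proof (rule sum.cong[OF refl])
      fix s assume s: "s \<in> {..<n}"
      have "slot_entropy K1 K2 c z S g s = slot_entropy K1 K2 c z' S g s" by (rule causalD[OF causal_Hs]) (use eq s in auto)
      moreover have "active c z s = active c z' s" by (rule causalD[OF causal_active]) (use eq s in auto)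
      ultimately show "of_bool (active c z s = i \<and> heard c z S s) * slot_entropy K1 K2 c z S g s
        = of_bool (active c z' s = i \<and> heard c z' S s) * slot_entropy K1 K2 c z' S g s"
        using eq[of "Suc s"] s by (simp add: heard_def)
    qed
  qed
  ultimately have "EZ (\<lambda>z. hcond (msgs K1 K2) (obs c z S n) g) = EZ (?T N1) + EZ (?T N2)"
    using EZ_add[of n "?T N1" n "?T N2"] by simp
  then show ?thesis
    using S by (subst (asm) (1 2) slots_heard) (auto intro: causal_Hs)
qed

lemma EZ_err_frac:
  fixes c :: "'f::{field, finite} channel_code"
  shows "EZ (\<lambda>z. err_frac (num_packets n (fst R)) (num_packets n (snd R)) n c z) = error_prob M Z n R c"
proof -
  let ?K1 = "num_packets n (fst R)" and ?K2 = "num_packets n (snd R)"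
  have ne: "{w :: 'f list. length w = k} \<noteq> {}" for k
    using Ex_list_of_length[of k] by auto
  have "measure_pmf.prob (pair_pmf (message_pmf ?K1) (message_pmf ?K2)) {(w1, w2). decoding_error n c z w1 w2}
      = err_frac ?K1 ?K2 n c z" for z
  proof -
    have "pair_pmf (message_pmf ?K1) (message_pmf ?K2) = pmf_of_set (msgs ?K1 ?K2 :: ('f list \<times> 'f list) set)"
      unfolding message_pmf_def msgs_Times
    proof (rule pmf_eqI)
      fix w :: "'f list \<times> 'f list"
      let ?A = "{w :: 'f list. length w = ?K1}" and ?B = "{w :: 'f list. length w = ?K2}"
      have "?A \<times> ?B \<noteq> {}" using ne by simp
      moreover have "finite (?A \<times> ?B)" by (intro finite_cartesian_product finite_lists_length)
      ultimately show "pmf (pair_pmf (pmf_of_set ?A) (pmf_of_set ?B)) w = pmf (pmf_of_set (?A \<times> ?B)) w"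
        by (cases w)
          (simp add: pmf_pair pmf_of_set[OF ne finite_lists_length] pmf_of_set[of "?A \<times> ?B"]
            card_cartesian_product indicator_def)
    qed
    moreover have "msgs ?K1 ?K2 \<inter> {(w1, w2). decoding_error n c z w1 w2}
        = {w \<in> msgs ?K1 ?K2. decoding_error n c z (fst w) (snd w)}" by auto
    moreover have "finite_sample (msgs ?K1 ?K2 :: ('f list \<times> 'f list) set)"
      by (rule finite_sample_msgs)
    ultimately show ?thesis
      unfolding err_frac_def by (simp add: measure_pmf_of_set finite_sample_def)
  qed
  then show ?thesis unfolding error_prob_eq EZ_def by simp
qed

lemma EZ_Fano:
  fixes c :: "'f::{field, finite} channel_code"
  assumes "K1 = num_packets n (fst R)" "K2 = num_packets n (snd R)"
  shows "EZ (\<lambda>z. b + err_frac K1 K2 n c z * a) = b + error_prob M Z n R c * a"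
proof -
  have "EZ (\<lambda>z. b + err_frac K1 K2 n c z * a) = EZ (\<lambda>z. b) + EZ (\<lambda>z. a * err_frac K1 K2 n c z)"
    using EZ_add[OF causal_const[of 0] causal_map[OF causal_err_frac, where f = "\<lambda>x. a * x"]]
    by (simp add: mult.commute)
  then show ?thesis
    using EZ_err_frac[of n R c] assms by (simp add: EZ_const EZ_mult mult.commute)
qed

lemma slots_nonneg:
  assumes "\<And>s. s < n \<Longrightarrow> causal s (F s)" "\<And>s z. s < n \<Longrightarrow> F s z \<ge> 0"
  shows "slots c n i F \<ge> 0"
  unfolding slots_def EZ_def
  by (intro integral_nonneg_AE AE_I2 sum_nonneg mult_nonneg_nonneg assms(2)) auto

lemma slots_mult: "slots c n i (\<lambda>s z. a * F s z) = a * slots c n i F"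
  unfolding slots_def EZ_mult[symmetric] sum_distrib_left by (simp add: mult.left_commute)

lemma causal_unresolved_real: "causal s (\<lambda>z. of_bool (unresolved c z T s) :: real)"
  by (rule causal_map[OF causal_unresolved, where f = of_bool])

text \<open>A Wald-type identity: each unresolved slot succeeds with the same probability whatever
  the past, and the successes correspond to distinct packets.\<close>

lemma slots_unresolved:
  assumes "T \<subseteq> nbrs N1"
  shows "(1 - eps N1 T) * slots c n N1 (\<lambda>s z. of_bool (unresolved c z T s))
    = EZ (\<lambda>z. real (card (resolved_pkts c z T n)))"
proof -
  have "EZ (\<lambda>z. \<Sum>s<n. of_bool (active c z s = N1 \<and> heard c z T s) * of_bool (unresolved c z T s))
      = (1 - eps N1 T) * slots c n N1 (\<lambda>s z. of_bool (unresolved c z T s))"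
    using assms by (intro slots_heard causal_unresolved_real) auto
  moreover have "(\<Sum>s<n. of_bool (active c z s = N1 \<and> heard c z T s) * of_bool (unresolved c z T s))
      = real (card (resolved_pkts c z T n))" for z
    unfolding sum_unresolved_heard[symmetric] by (intro sum.cong refl) (auto simp: unresolved_def)
  ultimately show ?thesis by simp
qed

lemma resolved_pkts_subset:
  assumes "is_code n R c"
  shows "resolved_pkts c z T n \<subseteq> {..<num_packets n (fst R)}"
  using assms unfolding is_code_def resolved_pkts_def active_def pkt_def by auto

lemma causal_resolved: "causal n (\<lambda>z. real (card (resolved_pkts c z T n)))"
proof (rule causalI)
  fix z z' assume eq: "\<And>t. 1 \<le> t \<Longrightarrow> t \<le> n \<Longrightarrow> link_state (z t) = link_state (z' t)"
  have "feedback c z t = feedback c z' t" if "t \<le> n" for t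
    using eq that by (intro feedback_cong) auto
  then have a: "active c z t = active c z' t" "pkt c z t = pkt c z' t" if "t \<le> n" for t
    using that by (auto simp: active_def pkt_def)
  moreover have "heard c z T t = heard c z' T t" if "t < n" for t
    using eq[of "Suc t"] that a(1)[of t] by (simp add: heard_def)
  ultimately have "{s. s < n \<and> active c z s = N1 \<and> heard c z T s} = {s. s < n \<and> active c z' s = N1 \<and> heard c z' T s}"
    by auto
  moreover have "pkt c z ` {s. s < n \<and> active c z' s = N1 \<and> heard c z' T s}
      = pkt c z' ` {s. s < n \<and> active c z' s = N1 \<and> heard c z' T s}"
    using a(2) by (intro image_cong) auto
  ultimately show "real (card (resolved_pkts c z T n)) = real (card (resolved_pkts c z' T n))"
    by (simp add: resolved_pkts_def)
qed

text \<open>All quantities are expectations, with entropies in units of packets. \<open>T1\<close> and \<open>T2\<close> count the slots of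
  nodes 1 and 2. Over the slots of node 2, \<open>v\<close> and \<open>v'\<close> sum the entropies of the symbols given \<open>W_2\<close> and
  the observations of nodes 3 and 4, respectively of node 4, while \<open>m\<close> does not condition on \<open>W_2\<close>; over
  the slots of node 1, \<open>u\<close>, \<open>k'\<close> and \<open>k\<close> do the same. \<open>A\<close> conditions on \<open>W_1\<close> and on what node 3 has
  received. \<open>F\<close>, \<open>T23\<close> and \<open>U4\<close> count the slots that are unresolved for nodes 2, 3 and 4, for nodes 2
  and 3, and for node 4.\<close>

lemma outer_bound_relations:
  fixes c :: "'f::{field, finite} channel_code" and R :: "real \<times> real"
  assumes code: "is_code n R c"
  defines "q \<equiv> ln (real CARD('f))" and "p \<equiv> error_prob M Z n R c"
    and "K1 \<equiv> num_packets n (fst R)" and "K2 \<equiv> num_packets n (snd R)"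
  shows "\<exists>T1 T2 A u v k k' m v' F T23 U4. T1 + T2 = real n \<and>
    K1 + (1 - f3) * A \<le> (1 - e3) * T1 + (1 - f3) * T2 + (ln 2 / q + p * K1) \<and>
    K2 \<le> (1 - f34) * A + (ln 2 / q + p * K2) \<and>
    K2 + (1 - f4) * v' + (1 - e4) * k'
      \<le> (1 - f4) * m + (1 - e4) * k + (ln 2 / q + p * K2) \<and>
    K1 \<le> (1 - f34) * v + (1 - e34) * u + (ln 2 / q + p * K1) \<and>
    (1 - f34) * v + (1 - e34) * u \<le> K1 \<and>
    (1 - e4) * (k - k') \<le> (1 - f4) * v' \<and>
    m \<le> T2 \<and> v \<le> v' \<and> u \<le> k' \<and> k' \<le> k \<and> F \<le> u \<and> k \<le> U4 \<and> T23 + U4 \<le> F + T1 \<and> 0 \<le> v \<and>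
    (1 - e234) * F \<le> K1 \<and> K1 * (1 - 2 * p) \<le> (1 - e23) * T23 \<and> T23 \<le> T1"
proof -
  let ?K1 = "num_packets n (fst R)" and ?K2 = "num_packets n (snd R)"
  have "CARD('f) \<ge> 2"
    using card_mono[of "UNIV :: 'f set" "{0, 1}"] by simp
  then have q: "q > 0" unfolding q_def by simp
  let ?Hs = "\<lambda>S g s z. slot_entropy K1 K2 c z S g s / q"
  let ?u = "\<lambda>_ :: 'f list \<times> 'f list. ()"
  have cH: "causal s (?Hs S g s)" for S s and g :: "'f list \<times> 'f list \<Rightarrow> 'b"
    by (rule causal_map[OF causal_Hs, where f = "\<lambda>x. x / q"])
  have c1: "causal s (\<lambda>z. 1 :: real)" for s by (rule causal_const)
  note cU = causal_unresolved_real
  have H: "EZ (\<lambda>z. hcond (msgs K1 K2) (obs c z S n) g) = ((1 - eps N1 S) * slots c n N1 (?Hs S g)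
      + (1 - eps N2 S) * slots c n N2 (?Hs S g)) * q" if "S \<subseteq> {N3, N4}" for S and g :: "'f list \<times> 'f list \<Rightarrow> 'b"
  proof -
    have "slots c n i (?Hs S g) = slots c n i (\<lambda>s z. slot_entropy K1 K2 c z S g s) / q" for i
      using slots_mult[of c n i "1 / q" "\<lambda>s z. slot_entropy K1 K2 c z S g s"] by simp
    then show ?thesis unfolding EZ_H_obs[OF code that] using q by (simp add: distrib_right)
  qed
  have cO: "causal n (\<lambda>z. hcond (msgs K1 K2 :: ('f list \<times> 'f list) set) (obs c z S n) g)" for S and g :: "'f list \<times> 'f list \<Rightarrow> 'b"
    by (rule causal_H_obs)
  have cF: "causal n (\<lambda>z. b + err_frac K1 K2 n c z * a)" for a b
    by (rule causal_map[OF causal_err_frac, where f = "\<lambda>x. b + x * a"])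
  have EF: "EZ (\<lambda>z. b + err_frac K1 K2 n c z * a) = b + p * a" for a b
    unfolding p_def by (rule EZ_Fano) (simp_all add: K1_def K2_def)
  have s1_1: "slots c n N1 (\<lambda>s z. 1) + slots c n N2 (\<lambda>s z. 1) = n"
  proof -
    have "(\<Sum>s<n. of_bool (active c z s = N1) * 1) + (\<Sum>s<n. of_bool (active c z s = N2) * 1) = (\<Sum>s<n. 1::real)" for z
      unfolding sum.distrib[symmetric]
    proof (rule sum.cong[OF refl])
      fix s assume "s \<in> {..<n}"
      then have "active c z s = N1 \<or> active c z s = N2"
        using code unfolding is_code_def active_def by auto
      then show "of_bool (active c z s = N1) * 1 + of_bool (active c z s = N2) * 1 = (1::real)" by auto
    qed
    then have eq: "(\<lambda>z. (\<Sum>s<n. of_bool (active c z s = N1) * 1) + (\<Sum>s<n. of_bool (active c z s = N2) * 1)) = (\<lambda>z. real n)"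
      by (simp only: sum_constant card_lessThan mult_1_right)
    have cs: "causal n (\<lambda>z. \<Sum>s<n. of_bool (active c z s = i) * 1 :: real)" for i
      by (intro causal_sum causal_active_mult c1) simp
    show ?thesis
      unfolding slots_def EZ_add[OF cs cs, symmetric] eq EZ_const ..
  qed
  have Hle: "?Hs S g s z \<le> 1" for S s z and g :: "'f list \<times> 'f list \<Rightarrow> 'b"
    using slot_entropy_le[of K1 K2 c z S g s] q by (simp add: q_def)
  have Hnn: "?Hs S g s z \<ge> 0" for S s z and g :: "'f list \<times> 'f list \<Rightarrow> 'b"
    using slot_entropy_nonneg[of K1 K2 c z S g s] q by simp
  \<comment> \<open>Given \<open>W_1\<close>, the uncoded symbols of node 1 carry no
    entropy.\<close>
  have fst0: "slots c n N1 (?Hs S fst) = 0" for S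
    using slots_mono[of n "?Hs S fst" "\<lambda>s z. 0" c N1] slots_mono[of n "\<lambda>s z. 0" "?Hs S fst" c N1]
      slots_mult[of c n N1 0 "\<lambda>s z. 0"]
    by (auto simp: cH causal_const slot_entropy_fst)
  have eps1: "1 - e3 \<ge> 0" "1 - e4 \<ge> 0" "1 - f3 \<ge> 0" "1 - f4 \<ge> 0"
    "1 - f34 \<ge> 0"
    using eps_order eps_less_1 by auto
  have b1: "K1 + (1 - f3) * slots c n N2 (?Hs {N3} fst)
    \<le> (1 - e3) * slots c n N1 (?Hs {N3} ?u) + (1 - f3) * slots c n N2 (?Hs {N3} ?u) + (ln 2 / q + p * K1)"
  proof -
    have "EZ (\<lambda>z. K1 * q + hcond (msgs K1 K2) (obs c z {N3} n) fst)
      \<le> EZ (\<lambda>z. hcond (msgs K1 K2) (obs c z {N3} n) ?u + (ln 2 + err_frac K1 K2 n c z * (K1 * q)))"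
      unfolding q_def
      by (intro EZ_mono[where m = n and n = n] decoded3_entropy causal_map2[OF cO cF, where f = "(+)"]
          causal_map[OF cO, where f = "\<lambda>x. a + x" for a])
    then have "K1 * q + EZ (\<lambda>z. hcond (msgs K1 K2) (obs c z {N3} n) fst)
      \<le> EZ (\<lambda>z. hcond (msgs K1 K2) (obs c z {N3} n) ?u) + (ln 2 + p * (K1 * q))"
      by (simp only: EZ_add[OF causal_const[of n] cO] EZ_add[OF cO cF] EF EZ_const)
    then show ?thesis
      using q unfolding H[of "{N3}", simplified] fst0 by (simp add: field_simps)
  qed
  have b2: "K2 \<le> (1 - f34) * slots c n N2 (?Hs {N3,N4} fst) + (ln 2 / q + p * K2)"
  proof -
    have "EZ (\<lambda>z. K2 * q) \<le> EZ (\<lambda>z. hcond (msgs K1 K2) (obs c z {N3,N4} n) fst + (ln 2 + err_frac K1 K2 n c z * (K2 * q)))"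
      unfolding q_def
      by (intro EZ_mono[where m = n and n = n] decoded4_entropy_given_W1 causal_map2[OF cO cF, where f = "(+)"] causal_const)
    then have "K2 * q \<le> EZ (\<lambda>z. hcond (msgs K1 K2) (obs c z {N3,N4} n) fst) + (ln 2 + p * (K2 * q))"
      by (simp only: EZ_add[OF cO cF] EF EZ_const)
    then show ?thesis
      using q unfolding H[of "{N3,N4}", simplified] fst0 by (simp add: field_simps)
  qed
  have b3: "K2 + ((1 - e4) * slots c n N1 (?Hs {N4} snd) + (1 - f4) * slots c n N2 (?Hs {N4} snd))
    \<le> (1 - e4) * slots c n N1 (?Hs {N4} ?u) + (1 - f4) * slots c n N2 (?Hs {N4} ?u) + (ln 2 / q + p * K2)"
  proof -
    have "EZ (\<lambda>z. K2 * q + hcond (msgs K1 K2) (obs c z {N4} n) snd)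
      \<le> EZ (\<lambda>z. hcond (msgs K1 K2) (obs c z {N4} n) ?u + (ln 2 + err_frac K1 K2 n c z * (K2 * q)))"
      unfolding q_def
      by (intro EZ_mono[where m = n and n = n] decoded4_entropy causal_map2[OF cO cF, where f = "(+)"]
          causal_map[OF cO, where f = "\<lambda>x. a + x" for a])
    then have "K2 * q + EZ (\<lambda>z. hcond (msgs K1 K2) (obs c z {N4} n) snd)
      \<le> EZ (\<lambda>z. hcond (msgs K1 K2) (obs c z {N4} n) ?u) + (ln 2 + p * (K2 * q))"
      by (simp only: EZ_add[OF causal_const[of n] cO] EZ_add[OF cO cF] EF EZ_const)
    then show ?thesis
      using q unfolding H[of "{N4}", simplified] by (simp add: field_simps)
  qed
  have b4: "K1 \<le> (1 - e34) * slots c n N1 (?Hs {N3,N4} snd)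
      + (1 - f34) * slots c n N2 (?Hs {N3,N4} snd) + (ln 2 / q + p * K1)"
  proof -
    have "EZ (\<lambda>z. K1 * q) \<le> EZ (\<lambda>z. hcond (msgs K1 K2) (obs c z {N3,N4} n) snd + (ln 2 + err_frac K1 K2 n c z * (K1 * q)))"
      unfolding q_def
      by (intro EZ_mono[where m = n and n = n] decoded3_entropy_given_W2 causal_map2[OF cO cF, where f = "(+)"] causal_const)
    then have "K1 * q \<le> EZ (\<lambda>z. hcond (msgs K1 K2) (obs c z {N3,N4} n) snd) + (ln 2 + p * (K1 * q))"
      by (simp only: EZ_add[OF cO cF] EF EZ_const)
    then show ?thesis
      using q unfolding H[of "{N3,N4}", simplified] by (simp add: field_simps)
  qed
  have b5: "(1 - e34) * slots c n N1 (?Hs {N3,N4} snd)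
      + (1 - f34) * slots c n N2 (?Hs {N3,N4} snd) \<le> K1"
  proof -
    have "EZ (\<lambda>z. hcond (msgs K1 K2) (obs c z {N3,N4} n) snd) \<le> EZ (\<lambda>z. K1 * q)"
      unfolding q_def by (intro EZ_mono[where m = n and n = n] obs34_entropy_le cO causal_const)
    then show ?thesis using q unfolding H[of "{N3,N4}", simplified] EZ_const by simp
  qed
  have b6: "(1 - e4) * slots c n N1 (?Hs {N4} ?u) + (1 - f4) * slots c n N2 (?Hs {N4} ?u)
    \<le> (1 - f4) * slots c n N2 (?Hs {N4} fst)
      + ((1 - e4) * slots c n N1 (?Hs {N4} snd) + (1 - f4) * slots c n N2 (?Hs {N4} snd))"
  proof -
    have "EZ (\<lambda>z. hcond (msgs K1 K2) (obs c z {N4} n) ?u)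
      \<le> EZ (\<lambda>z. hcond (msgs K1 K2) (obs c z {N4} n) fst + hcond (msgs K1 K2) (obs c z {N4} n) snd)"
      by (intro EZ_mono[where m = n and n = n] obs4_entropy_split cO causal_map2[OF cO cO, where f = "(+)"])
    then have "((1 - e4) * slots c n N1 (?Hs {N4} ?u) + (1 - f4) * slots c n N2 (?Hs {N4} ?u)) * q
      \<le> ((1 - f4) * slots c n N2 (?Hs {N4} fst)
      + ((1 - e4) * slots c n N1 (?Hs {N4} snd) + (1 - f4) * slots c n N2 (?Hs {N4} snd))) * q"
      unfolding EZ_add[OF cO cO] H[of "{N4}", simplified] fst0 by (simp add: algebra_simps)
    then show ?thesis using q by simp
  qed
  have m_fst: "slots c n N2 (?Hs {N4} fst) \<le> slots c n N2 (?Hs {N4} ?u)"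
    using q by (intro slots_mono cH divide_right_mono slot_entropy_cond) auto
  have A: "slots c n N2 (?Hs {N3,N4} fst) \<le> slots c n N2 (?Hs {N3} fst)"
    using q by (intro slots_mono cH divide_right_mono slot_entropy_mono) auto
  have v: "slots c n N2 (?Hs {N3,N4} snd) \<le> slots c n N2 (?Hs {N4} snd)"
    using q by (intro slots_mono cH divide_right_mono slot_entropy_mono) auto
  have u: "slots c n N1 (?Hs {N3,N4} snd) \<le> slots c n N1 (?Hs {N4} snd)"
    using q by (intro slots_mono cH divide_right_mono slot_entropy_mono) auto
  have k: "slots c n N1 (?Hs {N4} snd) \<le> slots c n N1 (?Hs {N4} ?u)"
    using q by (intro slots_mono cH divide_right_mono slot_entropy_cond) auto
  have h3: "slots c n i (?Hs S ?u) \<le> slots c n i (\<lambda>s z. 1)" for i S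
    by (intro slots_mono cH c1 Hle)
  let ?U = "\<lambda>T. slots c n N1 (\<lambda>s z. of_bool (unresolved c z T s))"
  have F: "?U {N2,N3,N4} \<le> slots c n N1 (?Hs {N3,N4} snd)"
  proof (intro slots_mono cU cH)
    fix s z assume s: "s < n" "active c z s = N1"
    have "pkt c z s < K1" using code s unfolding is_code_def active_def pkt_def K1_def by auto
    then show "of_bool (unresolved c z {N2,N3,N4} s) \<le> slot_entropy K1 K2 c z {N3, N4} snd s / q"
      using slot_entropy_fresh[where c = c and z = z and s = s and ?K1.0 = K1 and ?K2.0 = K2] slot_entropy_nonneg[of K1 K2 c z "{N3,N4}" snd s] q by (auto simp: q_def)
  qed
  have k4: "slots c n N1 (?Hs {N4} ?u) \<le> ?U {N4}"
  proof (intro slots_mono cU cH)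
    fix s z assume "active c z s = N1"
    then show "slot_entropy K1 K2 c z {N4} ?u s / q \<le> of_bool (unresolved c z {N4} s)"
      using slot_entropy_known[where c = c and z = z and s = s and S = "{N4}" and ?K1.0 = K1 and ?K2.0 = K2 and g = ?u] slot_entropy_le[of K1 K2 c z "{N4}" ?u s] q by (cases "unresolved c z {N4} s") (auto simp: q_def)
  qed
  have split: "?U {N2,N3} + ?U {N4} \<le> ?U {N2,N3,N4} + slots c n N1 (\<lambda>s z. 1)"
  proof -
    have cs: "causal n (\<lambda>z. \<Sum>s<n. of_bool (active c z s = N1) * of_bool (unresolved c z T s) :: real)"
      "causal n (\<lambda>z. \<Sum>s<n. of_bool (active c z s = N1) * 1 :: real)" for T
      by (intro causal_sum causal_active_mult cU c1; simp)+
    show ?thesis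
      unfolding slots_def EZ_add[OF cs(1) cs(1), symmetric] EZ_add[OF cs(1) cs(2), symmetric]
      by (intro EZ_mono[where m = n and n = n] causal_map2[OF cs(1) cs(1), where f = "(+)"]
          causal_map2[OF cs(1) cs(2), where f = "(+)"])
        (unfold sum.distrib[symmetric], rule sum_mono, auto dest: unresolved_cases)
  qed
  have T23: "?U {N2,N3} \<le> slots c n N1 (\<lambda>s z. 1)"
    by (intro slots_mono cU c1) auto
  have F234: "(1 - e234) * ?U {N2,N3,N4} \<le> K1"
  proof -
    have "(1 - e234) * ?U {N2,N3,N4} \<le> EZ (\<lambda>z. real K1)"
      unfolding slots_unresolved[of "{N2,N3,N4}", simplified]
    proof (intro EZ_mono[where m = n and n = n] causal_resolved causal_const)
      fix z show "real (card (resolved_pkts c z {N2,N3,N4} n)) \<le> real K1"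
        using card_mono[OF _ resolved_pkts_subset[OF code, of z "{N2,N3,N4}"]] by (simp add: K1_def)
    qed
    then show ?thesis by (simp add: EZ_const)
  qed
  have D23: "K1 * (1 - 2 * p) \<le> (1 - e23) * ?U {N2,N3}"
  proof -
    have "EZ (\<lambda>z. K1 + err_frac K1 K2 n c z * (- 2 * K1)) \<le> (1 - e23) * ?U {N2,N3}"
      unfolding slots_unresolved[of "{N2,N3}", simplified]
    proof (intro EZ_mono[where m = n and n = n] causal_resolved cF)
      fix z show "K1 + err_frac K1 K2 n c z * (- 2 * K1) \<le> real (card (resolved_pkts c z {N2,N3} n))"
        using card_resolved_ge[where c = c and z = z and n = n and ?K1.0 = K1 and ?K2.0 = K2] resolved_pkts_subset[OF code, of z "{N2,N3}"]
        by (simp add: K1_def algebra_simps)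
    qed
    then show ?thesis unfolding EF by (simp add: algebra_simps)
  qed
  have v0: "0 \<le> slots c n N2 (?Hs {N3,N4} snd)" by (intro slots_nonneg cH Hnn)
  have g1: "(1 - e3) * slots c n N1 (?Hs {N3} ?u) \<le> (1 - e3) * slots c n N1 (\<lambda>s z. 1)"
    "(1 - f3) * slots c n N2 (?Hs {N3} ?u) \<le> (1 - f3) * slots c n N2 (\<lambda>s z. 1)"
    using h3 eps1 by (auto intro: mult_left_mono)
  have g2: "(1 - f34) * slots c n N2 (?Hs {N3,N4} fst) \<le> (1 - f34) * slots c n N2 (?Hs {N3} fst)"
    using A eps1 by (auto intro: mult_left_mono)
  \<comment> \<open>Dropping the conditioning on \<open>W_1\<close> lets the slots of node 2 cancel
    in \<open>b6\<close>, which leaves the bound on \<open>k - k'\<close> in terms of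
    \<open>v'\<close>.\<close>
  have g6: "(1 - f4) * slots c n N2 (?Hs {N4} fst) \<le> (1 - f4) * slots c n N2 (?Hs {N4} ?u)"
    using m_fst eps1 by (auto intro: mult_left_mono)
  show ?thesis
  proof (intro exI conjI)
    show "slots c n N1 (\<lambda>s z. 1) + slots c n N2 (\<lambda>s z. 1) = real n" by (rule s1_1)
    show "K1 + (1 - f3) * slots c n N2 (?Hs {N3} fst)
      \<le> (1 - e3) * slots c n N1 (\<lambda>s z. 1) + (1 - f3) * slots c n N2 (\<lambda>s z. 1) + (ln 2 / q + p * K1)"
      using b1 g1 by linarith
    show "K2 \<le> (1 - f34) * slots c n N2 (?Hs {N3} fst) + (ln 2 / q + p * K2)"
      using b2 g2 by linarith
    show "K2 + (1 - f4) * slots c n N2 (?Hs {N4} snd) + (1 - e4) * slots c n N1 (?Hs {N4} snd)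
      \<le> (1 - f4) * slots c n N2 (?Hs {N4} ?u) + (1 - e4) * slots c n N1 (?Hs {N4} ?u) + (ln 2 / q + p * K2)"
      using b3 by linarith
    show "K1 \<le> (1 - f34) * slots c n N2 (?Hs {N3,N4} snd)
      + (1 - e34) * slots c n N1 (?Hs {N3,N4} snd) + (ln 2 / q + p * K1)"
      using b4 by linarith
    show "(1 - f34) * slots c n N2 (?Hs {N3,N4} snd)
      + (1 - e34) * slots c n N1 (?Hs {N3,N4} snd) \<le> K1"
      using b5 by linarith
    show "(1 - e4) * (slots c n N1 (?Hs {N4} ?u) - slots c n N1 (?Hs {N4} snd))
      \<le> (1 - f4) * slots c n N2 (?Hs {N4} snd)"
      using b6 g6 by (simp add: right_diff_distrib)
    show "?U {N2,N3} + ?U {N4} \<le> ?U {N2,N3,N4} + slots c n N1 (\<lambda>s z. 1)" by (rule split)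
  qed (fact h3 v u k F k4 v0 F234 D23 T23)+
qed

end

text \<open>The witness \<open>\<Gamma>\<close> plays the role of \<open>G\<close>: it combines the time node 1 spends on repeating packets that
  nodes 3 and 4 lack (\<open>u\<close>) with the gain \<open>e\<close> that node 4 draws from uncoded packets of \<open>W_1\<close> which
  resolve sums received earlier.\<close>

lemma outer_bound_arith:
  fixes K1 K2 p \<phi>3 \<phi>4 n c3 c4 c23 c34 c234 d3 d4 d34 :: real
  assumes pos: "c23 > 0" "c234 > 0" "d3 > 0" "d4 > 0" "d34 > 0" "c3 \<ge> 0" "c4 \<ge> 0" "c34 \<ge> 0"
    and c: "c3 \<le> d3" "c34 \<le> c234" and K: "K1 \<ge> 0" "p \<ge> 0"
    and ex: "\<exists>T1 T2 A u v k k' m v' F T23 U4. T1 + T2 = n \<and>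
    K1 + d3 * A \<le> c3 * T1 + d3 * T2 + \<phi>3 \<and> K2 \<le> d34 * A + \<phi>4 \<and>
    K2 + d4 * v' + c4 * k' \<le> d4 * m + c4 * k + \<phi>4 \<and>
    K1 \<le> d34 * v + c34 * u + \<phi>3 \<and> d34 * v + c34 * u \<le> K1 \<and> c4 * (k - k') \<le> d4 * v' \<and>
    m \<le> T2 \<and> v \<le> v' \<and> u \<le> k' \<and> k' \<le> k \<and> F \<le> u \<and> k \<le> U4 \<and> T23 + U4 \<le> F + T1 \<and> 0 \<le> v \<and>
    c234 * F \<le> K1 \<and> K1 * (1 - 2 * p) \<le> c23 * T23 \<and> T23 \<le> T1"
    and cases: "c34 / d34 \<le> 1 \<and> c4 / d4 \<le> 1 \<or> c4 / d4 \<le> c34 / d34 \<and> 1 < c34 / d34"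
  defines "E \<equiv> \<phi>3 / d3 + \<phi>4 / d34 + 2 * p * K1 / c23" and "E' \<equiv> \<phi>3 / d34 + \<phi>4 / d4 + 2 * p * K1 / c23"
  shows "\<exists>\<Gamma>\<ge>0. (1 < c34 / d34 \<longrightarrow> \<Gamma> \<le> K1 / c34 - K1 / c234) \<and> (\<not> 1 < c34 / d34 \<longrightarrow> \<Gamma> = 0) \<and>
    K1 / d3 + K2 / d34 + (1 - c3 / d3) * (K1 / c23 + \<Gamma>) \<le> n + E \<and>
    K1 / d34 + K2 / d4 + K1 / c23 - c34 / d34 * (K1 / c234) + \<Gamma> - c34 / d34 * \<Gamma> \<le> n + E'"
proof -
  obtain T1 T2 A u v k k' m v' F T23 U4 where
    T: "T1 + T2 = n" and b1: "K1 + d3 * A \<le> c3 * T1 + d3 * T2 + \<phi>3" and b2: "K2 \<le> d34 * A + \<phi>4"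
    and b3: "K2 + d4 * v' + c4 * k' \<le> d4 * m + c4 * k + \<phi>4"
    and b4: "K1 \<le> d34 * v + c34 * u + \<phi>3" and b5: "d34 * v + c34 * u \<le> K1"
    and b6: "c4 * (k - k') \<le> d4 * v'"
    and o: "m \<le> T2" "v \<le> v'" "u \<le> k'" "k' \<le> k" "F \<le> u" "k \<le> U4" "T23 + U4 \<le> F + T1" "0 \<le> v" "T23 \<le> T1"
    and f: "c234 * F \<le> K1" and t: "K1 * (1 - 2 * p) \<le> c23 * T23"
    using ex by blast
  define a b g where "a = c34 / d34" and "b = c4 / d4" and "g = c3 / d3"
  have c34: "c34 = a * d34" and c4: "c4 = b * d4" and c3: "c3 = g * d3"
    using pos by (simp_all add: a_def b_def g_def)
  have abg: "a \<ge> 0" "b \<ge> 0" "g \<ge> 0" "g \<le> 1" using pos c by (simp_all add: a_def b_def g_def)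
  have B1: "K1 / d3 + A \<le> g * T1 + T2 + \<phi>3 / d3"
  proof -
    have "(K1 / d3 + A) * d3 \<le> (g * T1 + T2 + \<phi>3 / d3) * d3"
      using b1 pos unfolding c3 by (simp add: algebra_simps)
    then show ?thesis by (rule mult_right_le_imp_le) (rule pos)
  qed
  have B2: "K2 / d34 \<le> A + \<phi>4 / d34"
  proof -
    have "K2 / d34 * d34 \<le> (A + \<phi>4 / d34) * d34" using b2 pos by (simp add: algebra_simps)
    then show ?thesis by (rule mult_right_le_imp_le) (rule pos)
  qed
  have B3: "K2 / d4 + v' + b * k' \<le> m + b * k + \<phi>4 / d4"
  proof -
    have "(K2 / d4 + v' + b * k') * d4 \<le> (m + b * k + \<phi>4 / d4) * d4"
      using b3 pos unfolding c4 by (simp add: algebra_simps)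
    then show ?thesis by (rule mult_right_le_imp_le) (rule pos)
  qed
  have B4: "K1 / d34 \<le> v + a * u + \<phi>3 / d34" and B5: "v + a * u \<le> K1 / d34"
  proof -
    have "K1 / d34 * d34 \<le> (v + a * u + \<phi>3 / d34) * d34" "(v + a * u) * d34 \<le> K1 / d34 * d34"
      using b4 b5 pos unfolding c34 by (simp_all add: algebra_simps)
    then show "K1 / d34 \<le> v + a * u + \<phi>3 / d34" "v + a * u \<le> K1 / d34"
      using pos(5) by (blast intro: mult_right_le_imp_le)+
  qed
  have B6: "b * (k - k') \<le> v'"
  proof -
    have "b * (k - k') * d4 \<le> v' * d4" using b6 unfolding c4 by (simp add: algebra_simps)
    then show ?thesis by (rule mult_right_le_imp_le) (rule pos)
  qed
  have f': "F \<le> K1 / c234" using f pos by (simp add: field_simps)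
  have t': "K1 / c23 - 2 * p * K1 / c23 \<le> T23"
    using t pos by (simp add: field_simps)
  have r: "0 \<le> 2 * p * K1 / c23" using K pos by simp
  \<comment> \<open>When \<open>B3\<close> and \<open>B4\<close> are added, node 4 gains
    \<open>b * (k - k')\<close> and loses \<open>v' - v\<close>; \<open>e\<close> is the positive
    part of the net gain, and \<open>B6\<close> bounds it by \<open>v\<close>.\<close>
  define e where "e = max 0 (b * (k - k') - (v' - v))"
  have bk: "0 \<le> b * (k - k')" using abg o by simp
  have e: "0 \<le> e" "e \<le> v" "e \<le> b * (k - k')" "b * (k - k') - (v' - v) \<le> e"
    unfolding e_def using B6 o bk by auto
  have B7: "K2 / d4 + K1 / d34 \<le> T2 + a * u + e + \<phi>4 / d4 + \<phi>3 / d34"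
    using B3 B4 e(4) o(1) by (simp add: algebra_simps)
  \<comment> \<open>Every \<open>\<Gamma>\<close> that fits into the slots of node 1 left over by
    \<open>T23\<close> satisfies the first constraint, since a slot of node 1 costs
    \<open>1 - g \<ge> 0\<close> there.\<close>
  have P3: "K1 / d3 + K2 / d34 + (1 - g) * (K1 / c23 + \<Gamma>) \<le> n + E" if "T23 + \<Gamma> \<le> T1" for \<Gamma>
  proof -
    have "K1 / c23 + \<Gamma> \<le> T1 + 2 * p * K1 / c23" using t' that by linarith
    then have "(1 - g) * (K1 / c23 + \<Gamma>) \<le> (1 - g) * (T1 + 2 * p * K1 / c23)"
      using abg by (intro mult_left_mono) auto
    also have "\<dots> \<le> (1 - g) * T1 + 2 * p * K1 / c23"
      using mult_left_le_one_le[OF r, of "1 - g"] abg by (simp add: distrib_left)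
    finally show ?thesis using B1 B2 T unfolding E_def by (simp add: algebra_simps)
  qed
  show ?thesis
  proof (cases "1 < c34 / d34")
    case True
    then have a1: "a > 1" and ba: "b \<le> a" using cases by (auto simp: a_def b_def)
    have c34p: "c34 > 0" unfolding c34 using a1 pos by simp
    \<comment> \<open>At rate \<open>a\<close> the gain \<open>e\<close> is worth
      \<open>e / a\<close> slots, at most \<open>k - k'\<close> because \<open>b \<le> a\<close>.
      The term \<open>K1 / c234\<close> bounds the slots \<open>F\<close> and is subtracted because
      the second constraint already credits it.\<close>
    define \<Gamma> where "\<Gamma> = max 0 (u + e / a - K1 / c234)"
    have "e / a \<le> k - k'"
    proof -
      have "e \<le> a * (k - k')" using e(3) mult_right_mono[OF ba, of "k - k'"] o by linarith
      then show ?thesis using a1 by (simp add: field_simps)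
    qed
    then have TG: "T23 + \<Gamma> \<le> T1" unfolding \<Gamma>_def using o f' by linarith
    have cap: "\<Gamma> \<le> K1 / c34 - K1 / c234"
    proof -
      have "u + e / a \<le> K1 / c34"
      proof -
        have "(u + e / a) * a \<le> K1 / d34" using B5 e(2) a1 by (simp add: algebra_simps)
        also have "\<dots> = K1 / c34 * a" using a1 pos by (simp add: c34)
        finally show ?thesis by (rule mult_right_le_imp_le) (use a1 in simp)
      qed
      moreover have "K1 / c234 \<le> K1 / c34" using c c34p K pos by (intro divide_left_mono) auto
      ultimately show ?thesis unfolding \<Gamma>_def by linarith
    qed
    have "a * u + e \<le> a * \<Gamma> + a * (K1 / c234)"
    proof -
      have "a * (u + e / a - K1 / c234) \<le> a * \<Gamma>" unfolding \<Gamma>_def using a1 by (intro mult_left_mono) auto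
      then show ?thesis using a1 by (simp add: algebra_simps)
    qed
    then have "K1 / d34 + K2 / d4 + K1 / c23 - a * (K1 / c234) + \<Gamma> - a * \<Gamma> \<le> n + E'"
      using B7 T TG t' unfolding E'_def by linarith
    then show ?thesis
      using P3[OF TG] cap True unfolding a_def[symmetric] g_def[symmetric]
      by (intro exI[of _ \<Gamma>]) (auto simp: \<Gamma>_def)
  next
    case False
    \<comment> \<open>With both gains at most 1, the extra slots of node 1 bring node 4 at most
      their own number, so \<open>\<Gamma> = 0\<close> suffices.\<close>
    then have a1: "a \<le> 1" "b \<le> 1" using cases by (auto simp: a_def b_def)
    have "a * (u - F) \<le> 1 * (u - F)" using a1 o by (intro mult_right_mono) auto
    moreover have "b * (k - k') \<le> 1 * (k - k')" using a1 o by (intro mult_right_mono) auto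
    moreover have "a * F \<le> a * (K1 / c234)" using f' abg by (intro mult_left_mono) auto
    ultimately have "a * u + e \<le> a * (K1 / c234) + T1 - T23"
      using e(3) o by (simp add: algebra_simps)
    then have "K1 / d34 + K2 / d4 + K1 / c23 - a * (K1 / c234) \<le> n + E'"
      using B7 T t' unfolding E'_def by linarith
    then show ?thesis
      using P3[of 0] o(9) False unfolding a_def[symmetric] g_def[symmetric]
      by (intro exI[of _ 0]) auto
  qed
qed

section \<open>Passing to the limit\<close>

context erasure_network
begin

text \<open>Rates enter as actual packet numbers divided by n, which tend to \<open>R1\<close> and
  \<open>R2\<close>. The witnesses \<open>\<gamma> n\<close> need not converge, so they are kept for
  each n and eliminated before the limit is taken.\<close>

lemma outer_bound_asymptotic:
  assumes ach: "achievable TYPE('f::{field, finite}) M Z (R1, R2)"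
    and eps3: "e3 \<ge> f3"
    and cases: "gain34 \<le> 1 \<and> gain4 \<le> 1 \<or> gain4 \<le> gain34 \<and> 1 < gain34"
  shows "\<exists>\<kappa>1 \<kappa>2 \<delta> \<gamma>. \<kappa>1 \<longlonglongrightarrow> R1 \<and> \<kappa>2 \<longlonglongrightarrow> R2 \<and> \<delta> \<longlonglongrightarrow> 0 \<and>
    (\<forall>n\<ge>1. 0 \<le> \<gamma> n \<and> (1 < gain34 \<longrightarrow> \<gamma> n \<le> capG * \<kappa>1 n) \<and> (\<not> 1 < gain34 \<longrightarrow> \<gamma> n = 0) \<and>
      coef3 * \<kappa>1 n + \<kappa>2 n / (1 - f34) + (1 - gain3) * \<gamma> n \<le> 1 + \<delta> n \<and>
      coef4 * \<kappa>1 n + \<kappa>2 n / (1 - f4) - (gain34 - 1) * \<gamma> n \<le> 1 + \<delta> n)"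
proof -
  obtain C :: "nat \<Rightarrow> 'f channel_code" where R: "R1 \<ge> 0" "R2 \<ge> 0"
    and code: "\<And>n. n \<ge> 1 \<Longrightarrow> is_code n (R1, R2) (C n)"
    and err: "(\<lambda>n. error_prob M Z n (R1, R2) (C n)) \<longlonglongrightarrow> 0"
    using ach unfolding achievable_def by auto
  define c3 c4 c23 c34 c234 d3 d4 d34 where e: "c3 = 1 - e3" "c4 = 1 - e4"
    "c23 = 1 - e23" "c34 = 1 - e34" "c234 = 1 - e234"
    "d3 = 1 - f3" "d4 = 1 - f4" "d34 = 1 - f34"
  have pos: "c23 > 0" "c234 > 0" "d3 > 0" "d4 > 0" "d34 > 0" "c3 \<ge> 0" "c4 \<ge> 0" "c34 \<ge> 0"
    and le: "c3 \<le> d3" "c34 \<le> c234"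
    unfolding e using eps_order eps_less_1 eps3 by linarith+
  have coef3: "coef3 = 1 / d3 + (1 - c3 / d3) / c23"
  proof -
    have "coef3 = (c23 - c3) / (d3 * c23) + 1 / c23" by (simp add: coef3_def e)
    also have "\<dots> = 1 / d3 + (1 - c3 / d3) / c23" using pos by (simp add: field_simps)
    finally show ?thesis .
  qed
  have coef4: "coef4 = 1 / d34 + 1 / c23 - c34 / d34 / c234"
  proof -
    have "coef4 = (c234 - c34) / (c234 * d34) + 1 / c23" by (simp add: coef4_def e)
    also have "\<dots> = 1 / d34 + 1 / c23 - c34 / d34 / c234" using pos by (simp add: field_simps)
    finally show ?thesis .
  qed
  have gains: "gain3 = c3 / d3" "gain34 = c34 / d34" "gain4 = c4 / d4"
    by (simp_all add: gain3_def gain34_def gain4_def e)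
  have capG: "capG = 1 / c34 - 1 / c234" if "1 < gain34"
  proof -
    have "c34 > 0" using that pos unfolding gains by (cases "c34 = 0") auto
    moreover have "capG = (c234 - c34) / (c234 * c34)" by (simp add: capG_def e)
    ultimately show ?thesis using pos by (simp add: field_simps)
  qed
  define \<kappa>1 \<kappa>2 where "\<kappa>1 = (\<lambda>n. real (num_packets n R1) / real n)" and "\<kappa>2 = (\<lambda>n. real (num_packets n R2) / real n)"
  define l where "l = ln 2 / ln (real CARD('f))"
  define p where "p = (\<lambda>n. error_prob M Z n (R1, R2) (C n))"
  define \<delta>3 where "\<delta>3 = (\<lambda>n. (l * (1 / real n) + p n * \<kappa>1 n) / d3 + (l * (1 / real n) + p n * \<kappa>2 n) / d34 + 2 * p n * \<kappa>1 n / c23)"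
  define \<delta>4 where "\<delta>4 = (\<lambda>n. (l * (1 / real n) + p n * \<kappa>1 n) / d34 + (l * (1 / real n) + p n * \<kappa>2 n) / d4 + 2 * p n * \<kappa>1 n / c23)"
  have k1: "\<kappa>1 \<longlonglongrightarrow> R1" and k2: "\<kappa>2 \<longlonglongrightarrow> R2"
    unfolding \<kappa>1_def \<kappa>2_def using dens_num_packets R by (auto simp: dens_def)
  have p0: "p \<longlonglongrightarrow> 0" using err by (simp add: p_def)
  have "\<delta>3 \<longlonglongrightarrow> (l * 0 + 0 * R1) / d3 + (l * 0 + 0 * R2) / d34 + 2 * 0 * R1 / c23"
    unfolding \<delta>3_def using pos by (intro tendsto_intros k1 k2 p0 lim_1_over_n) auto
  then have d3: "\<delta>3 \<longlonglongrightarrow> 0" by simp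
  have "\<delta>4 \<longlonglongrightarrow> (l * 0 + 0 * R1) / d34 + (l * 0 + 0 * R2) / d4 + 2 * 0 * R1 / c23"
    unfolding \<delta>4_def using pos by (intro tendsto_intros k1 k2 p0 lim_1_over_n) auto
  then have d4: "\<delta>4 \<longlonglongrightarrow> 0" by simp
  have step: "\<exists>g\<ge>0. (1 < gain34 \<longrightarrow> g \<le> capG * \<kappa>1 n) \<and> (\<not> 1 < gain34 \<longrightarrow> g = 0) \<and>
      coef3 * \<kappa>1 n + \<kappa>2 n / d34 + (1 - gain3) * g \<le> 1 + \<delta>3 n \<and>
      coef4 * \<kappa>1 n + \<kappa>2 n / d4 - (gain34 - 1) * g \<le> 1 + \<delta>4 n" if n: "n \<ge> 1" for n
  proof -
    have pn: "p n \<ge> 0" unfolding p_def error_prob_def Let_def by simp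
    have pe: "error_prob M Z n (R1, R2) (C n) = p n" by (simp add: p_def)
    let ?K1 = "real (num_packets n R1)" and ?K2 = "real (num_packets n R2)"
    obtain \<Gamma> where G: "\<Gamma> \<ge> 0" "1 < c34 / d34 \<longrightarrow> \<Gamma> \<le> ?K1 / c34 - ?K1 / c234" "\<not> 1 < c34 / d34 \<longrightarrow> \<Gamma> = 0"
      and P3: "?K1 / d3 + ?K2 / d34 + (1 - c3 / d3) * (?K1 / c23 + \<Gamma>)
        \<le> n + ((l + p n * ?K1) / d3 + (l + p n * ?K2) / d34 + 2 * p n * ?K1 / c23)"
      and P4: "?K1 / d34 + ?K2 / d4 + ?K1 / c23 - c34 / d34 * (?K1 / c234) + \<Gamma> - c34 / d34 * \<Gamma>
        \<le> n + ((l + p n * ?K1) / d34 + (l + p n * ?K2) / d4 + 2 * p n * ?K1 / c23)"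
      using outer_bound_arith[OF pos le of_nat_0_le_iff pn
          outer_bound_relations[OF code[OF n], folded e l_def, unfolded fst_conv snd_conv pe] cases[unfolded gains]]
      by blast
    have K: "?K1 = n * \<kappa>1 n" "?K2 = n * \<kappa>2 n" using n by (simp_all add: \<kappa>1_def \<kappa>2_def)
    define g where "g = \<Gamma> / n"
    have G': "\<Gamma> = n * g" using n by (simp add: g_def)
    have n0: "real n > 0" using n by simp
    have 1: "real n * (coef3 * \<kappa>1 n + \<kappa>2 n / d34 + (1 - gain3) * g) \<le> real n * (1 + \<delta>3 n)"
      using P3 n0 unfolding K G' coef3 gains \<delta>3_def by (simp add: algebra_simps add_divide_distrib diff_divide_distrib)
    have 2: "real n * (coef4 * \<kappa>1 n + \<kappa>2 n / d4 - (gain34 - 1) * g) \<le> real n * (1 + \<delta>4 n)"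
      using P4 n0 unfolding K G' coef4 gains \<delta>4_def by (simp add: algebra_simps add_divide_distrib diff_divide_distrib)
    have 3: "g \<le> capG * \<kappa>1 n" if "1 < gain34"
    proof -
      have "real n * g \<le> real n * (capG * \<kappa>1 n)"
        using G(2) that unfolding K G' capG[OF that] gains[symmetric] by (simp add: algebra_simps)
      then show ?thesis using n0 by simp
    qed
    show ?thesis
    proof (intro exI[of _ g] conjI impI)
      show "g \<ge> 0" using G(1) by (simp add: g_def)
      show "g \<le> capG * \<kappa>1 n" if "1 < gain34" by (rule 3[OF that])
      show "g = 0" if "\<not> 1 < gain34" using G(3) that by (simp add: g_def gains)
      show "coef3 * \<kappa>1 n + \<kappa>2 n / d34 + (1 - gain3) * g \<le> 1 + \<delta>3 n" using 1 n0 by simp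
      show "coef4 * \<kappa>1 n + \<kappa>2 n / d4 - (gain34 - 1) * g \<le> 1 + \<delta>4 n" using 2 n0 by simp
    qed
  qed
  then obtain \<gamma> where \<gamma>: "\<And>n. n \<ge> 1 \<Longrightarrow> 0 \<le> \<gamma> n \<and> (1 < gain34 \<longrightarrow> \<gamma> n \<le> capG * \<kappa>1 n) \<and> (\<not> 1 < gain34 \<longrightarrow> \<gamma> n = 0) \<and>
      coef3 * \<kappa>1 n + \<kappa>2 n / d34 + (1 - gain3) * \<gamma> n \<le> 1 + \<delta>3 n \<and>
      coef4 * \<kappa>1 n + \<kappa>2 n / d4 - (gain34 - 1) * \<gamma> n \<le> 1 + \<delta>4 n"
    by metis
  have "(\<lambda>n. max (\<delta>3 n) (\<delta>4 n)) \<longlonglongrightarrow> max 0 0" by (intro tendsto_max d3 d4)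
  then have "(\<lambda>n. max (\<delta>3 n) (\<delta>4 n)) \<longlonglongrightarrow> 0" by simp
  moreover have "0 \<le> \<gamma> n \<and> (1 < gain34 \<longrightarrow> \<gamma> n \<le> capG * \<kappa>1 n) \<and> (\<not> 1 < gain34 \<longrightarrow> \<gamma> n = 0) \<and>
      coef3 * \<kappa>1 n + \<kappa>2 n / d34 + (1 - gain3) * \<gamma> n \<le> 1 + max (\<delta>3 n) (\<delta>4 n) \<and>
      coef4 * \<kappa>1 n + \<kappa>2 n / d4 - (gain34 - 1) * \<gamma> n \<le> 1 + max (\<delta>3 n) (\<delta>4 n)" if "n \<ge> 1" for n
  proof -
    have "\<delta>3 n \<le> max (\<delta>3 n) (\<delta>4 n)" "\<delta>4 n \<le> max (\<delta>3 n) (\<delta>4 n)" by simp_all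
    moreover note \<gamma>[OF that]
    ultimately show ?thesis by (intro conjI) (linarith | blast)+
  qed
  ultimately show ?thesis using k1 k2 unfolding e by blast
qed

lemma outer_bound_region1:
  assumes ach: "achievable TYPE('f::{field, finite}) M Z (R1, R2)"
    and eps3: "e3 \<ge> f3" and le1: "gain34 \<le> 1" "gain4 \<le> 1"
  shows "coef3 * R1 + R2 / (1 - f34) \<le> 1" "coef4 * R1 + R2 / (1 - f4) \<le> 1"
proof -
  obtain \<kappa>1 \<kappa>2 \<delta> \<gamma> where l: "\<kappa>1 \<longlonglongrightarrow> R1" "\<kappa>2 \<longlonglongrightarrow> R2" "\<delta> \<longlonglongrightarrow> 0"
    and b: "\<And>n. n \<ge> 1 \<Longrightarrow> \<gamma> n = 0 \<and>
      coef3 * \<kappa>1 n + \<kappa>2 n / (1 - f34) + (1 - gain3) * \<gamma> n \<le> 1 + \<delta> n \<and>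
      coef4 * \<kappa>1 n + \<kappa>2 n / (1 - f4) - (gain34 - 1) * \<gamma> n \<le> 1 + \<delta> n"
    using outer_bound_asymptotic[OF ach eps3] le1 by (metis not_less)
  have ne: "1 - f34 \<noteq> 0" "1 - f4 \<noteq> 0" using eps_order eps_less_1 by linarith+
  have d: "(\<lambda>n. 1 + \<delta> n) \<longlonglongrightarrow> 1" using tendsto_add[OF tendsto_const l(3)] by simp
  have "(\<lambda>n. coef3 * \<kappa>1 n + \<kappa>2 n / (1 - f34)) \<longlonglongrightarrow> coef3 * R1 + R2 / (1 - f34)"
    by (intro tendsto_intros l ne)
  from LIMSEQ_le[OF this d] show "coef3 * R1 + R2 / (1 - f34) \<le> 1" using b by force
  have "(\<lambda>n. coef4 * \<kappa>1 n + \<kappa>2 n / (1 - f4)) \<longlonglongrightarrow> coef4 * R1 + R2 / (1 - f4)"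
    by (intro tendsto_intros l ne)
  from LIMSEQ_le[OF this d] show "coef4 * R1 + R2 / (1 - f4) \<le> 1" using b by force
qed

text \<open>The least \<open>G\<close> allowed by the last constraint of the second region.\<close>

definition "minG R = max 0 ((coef4 * fst R + snd R / (1 - f4) - 1) / (gain34 - 1))"

text \<open>By \<open>e3 \<ge> f3\<close> the first rate constraint only becomes easier when
  \<open>G\<close> shrinks. Hence each \<open>\<gamma> n\<close> may be lowered to the least value
  that the last constraint permits, and this value converges with the rates.\<close>

lemma outer_bound_region2:
  assumes ach: "achievable TYPE('f::{field, finite}) M Z R"
    and eps3: "e3 \<ge> f3" and gt: "gain4 \<le> gain34" "1 < gain34"
  shows "minG R \<le> capG * fst R"
    and "coef3 * fst R + snd R / (1 - f34) + (1 - gain3) * minG R \<le> 1"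
proof -
  obtain \<kappa>1 \<kappa>2 \<delta> \<gamma> where l: "\<kappa>1 \<longlonglongrightarrow> fst R" "\<kappa>2 \<longlonglongrightarrow> snd R" "\<delta> \<longlonglongrightarrow> 0"
    and b: "\<And>n. n \<ge> 1 \<Longrightarrow> 0 \<le> \<gamma> n \<and> \<gamma> n \<le> capG * \<kappa>1 n \<and>
      coef3 * \<kappa>1 n + \<kappa>2 n / (1 - f34) + (1 - gain3) * \<gamma> n \<le> 1 + \<delta> n \<and>
      coef4 * \<kappa>1 n + \<kappa>2 n / (1 - f4) - (gain34 - 1) * \<gamma> n \<le> 1 + \<delta> n"
    using outer_bound_asymptotic[of "fst R" "snd R", unfolded prod.collapse, OF ach eps3] gt by metis
  define G where "G n = max 0 ((coef4 * \<kappa>1 n + \<kappa>2 n / (1 - f4) - (1 + \<delta> n)) / (gain34 - 1))" for n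
  have ne: "1 - f34 \<noteq> 0" "1 - f4 \<noteq> 0" using eps_order eps_less_1 by linarith+
  have d: "(\<lambda>n. 1 + \<delta> n) \<longlonglongrightarrow> 1" using tendsto_add[OF tendsto_const l(3)] by simp
  have G: "G \<longlonglongrightarrow> minG R"
    unfolding G_def minG_def using gt by (intro tendsto_intros l d ne) auto
  have Gle: "G n \<le> \<gamma> n" if "n \<ge> 1" for n
    using b[OF that] gt unfolding G_def by (auto simp: field_simps)
  have g3: "1 - gain3 \<ge> 0" unfolding gain3_def using eps3 eps_less_1 by simp
  have "(\<lambda>n. capG * \<kappa>1 n) \<longlonglongrightarrow> capG * fst R" by (intro tendsto_intros l)
  from LIMSEQ_le[OF G this] show "minG R \<le> capG * fst R" using b Gle by (metis order_trans)
  have "(\<lambda>n. coef3 * \<kappa>1 n + \<kappa>2 n / (1 - f34) + (1 - gain3) * G n)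
      \<longlonglongrightarrow> coef3 * fst R + snd R / (1 - f34) + (1 - gain3) * minG R"
    by (intro tendsto_intros l G ne)
  then show "coef3 * fst R + snd R / (1 - f34) + (1 - gain3) * minG R \<le> 1"
  proof (rule LIMSEQ_le[OF _ d])
    show "\<exists>N. \<forall>n\<ge>N. coef3 * \<kappa>1 n + \<kappa>2 n / (1 - f34) + (1 - gain3) * G n \<le> 1 + \<delta> n"
    proof (intro exI[of _ 1] allI impI)
      fix n :: nat assume n: "1 \<le> n"
      have "(1 - gain3) * G n \<le> (1 - gain3) * \<gamma> n" using Gle[OF n] g3 by (rule mult_left_mono)
      then show "coef3 * \<kappa>1 n + \<kappa>2 n / (1 - f34) + (1 - gain3) * G n \<le> 1 + \<delta> n"
        using b[OF n] by linarith
    qed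
  qed
qed

lemma capacity_region1:
  assumes eps3: "e3 \<ge> f3" and le1: "gain34 \<le> 1" "gain4 \<le> 1"
  shows "capacity_region TYPE('f::{field, finite}) M Z = {(R1, R2). R1 \<ge> 0 \<and> R2 \<ge> 0 \<and>
    coef3 * R1 + R2 / (1 - f34) \<le> 1 \<and> coef4 * R1 + R2 / (1 - f4) \<le> 1}" (is "_ = ?S")
proof
  have ne: "1 - f34 \<noteq> 0" "1 - f4 \<noteq> 0" using eps_order eps_less_1 by linarith+
  have S: "?S = {R. 0 \<le> fst R \<and> 0 \<le> snd R \<and> coef3 * fst R + snd R / (1 - f34) \<le> 1
      \<and> coef4 * fst R + snd R / (1 - f4) \<le> 1}" by auto
  have "closed ?S"
    unfolding S by (intro closed_Collect_conj closed_Collect_le continuous_intros) (use ne in auto)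
  moreover have "{R. achievable TYPE('f) M Z R} \<subseteq> ?S"
  proof
    fix R assume R: "R \<in> {R. achievable TYPE('f) M Z R}"
    then have "0 \<le> fst R" "0 \<le> snd R" by (simp_all add: achievable_def)
    then show "R \<in> ?S"
      using outer_bound_region1[of "fst R" "snd R", OF _ eps3 le1, where 'f = 'f] R
      by (simp add: case_prod_beta)
  qed
  ultimately show "capacity_region TYPE('f) M Z \<subseteq> ?S"
    unfolding capacity_region_def by (simp add: closure_minimal)
  show "?S \<subseteq> capacity_region TYPE('f) M Z"
  proof safe
    fix R1 R2 assume R: "0 \<le> R1" "0 \<le> R2" and c3: "coef3 * R1 + R2 / (1 - f34) \<le> 1"
      and c4: "coef4 * R1 + R2 / (1 - f4) \<le> 1"
    \<comment> \<open>Node 1 makes no extra repetitions and node 2 sends no early sums: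
      \<open>G\<close>, \<open>S\<close>, \<open>U\<close> and \<open>X\<close> are all 0.\<close>
    show "(R1, R2) \<in> capacity_region TYPE('f) M Z"
      using eps_order eps_less_1 R c3 c4
      by (intro in_capacity_region_if_feasible[of R1 R2 0 0 0 0]) auto
  qed
qed

lemma capacity_region2:
  assumes eps3: "e3 \<ge> f3" and gt: "gain4 \<le> gain34" "1 < gain34"
  shows "capacity_region TYPE('f::{field, finite}) M Z = {(R1, R2). R1 \<ge> 0 \<and> R2 \<ge> 0 \<and> (\<exists>G\<ge>0.
    G \<le> capG * R1 \<and> coef3 * R1 + R2 / (1 - f34) \<le> 1 - G + gain3 * G \<and>
    coef4 * R1 + R2 / (1 - f4) \<le> 1 - G + gain34 * G)}" (is "_ = ?S")
proof
  have ne: "1 - f34 \<noteq> 0" "1 - f4 \<noteq> 0" "gain34 - 1 \<noteq> 0"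
    using eps_order eps_less_1 gt by linarith+
  \<comment> \<open>The existential quantifier over \<open>G\<close> is traded for
    \<open>minG\<close>, whose continuity makes the set closed.\<close>
  let ?T = "{R. 0 \<le> fst R \<and> 0 \<le> snd R \<and> minG R \<le> capG * fst R \<and>
    coef3 * fst R + snd R / (1 - f34) + (1 - gain3) * minG R \<le> 1}"
  have "closed ?T"
    unfolding minG_def
    by (intro closed_Collect_conj closed_Collect_le continuous_intros continuous_on_max) (use ne in auto)
  moreover have "{R. achievable TYPE('f) M Z R} \<subseteq> ?T"
  proof
    fix R assume R: "R \<in> {R. achievable TYPE('f) M Z R}"
    then have "0 \<le> fst R" "0 \<le> snd R" by (simp_all add: achievable_def)
    then show "R \<in> ?T" using outer_bound_region2[of R, OF _ eps3 gt, where 'f = 'f] R by simp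
  qed
  ultimately have "capacity_region TYPE('f) M Z \<subseteq> ?T"
    unfolding capacity_region_def by (simp add: closure_minimal)
  also have "?T \<subseteq> ?S"
  proof
    fix R assume R: "R \<in> ?T"
    have "minG R \<ge> 0" by (simp add: minG_def)
    moreover have "(coef4 * fst R + snd R / (1 - f4) - 1) / (gain34 - 1) \<le> minG R"
      by (simp add: minG_def)
    then have "coef4 * fst R + snd R / (1 - f4) - 1 \<le> (gain34 - 1) * minG R"
      using gt by (simp add: pos_divide_le_eq mult.commute)
    ultimately show "R \<in> ?S"
      using R by (auto simp: case_prod_beta algebra_simps intro!: exI[of _ "minG R"])
  qed
  finally show "capacity_region TYPE('f) M Z \<subseteq> ?S" .
  show "?S \<subseteq> capacity_region TYPE('f) M Z"
  proof safe
    fix R1 R2 G :: real assume R: "0 \<le> R1" "0 \<le> R2" and G: "0 \<le> G" "G \<le> capG * R1"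
      and c3: "coef3 * R1 + R2 / (1 - f34) \<le> 1 - G + gain3 * G"
      and c4: "coef4 * R1 + R2 / (1 - f4) \<le> 1 - G + gain34 * G"
    have c34: "1 - e34 > 0"
      using gt(2) eps_order eps_less_1 unfolding gain34_def by (cases "e34 = 1") auto
    have "(1 - e34) * G \<le> (1 - e34) * (capG * R1)"
      using G c34 by (intro mult_left_mono) auto
    also have "\<dots> = (e34 - e234) / (1 - e234) * R1"
      using c34 by (simp add: capG_def)
    finally have X1: "(1 - e34) * G + 0
      \<le> (e34 - e234) / (1 - e234) * R1" by simp
    show "(R1, R2) \<in> capacity_region TYPE('f) M Z"
      using eps_order eps_less_1 R G c3 c4
      by (intro in_capacity_region_if_feasible[OF R G(1) _ _ _ X1, of 0 0]) auto
  qed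
qed

lemma capacity_region3:
  assumes gt: "(1 - e4) / (1 - f4) > 1"
  shows "{(R1, R2). R1 \<ge> 0 \<and> R2 \<ge> 0 \<and> (\<exists>G\<ge>0. \<exists>S\<ge>0. \<exists>U\<ge>0.
            ((e3 - e23) / ((1 - f3) * (1 - e23))
              + 1 / (1 - e23)) * R1 + R2 / (1 - f34) \<le>
              1 - G - S - U + ((1 - e3) / (1 - f3)) * (G + S) \<and>
            ((e34 - e234) / ((1 - e234) * (1 - f34))
              + 1 / (1 - e23)) * R1 + R2 / (1 - f4) \<le>
              1 - G - S - U + (1 - e34) / (1 - f34) * G
              + (1 - e4) / (1 - f4) * (S + U) \<and>
            (f3 - f34) * G + (1 - f34) * S \<le>
              ((f3 - f34) * (e34 - e234))
              / ((1 - e34) * (1 - e234)) * R1 \<and>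
            (f3 - f34) * U \<le>
              (((1 - f4) * (1 - e34)) / (1 - e4)
               - (f3 - f34)) * S \<and>
            G + ((1 - e4) * (1 - f34))
                / ((1 - f4) * (1 - e34)) * (U + S) \<le>
              (e34 - e234) / ((1 - e34) * (1 - e234)) * R1 \<and>
            S \<le> ((f3 - f34) * (f4 - f34))
                / ((1 - e34) * (1 - f4) * (1 - f34)) * R2)}
        \<subseteq> capacity_region TYPE('f::{field, finite}) M Z"
proof safe
  fix R1 R2 G S U :: real
  have "1 - e4 > 0"
    using gt eps_order eps_less_1 by (cases "e4 = 1") auto
  note in_capacity_region_GSU[unfolded coef3_def coef4_def gain3_def gain34_def gain4_def, OF _ _ _ _ _ this, of R1 R2 G S U, where 'f = 'f]
  moreover assume "0 \<le> R1" "0 \<le> R2" "0 \<le> G" "0 \<le> S" "0 \<le> U"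
    "((e3 - e23) / ((1 - f3) * (1 - e23)) + 1 / (1 - e23)) * R1 + R2 / (1 - f34) \<le> 1 - G - S - U + ((1 - e3) / (1 - f3)) * (G + S)"
    "((e34 - e234) / ((1 - e234) * (1 - f34)) + 1 / (1 - e23)) * R1 + R2 / (1 - f4) \<le> 1 - G - S - U + (1 - e34) / (1 - f34) * G + (1 - e4) / (1 - f4) * (S + U)"
    "(f3 - f34) * G + (1 - f34) * S \<le> ((f3 - f34) * (e34 - e234)) / ((1 - e34) * (1 - e234)) * R1"
    "(f3 - f34) * U \<le> (((1 - f4) * (1 - e34)) / (1 - e4) - (f3 - f34)) * S"
    "G + ((1 - e4) * (1 - f34)) / ((1 - f4) * (1 - e34)) * (U + S) \<le> (e34 - e234) / ((1 - e34) * (1 - e234)) * R1"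
    "S \<le> ((f3 - f34) * (f4 - f34)) / ((1 - e34) * (1 - f4) * (1 - f34)) * R2"
  ultimately show "(R1, R2) \<in> capacity_region TYPE('f) M Z" .
qed

end

theorem theorem4:
  fixes M :: "'a measure"
    and Z :: "nat \<Rightarrow> 'a \<Rightarrow> node \<Rightarrow> node \<Rightarrow> bool"
    and eps :: "node \<Rightarrow> node set \<Rightarrow> real"
  assumes "erasure_network M Z eps"
    and "eps N1 {N3} \<ge> eps N2 {N3}"
  shows
    "(max ((1 - eps N1 {N3, N4}) / (1 - eps N2 {N3, N4}))
            ((1 - eps N1 {N4}) / (1 - eps N2 {N4})) \<le> 1 \<longrightarrow>
        capacity_region TYPE('f::{field, finite}) M Z =
        {(R1, R2). R1 \<ge> 0 \<and> R2 \<ge> 0 \<and>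
            ((eps N1 {N3} - eps N1 {N2, N3}) / ((1 - eps N2 {N3}) * (1 - eps N1 {N2, N3}))
              + 1 / (1 - eps N1 {N2, N3})) * R1 + R2 / (1 - eps N2 {N3, N4}) \<le> 1 \<and>
            ((eps N1 {N3, N4} - eps N1 {N2, N3, N4}) / ((1 - eps N1 {N2, N3, N4}) * (1 - eps N2 {N3, N4}))
              + 1 / (1 - eps N1 {N2, N3})) * R1 + R2 / (1 - eps N2 {N4}) \<le> 1})
     \<and>
     (max ((1 - eps N1 {N3, N4}) / (1 - eps N2 {N3, N4}))
            ((1 - eps N1 {N4}) / (1 - eps N2 {N4})) = (1 - eps N1 {N3, N4}) / (1 - eps N2 {N3, N4}) \<and>
      (1 - eps N1 {N3, N4}) / (1 - eps N2 {N3, N4}) > 1 \<longrightarrow>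
        capacity_region TYPE('f) M Z =
        {(R1, R2). R1 \<ge> 0 \<and> R2 \<ge> 0 \<and> (\<exists>G\<ge>0.
            G \<le> (eps N1 {N3, N4} - eps N1 {N2, N3, N4}) / ((1 - eps N1 {N2, N3, N4}) * (1 - eps N1 {N3, N4})) * R1 \<and>
            ((eps N1 {N3} - eps N1 {N2, N3}) / ((1 - eps N2 {N3}) * (1 - eps N1 {N2, N3}))
              + 1 / (1 - eps N1 {N2, N3})) * R1 + R2 / (1 - eps N2 {N3, N4}) \<le>
              1 - G + ((1 - eps N1 {N3}) / (1 - eps N2 {N3})) * G \<and>
            ((eps N1 {N3, N4} - eps N1 {N2, N3, N4}) / ((1 - eps N1 {N2, N3, N4}) * (1 - eps N2 {N3, N4}))
              + 1 / (1 - eps N1 {N2, N3})) * R1 + R2 / (1 - eps N2 {N4}) \<le>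
              1 - G + (1 - eps N1 {N3, N4}) / (1 - eps N2 {N3, N4}) * G)})
     \<and>
     (max ((1 - eps N1 {N3, N4}) / (1 - eps N2 {N3, N4}))
            ((1 - eps N1 {N4}) / (1 - eps N2 {N4})) = (1 - eps N1 {N4}) / (1 - eps N2 {N4}) \<and>
      (1 - eps N1 {N4}) / (1 - eps N2 {N4}) > 1 \<longrightarrow>
        {(R1, R2). R1 \<ge> 0 \<and> R2 \<ge> 0 \<and> (\<exists>G\<ge>0. \<exists>S\<ge>0. \<exists>U\<ge>0.
            ((eps N1 {N3} - eps N1 {N2, N3}) / ((1 - eps N2 {N3}) * (1 - eps N1 {N2, N3}))
              + 1 / (1 - eps N1 {N2, N3})) * R1 + R2 / (1 - eps N2 {N3, N4}) \<le>
              1 - G - S - U + ((1 - eps N1 {N3}) / (1 - eps N2 {N3})) * (G + S) \<and>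
            ((eps N1 {N3, N4} - eps N1 {N2, N3, N4}) / ((1 - eps N1 {N2, N3, N4}) * (1 - eps N2 {N3, N4}))
              + 1 / (1 - eps N1 {N2, N3})) * R1 + R2 / (1 - eps N2 {N4}) \<le>
              1 - G - S - U + (1 - eps N1 {N3, N4}) / (1 - eps N2 {N3, N4}) * G
              + (1 - eps N1 {N4}) / (1 - eps N2 {N4}) * (S + U) \<and>
            (eps N2 {N3} - eps N2 {N3, N4}) * G + (1 - eps N2 {N3, N4}) * S \<le>
              ((eps N2 {N3} - eps N2 {N3, N4}) * (eps N1 {N3, N4} - eps N1 {N2, N3, N4}))
              / ((1 - eps N1 {N3, N4}) * (1 - eps N1 {N2, N3, N4})) * R1 \<and>
            (eps N2 {N3} - eps N2 {N3, N4}) * U \<le>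
              (((1 - eps N2 {N4}) * (1 - eps N1 {N3, N4})) / (1 - eps N1 {N4})
               - (eps N2 {N3} - eps N2 {N3, N4})) * S \<and>
            G + ((1 - eps N1 {N4}) * (1 - eps N2 {N3, N4}))
                / ((1 - eps N2 {N4}) * (1 - eps N1 {N3, N4})) * (U + S) \<le>
              (eps N1 {N3, N4} - eps N1 {N2, N3, N4}) / ((1 - eps N1 {N3, N4}) * (1 - eps N1 {N2, N3, N4})) * R1 \<and>
            S \<le> ((eps N2 {N3} - eps N2 {N3, N4}) * (eps N2 {N4} - eps N2 {N3, N4}))
                / ((1 - eps N1 {N3, N4}) * (1 - eps N2 {N4}) * (1 - eps N2 {N3, N4})) * R2)}
        \<subseteq> capacity_region TYPE('f) M Z)"
proof -
  interpret erasure_network M Z eps by fact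
  note eps3 = assms(2)
  show ?thesis
    unfolding gain34_def[symmetric] gain4_def[symmetric] gain3_def[symmetric] coef3_def[symmetric]
      coef4_def[symmetric] capG_def[symmetric]
  proof (intro conjI impI)
    assume "max gain34 gain4 \<le> 1"
    then show "capacity_region TYPE('f) M Z = {(R1, R2). R1 \<ge> 0 \<and> R2 \<ge> 0 \<and>
        coef3 * R1 + R2 / (1 - eps N2 {N3, N4}) \<le> 1 \<and> coef4 * R1 + R2 / (1 - eps N2 {N4}) \<le> 1}"
      by (intro capacity_region1 eps3) auto
  next
    assume "max gain34 gain4 = gain34 \<and> gain34 > 1"
    then show "capacity_region TYPE('f) M Z = {(R1, R2). R1 \<ge> 0 \<and> R2 \<ge> 0 \<and> (\<exists>G\<ge>0.
      G \<le> capG * R1 \<and> coef3 * R1 + R2 / (1 - eps N2 {N3, N4}) \<le> 1 - G + gain3 * G \<and>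
      coef4 * R1 + R2 / (1 - eps N2 {N4}) \<le> 1 - G + gain34 * G)}"
      by (intro capacity_region2 eps3) (auto simp: max_def split: if_splits)
  qed (rule capacity_region3[folded gain34_def gain4_def gain3_def coef3_def coef4_def capG_def], simp)
qed

end
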